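(* Let $H=H(N,M,k)=\langle a,b\mid a^M=b^N=e,\ bab^{-1}=a^k\rangle$, and assume that the multiplicative order $r$ of $k$ modulo $M$ equals $N$. Let $\phi:H\rightarrow\mathrm{GL}_n(K)$ be a faithful, absolutely irreducible representation of $H$ whose field of definition is the number field $K$. Then, at every finite place $\wp$ of $K$, the vertices of the local Bruhat-Tits building at $\wp$ that correspond to maximal orders containing $\phi(H)$ lie in a simplex (consider the simplex spanned by these vertices). This simplex is non-trivial (i.e., has more than one vertex) precisely at those places $\wp$ that are ramified in the extension $L/K$, where $L=K(\eta)$ for a primitive $M$-th root of unity $\eta$. In this case, the number of vertices of the corresponding simplex is the ramification index $e_\wp(L/K)$.
   Context: Here $N,M\ge 1$ are integers and $k$ is an integer coprime to $M$; $r$ is the order of the class of $k$ in $(\mathbb{Z}/M\mathbb{Z})^*$. A field of definition of a representation $\psi$ is a minimal field $K_0$ such that some conjugate of $\psi$ has image in $\mathrm{GL}_n(K_0)$. Any such field contains all values of the character $\chi_\psi$; when $\mathbb{Q}(\chi_\psi)$ is itself a field of definition, it is the unique one and is called the field of definition of $\psi$. For a local field $F$ with ring of integers $\mathcal{O}_F$ and uniformizer $\pi$, the Bruhat-Tits building is the simplicial complex having one vertex for every homothety class $[\Lambda]$ of full $\mathcal{O}_F$-lattices $\Lambda\subseteq F^n$, where classes $[\Lambda_1],\dots,[\Lambda_s]$ form a simplex if and only if, up to reordering and rescaling, $\pi\Lambda_s\subseteq\Lambda_1\subseteq\Lambda_2\subseteq\cdots\subseteq\Lambda_s$. The vertex $[\Lambda]$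 corresponds to the maximal order $\mathrm{End}_{\mathcal{O}_F}(\Lambda)\subseteq\mathbb{M}_n(F)$; this is a bijection between vertices and maximal orders of $\mathbb{M}_n(F)$. The local building at $\wp$ is the one for the completion $F=K_\wp$, and $\phi(H)$ is viewed inside $\mathrm{GL}_n(K_\wp)$. *)

theory Defs
  imports
    "Jordan_Normal_Form.VS_Connect"
    "HOL-Algebra.Generated_Fields"
    "HOL-Algebra.Embedded_Algebras"
    "HOL-Algebra.Ideal_Product"
    "HOL-Number_Theory.Residue_Primitive_Roots"
begin

section \<open>Groups given by generators and relators\<close>

text \<open>A letter \<open>(g, True)\<close> stands for the generator \<open>g\<close>, and \<open>(g, False)\<close> for its inverse.\<close>

type_synonym 'g word = "('g \<times> bool) list"

inductive word_eq :: "'g word set \<Rightarrow> 'g word \<Rightarrow> 'g word \<Rightarrow> bool" for R where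
  refl: "word_eq R u u"
| sym: "word_eq R u w \<Longrightarrow> word_eq R w u"
| trans: "word_eq R u w \<Longrightarrow> word_eq R w x \<Longrightarrow> word_eq R u x"
| append: "word_eq R u u' \<Longrightarrow> word_eq R w w' \<Longrightarrow> word_eq R (u @ w) (u' @ w')"
| cancel: "word_eq R [(g, s), (g, \<not> s)] []"
| relator: "u \<in> R \<Longrightarrow> word_eq R u []"

definition word_class :: "'g word set \<Rightarrow> 'g word \<Rightarrow> 'g word set" where
  "word_class R u = {w. word_eq R u w}"

definition presented_group :: "'g word set \<Rightarrow> 'g word set monoid" where
  "presented_group R =
    \<lparr>carrier = range (word_class R),
     monoid.mult = (\<lambda>X Y. \<Union>u\<in>X. \<Union>w\<in>Y. word_class R (u @ w)),
     one = word_class R []\<rparr>"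

definition word_pow :: "'g \<Rightarrow> int \<Rightarrow> 'g word" where
  "word_pow g i = replicate (nat \<bar>i\<bar>) (g, 0 \<le> i)"

datatype gen = Gen_a | Gen_b

definition metacyclic :: "nat \<Rightarrow> nat \<Rightarrow> int \<Rightarrow> gen word set monoid" where
  "metacyclic N M k = presented_group
    {word_pow Gen_a (int M),
     word_pow Gen_b (int N),
     word_pow Gen_b 1 @ word_pow Gen_a 1 @ word_pow Gen_b (-1) @ word_pow Gen_a (-k)}"

lemma word_class_eq_iff: "word_class R u = word_class R w \<longleftrightarrow> word_eq R u w"
proof
  assume "word_class R u = word_class R w"
  then have "w \<in> word_class R u"
    by (simp add: word_class_def word_eq.refl)
  then show "word_eq R u w"
    by (simp add: word_class_def)
next
  assume *: "word_eq R u w"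
  have "word_eq R u x \<longleftrightarrow> word_eq R w x" for x
    using word_eq.trans[OF *] word_eq.trans[OF word_eq.sym[OF *]] by blast
  then show "word_class R u = word_class R w"
    by (simp add: word_class_def)
qed

lemma presented_group_mult:
  "word_class R u \<otimes>\<^bsub>presented_group R\<^esub> word_class R w = word_class R (u @ w)"
proof -
  have "word_class R (u' @ w') = word_class R (u @ w)"
    if "u' \<in> word_class R u" "w' \<in> word_class R w" for u' w'
  proof -
    from that have "word_eq R u u'" "word_eq R w w'"
      by (simp_all add: word_class_def)
    then have "word_eq R (u @ w) (u' @ w')"
      by (rule word_eq.append)
    then show ?thesis
      unfolding word_class_eq_iff by (rule word_eq.sym)
  qed
  moreover have "u \<in> word_class R u" "w \<in> word_class R w"
    by (simp_all add: word_class_def word_eq.refl)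
  ultimately show ?thesis
    unfolding presented_group_def monoid.simps by blast
qed

lemma word_eq_inverse: "word_eq R (map (\<lambda>(g, s). (g, \<not> s)) (rev u) @ u) []"
proof (induction u)
  case Nil
  show ?case by (simp add: word_eq.refl)
next
  case (Cons x u)
  obtain g s where x: "x = (g, s)" by fastforce
  let ?i = "map (\<lambda>(g, s). (g, \<not> s)) (rev u)"
  have "word_eq R [(g, \<not> s), (g, s)] []"
    using word_eq.cancel[of R g "\<not> s"] by simp
  then have "word_eq R (?i @ ([(g, \<not> s), (g, s)] @ u)) (?i @ ([] @ u))"
    by (intro word_eq.append word_eq.refl)
  with Cons.IH show ?case
    by (simp add: x) (blast intro: word_eq.trans)
qed

lemma group_presented_group: "group (presented_group R)"
proof (rule groupI)
  show "\<one>\<^bsub>presented_group R\<^esub> \<in> carrier (presented_group R)"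
    by (simp add: presented_group_def)
next
  fix x y assume "x \<in> carrier (presented_group R)" "y \<in> carrier (presented_group R)"
  then obtain u w where "x = word_class R u" "y = word_class R w"
    by (auto simp: presented_group_def)
  then show "x \<otimes>\<^bsub>presented_group R\<^esub> y \<in> carrier (presented_group R)"
    by (simp add: presented_group_mult) (simp add: presented_group_def)
next
  fix x y z assume "x \<in> carrier (presented_group R)" "y \<in> carrier (presented_group R)"
    "z \<in> carrier (presented_group R)"
  then obtain u w t where "x = word_class R u" "y = word_class R w" "z = word_class R t"
    by (auto simp: presented_group_def)
  then show "x \<otimes>\<^bsub>presented_group R\<^esub> y \<otimes>\<^bsub>presented_group R\<^esub> z
      = x \<otimes>\<^bsub>presented_group R\<^esub> (y \<otimes>\<^bsub>presented_group R\<^esub> z)"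
    by (simp add: presented_group_mult)
next
  fix x assume "x \<in> carrier (presented_group R)"
  then obtain u where x: "x = word_class R u"
    by (auto simp: presented_group_def)
  have one: "\<one>\<^bsub>presented_group R\<^esub> = word_class R []"
    by (simp add: presented_group_def)
  show "\<one>\<^bsub>presented_group R\<^esub> \<otimes>\<^bsub>presented_group R\<^esub> x = x"
    by (simp add: one x presented_group_mult)
  have "word_class R (map (\<lambda>(g, s). (g, \<not> s)) (rev u)) \<in> carrier (presented_group R)"
    by (simp add: presented_group_def)
  moreover have "word_class R (map (\<lambda>(g, s). (g, \<not> s)) (rev u)) \<otimes>\<^bsub>presented_group R\<^esub> x
      = \<one>\<^bsub>presented_group R\<^esub>"
    by (simp add: one x presented_group_mult word_class_eq_iff word_eq_inverse)
  ultimately show "\<exists>y\<in>carrier (presented_group R).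
      y \<otimes>\<^bsub>presented_group R\<^esub> x = \<one>\<^bsub>presented_group R\<^esub>" by blast
qed


section \<open>Matrix representations over subfields of the complex numbers\<close>

definition matrices :: "'a::field set \<Rightarrow> nat \<Rightarrow> 'a mat ring" where
  "matrices E n = (ring_mat TYPE('a) n ()) \<lparr>carrier := {A \<in> carrier_mat n n. elements_mat A \<subseteq> E}\<rparr>"

definition GL :: "'a::field set \<Rightarrow> nat \<Rightarrow> 'a mat monoid" where
  "GL E n = units_of (matrices E n)"

definition is_subspace :: "'a::field set \<Rightarrow> nat \<Rightarrow> 'a vec set \<Rightarrow> bool" where
  "is_subspace E n W \<longleftrightarrow>
    W \<subseteq> {w \<in> carrier_vec n. set\<^sub>v w \<subseteq> E} \<and> 0\<^sub>v n \<in> W \<and>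
    (\<forall>u\<in>W. \<forall>w\<in>W. u + w \<in> W) \<and> (\<forall>c\<in>E. \<forall>w\<in>W. c \<cdot>\<^sub>v w \<in> W)"

definition irreducible_over ::
  "'a::field set \<Rightarrow> nat \<Rightarrow> ('g, 'c) monoid_scheme \<Rightarrow> ('g \<Rightarrow> 'a mat) \<Rightarrow> bool" where
  "irreducible_over E n G \<phi> \<longleftrightarrow> n > 0 \<and>
    (\<forall>W. is_subspace E n W \<and> (\<forall>h\<in>carrier G. \<forall>w\<in>W. \<phi> h *\<^sub>v w \<in> W) \<longrightarrow>
      W = {0\<^sub>v n} \<or> W = {w \<in> carrier_vec n. set\<^sub>v w \<subseteq> E})"

text \<open>
  The extension fields range over the fields between \<open>K\<close> and the complex numbers; these include
  an algebraic closure of \<open>K\<close>.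
\<close>
definition absolutely_irreducible ::
  "complex set \<Rightarrow> nat \<Rightarrow> ('g, 'c) monoid_scheme \<Rightarrow> ('g \<Rightarrow> complex mat) \<Rightarrow> bool" where
  "absolutely_irreducible K n G \<phi> \<longleftrightarrow>
    (\<forall>E. subfield E class_ring \<and> K \<subseteq> E \<longrightarrow> irreducible_over E n G \<phi>)"

definition character :: "('g \<Rightarrow> complex mat) \<Rightarrow> 'g \<Rightarrow> complex" where
  "character \<phi> h = (\<Sum>i<dim_row (\<phi> h). \<phi> h $$ (i, i))"

definition character_field ::
  "('g, 'c) monoid_scheme \<Rightarrow> ('g \<Rightarrow> complex mat) \<Rightarrow> complex set" where
  "character_field G \<phi> = generate_field class_ring (character \<phi> ` carrier G)"

definition realizable_over ::
  "complex set \<Rightarrow> nat \<Rightarrow> ('g, 'c) monoid_scheme \<Rightarrow> ('g \<Rightarrow> complex mat) \<Rightarrow> bool" where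
  "realizable_over E n G \<phi> \<longleftrightarrow>
    (\<exists>P\<in>carrier (GL UNIV n). \<forall>h\<in>carrier G. P * \<phi> h * inv\<^bsub>GL UNIV n\<^esub> P \<in> carrier (GL E n))"

definition is_field_of_definition ::
  "complex set \<Rightarrow> nat \<Rightarrow> ('g, 'c) monoid_scheme \<Rightarrow> ('g \<Rightarrow> complex mat) \<Rightarrow> bool" where
  "is_field_of_definition E n G \<phi> \<longleftrightarrow>
    subfield E class_ring \<and> realizable_over E n G \<phi> \<and>
    (\<forall>E'. subfield E' class_ring \<and> realizable_over E' n G \<phi> \<and> E' \<subseteq> E \<longrightarrow> E' = E)"

text \<open>
  There may be several minimal fields; one speaks of \<^emph>\<open>the\<close> field of definition when the field
  of character values is one of them (it is then the only one).
\<close>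
definition is_the_field_of_definition ::
  "complex set \<Rightarrow> nat \<Rightarrow> ('g, 'c) monoid_scheme \<Rightarrow> ('g \<Rightarrow> complex mat) \<Rightarrow> bool" where
  "is_the_field_of_definition E n G \<phi> \<longleftrightarrow>
    E = character_field G \<phi> \<and> is_field_of_definition E n G \<phi>"


section \<open>Number fields, finite places and ramification\<close>

definition number_field :: "complex set \<Rightarrow> bool" where
  "number_field K \<longleftrightarrow> subfield K class_ring \<and> ring.finite_dimension class_ring \<rat> K"

definition int_ring :: "complex set \<Rightarrow> complex ring" where
  "int_ring K = class_ring \<lparr>carrier := {x \<in> K. algebraic_int x}\<rparr>"

definition ideal_pow :: "('a, 'b) ring_scheme \<Rightarrow> 'a set \<Rightarrow> nat \<Rightarrow> 'a set" where
  "ideal_pow R I m = I [^]\<^bsub>ideals_set R\<^esub> m"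

definition finite_place :: "complex set \<Rightarrow> complex set \<Rightarrow> bool" where
  "finite_place K p \<longleftrightarrow> primeideal p (int_ring K) \<and> p \<noteq> {0}"

definition lies_over :: "complex set \<Rightarrow> complex set \<Rightarrow> complex set \<Rightarrow> complex set \<Rightarrow> bool" where
  "lies_over L q K p \<longleftrightarrow> finite_place L q \<and> q \<inter> K = p"

text \<open>The ramification index of a prime \<open>q\<close> of \<open>L\<close> over a prime \<open>p\<close> of a subfield: the exponent
  of \<open>q\<close> in the ideal generated by \<open>p\<close>.\<close>
definition ramification_index :: "complex set \<Rightarrow> complex set \<Rightarrow> complex set \<Rightarrow> nat" where
  "ramification_index L q p =
    (GREATEST m. genideal (int_ring L) p \<subseteq> ideal_pow (int_ring L) q m)"

definition ramified :: "complex set \<Rightarrow> complex set \<Rightarrow> complex set \<Rightarrow> bool" where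
  "ramified L K p \<longleftrightarrow> (\<exists>q. lies_over L q K p \<and> ramification_index L q p > 1)"


section \<open>Completion at a finite place\<close>

text \<open>
  The completion is characterised (up to isomorphism) as a field, given as a whole type, that is
  complete for a discrete valuation \<open>v\<close> and in which \<open>K\<close> embeds densely, with \<open>v\<close> extending
  the normalised \<open>p\<close>-adic valuation.
  It suffices to prescribe \<open>v\<close> on the nonzero algebraic integers of \<open>K\<close>. The value \<open>v 0\<close> is irrelevant.
\<close>

definition val_close :: "('f::field \<Rightarrow> int) \<Rightarrow> int \<Rightarrow> 'f \<Rightarrow> 'f \<Rightarrow> bool" where
  "val_close v m x y \<longleftrightarrow> x = y \<or> m \<le> v (x - y)"

locale completion_at =
  fixes K p :: "complex set" and \<iota> :: "complex \<Rightarrow> 'f::field" and v :: "'f \<Rightarrow> int"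
  assumes embedding: "\<iota> \<in> Ring.ring_hom (class_ring \<lparr>carrier := K\<rparr>) class_ring"
    and v_mult: "x \<noteq> 0 \<Longrightarrow> y \<noteq> 0 \<Longrightarrow> v (x * y) = v x + v y"
    and v_add: "x \<noteq> 0 \<Longrightarrow> y \<noteq> 0 \<Longrightarrow> x + y \<noteq> 0 \<Longrightarrow> min (v x) (v y) \<le> v (x + y)"
    and v_extends: "a \<in> carrier (int_ring K) \<Longrightarrow> a \<noteq> 0 \<Longrightarrow>
      v (\<iota> a) = int (GREATEST m. a \<in> ideal_pow (int_ring K) p m)"
    and dense: "\<exists>a\<in>K. val_close v m x (\<iota> a)"
    and complete: "\<forall>m. \<exists>i\<^sub>0. \<forall>i\<ge>i\<^sub>0. \<forall>j\<ge>i\<^sub>0. val_close v m ((s :: nat \<Rightarrow> 'f) i) (s j) \<Longrightarrow>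
      \<exists>l. \<forall>m. \<exists>i\<^sub>0. \<forall>i\<ge>i\<^sub>0. val_close v m (s i) l"

definition val_ring :: "('f::field \<Rightarrow> int) \<Rightarrow> 'f set" where
  "val_ring v = {x. x = 0 \<or> 0 \<le> v x}"

definition uniformizer :: "('f::field \<Rightarrow> int) \<Rightarrow> 'f \<Rightarrow> bool" where
  "uniformizer v \<pi> \<longleftrightarrow> \<pi> \<noteq> 0 \<and> v \<pi> = 1"


section \<open>Lattices, maximal orders and the Bruhat-Tits building\<close>

definition vec_span :: "'f::field set \<Rightarrow> nat \<Rightarrow> nat \<Rightarrow> (nat \<Rightarrow> 'f vec) \<Rightarrow> 'f vec set" where
  "vec_span R n m b = {vec n (\<lambda>r. \<Sum>i<m. c i * b i $ r) | c. \<forall>i<m. c i \<in> R}"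

definition full_lattice :: "('f::field \<Rightarrow> int) \<Rightarrow> nat \<Rightarrow> 'f vec set \<Rightarrow> bool" where
  "full_lattice v n \<Lambda> \<longleftrightarrow> (\<exists>m b. (\<forall>i<m. b i \<in> carrier_vec n) \<and>
    \<Lambda> = vec_span (val_ring v) n m b \<and> vec_span UNIV n m b = carrier_vec n)"

definition mat_span :: "'f::field set \<Rightarrow> nat \<Rightarrow> nat \<Rightarrow> (nat \<Rightarrow> 'f mat) \<Rightarrow> 'f mat set" where
  "mat_span R n m B = {mat n n (\<lambda>(r, s). \<Sum>i<m. c i * B i $$ (r, s)) | c. \<forall>i<m. c i \<in> R}"

definition is_order :: "('f::field \<Rightarrow> int) \<Rightarrow> nat \<Rightarrow> 'f mat set \<Rightarrow> bool" where
  "is_order v n D \<longleftrightarrow>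
    (\<exists>m B. (\<forall>i<m. B i \<in> carrier_mat n n) \<and>
      D = mat_span (val_ring v) n m B \<and> mat_span UNIV n m B = carrier_mat n n) \<and>
    1\<^sub>m n \<in> D \<and> (\<forall>A\<in>D. \<forall>B\<in>D. A * B \<in> D)"

definition maximal_order :: "('f::field \<Rightarrow> int) \<Rightarrow> nat \<Rightarrow> 'f mat set \<Rightarrow> bool" where
  "maximal_order v n D \<longleftrightarrow> is_order v n D \<and> (\<forall>D'. is_order v n D' \<and> D \<subseteq> D' \<longrightarrow> D' = D)"

definition lattice_End :: "nat \<Rightarrow> 'f::field vec set \<Rightarrow> 'f mat set" where
  "lattice_End n \<Lambda> = {A \<in> carrier_mat n n. \<forall>x\<in>\<Lambda>. A *\<^sub>v x \<in> \<Lambda>}"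

definition scale :: "'f::field \<Rightarrow> 'f vec set \<Rightarrow> 'f vec set" where
  "scale c \<Lambda> = (\<lambda>x. c \<cdot>\<^sub>v x) ` \<Lambda>"

definition homothety_class :: "'f::field vec set \<Rightarrow> 'f vec set set" where
  "homothety_class \<Lambda> = {scale c \<Lambda> | c. c \<noteq> 0}"

definition bt_vertices :: "('f::field \<Rightarrow> int) \<Rightarrow> nat \<Rightarrow> 'f vec set set set" where
  "bt_vertices v n = homothety_class ` {\<Lambda>. full_lattice v n \<Lambda>}"

text \<open>
  The sequence \<open>\<Lambda>\<close> provides the ordering and the rescaled representatives of the classes in \<open>S\<close>.
  Repetitions are harmless, as \<open>S\<close> is the set of classes.
\<close>
definition bt_simplex :: "('f::field \<Rightarrow> int) \<Rightarrow> 'f \<Rightarrow> nat \<Rightarrow> 'f vec set set set \<Rightarrow> bool" where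
  "bt_simplex v \<pi> n S \<longleftrightarrow> (\<exists>s \<Lambda>. s \<ge> (1::nat) \<and> (\<forall>i\<in>{1..s}. full_lattice v n (\<Lambda> i)) \<and>
    S = (\<lambda>i. homothety_class (\<Lambda> i)) ` {1..s} \<and>
    scale \<pi> (\<Lambda> s) \<subseteq> \<Lambda> 1 \<and> (\<forall>i\<in>{1..<s}. \<Lambda> i \<subseteq> \<Lambda> (i + 1)))"

definition vertex_of_order ::
  "('f::field \<Rightarrow> int) \<Rightarrow> nat \<Rightarrow> 'f vec set set \<Rightarrow> 'f mat set \<Rightarrow> bool" where
  "vertex_of_order v n V D \<longleftrightarrow>
    (\<exists>\<Lambda>. full_lattice v n \<Lambda> \<and> V = homothety_class \<Lambda> \<and> D = lattice_End n \<Lambda>)"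

definition vertices_containing :: "('f::field \<Rightarrow> int) \<Rightarrow> nat \<Rightarrow> 'f mat set \<Rightarrow> 'f vec set set set" where
  "vertices_containing v n X = {V \<in> bt_vertices v n.
    \<exists>D. maximal_order v n D \<and> vertex_of_order v n V D \<and> X \<subseteq> D}"

end

theory Submission
  imports Defs "Jordan_Normal_Form.Spectral_Radius"
begin

text \<open>
  A left eigenvector of \<open>\<phi>(a)\<close>, scaled to take the value \<open>1\<close> on a \<open>b\<close>-invariant vector, identifies
  \<open>K\<^sup>n\<close> with the cyclotomic field \<open>L\<close>, where \<open>a\<close> acts as multiplication by a primitive \<open>M\<close>-th root of
  unity \<open>z\<close> and \<open>b\<close> as the automorphism \<open>\<sigma>\<close> with \<open>\<sigma>(z) = z\<^sup>k\<close>; the character formula gives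
  \<open>K = L\<^sup>\<sigma>\<close>. So the stable lattices are the \<open>\<sigma>\<close>-stable fractional ideals of \<open>\<int>[z]\<close> localised at the
  place. If \<open>p\<close> is the residue characteristic, the radical of \<open>p \<int>[z]\<close> is generated by an element
  \<open>l\<close> with \<open>\<sigma>(l) \<int>[z] = l \<int>[z]\<close>, and \<open>x\<^sup>Q \<equiv> x\<close> modulo \<open>l\<close> for a suitable power \<open>Q\<close> of \<open>p\<close>. This
  congruence shows that \<open>\<int>[z]\<close> is integrally closed, and that every \<open>\<sigma>\<close>-stable fractional ideal
  is generated by a power of \<open>l\<close>. Hence the stable lattices form a chain \<open>\<dots> \<supset> l\<^sup>c\<Lambda> \<supset> l\<^sup>c\<^sup>+\<^sup>1\<Lambda> \<supset> \<dots>\<close>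
  on which a uniformizer of \<open>K\<close> acts as the shift by the ramification index.
\<close>

hide_const (open) up_ring.coeff up_ring.monom

section \<open>Congruences in subrings of the complex numbers\<close>

text \<open>There may be several primes of L above the place, and a lattice could a priori weigh
  them differently. Stability under b forbids this: \<sigma> permutes them transitively, so a single
  exponent describes a stable module, and one element l that lies in all of them can serve as a
  gauge. For the same reason the localisation inverts elements of K only, and no prime of L is
  singled out until the ramification index is computed.

  The hypothesis r = N makes the N conjugates of z distinct. Hence [L:K] = N, a trace computation
  gives n = N, and K^n is one copy of L, with no multiplicity left.

  The completion of L is never formed: a lattice over the completion of K is recovered by density
  from its intersection with K^n. The link with \<open>v\<close> needs care, since \<open>v\<close>
  is prescribed on K as a greatest exponent, which says nothing until one is known to exist; the
  congruence x^Q = x settles this by making prime ideals above the residue characteristic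
  maximal.\<close>

definition cgr :: "complex set \<Rightarrow> complex \<Rightarrow> complex \<Rightarrow> complex \<Rightarrow> bool" where
  "cgr R c x y \<longleftrightarrow> (\<exists>r\<in>R. x - y = c * r)"

text \<open>Rings are plain sets of complex numbers, so that identities are proved by complex
  arithmetic; \<open>sub_ring\<close> later turns such a set into a ring record where ideals are
  needed.\<close>

locale csubring =
  fixes R :: "complex set"
  assumes one_in: "1 \<in> R"
    and add_in: "x \<in> R \<Longrightarrow> y \<in> R \<Longrightarrow> x + y \<in> R"
    and mult_in: "x \<in> R \<Longrightarrow> y \<in> R \<Longrightarrow> x * y \<in> R"
    and minus_in: "x \<in> R \<Longrightarrow> - x \<in> R"
begin

lemma diff_in: "x \<in> R \<Longrightarrow> y \<in> R \<Longrightarrow> x - y \<in> R"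
  using add_in[of x "- y"] minus_in by simp

lemma zero_in: "0 \<in> R"
  using diff_in[OF one_in one_in] by simp

lemma power_in: "x \<in> R \<Longrightarrow> x ^ i \<in> R"
  by (induction i) (auto intro: one_in mult_in)

lemma sum_in: "(\<And>i. i \<in> I \<Longrightarrow> f i \<in> R) \<Longrightarrow> sum f I \<in> R"
  by (induction I rule: infinite_finite_induct) (auto intro: zero_in add_in)

lemma prod_in: "(\<And>i. i \<in> I \<Longrightarrow> f i \<in> R) \<Longrightarrow> prod f I \<in> R"
  by (induction I rule: infinite_finite_induct) (auto intro: one_in mult_in)

lemma of_nat_in: "of_nat i \<in> R"
  by (induction i) (auto intro: zero_in one_in add_in)

lemma of_int_in: "of_int i \<in> R"
  by (cases i) (auto intro: of_nat_in minus_in simp del: of_nat_Suc)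

lemma poly_in:
  "(\<And>i. coeff f i \<in> R) \<Longrightarrow> x \<in> R \<Longrightarrow> poly f x \<in> R"
  unfolding poly_altdef by (intro sum_in mult_in power_in)

lemma cgr_refl: "cgr R c x x"
  unfolding cgr_def using zero_in by (auto intro!: bexI[of _ 0])

lemma cgr_sym: "cgr R c x y \<Longrightarrow> cgr R c y x"
  unfolding cgr_def using minus_in by (auto intro!: bexI[of _ "- _"] simp: algebra_simps)

lemma cgr_trans: "cgr R c x y \<Longrightarrow> cgr R c y w \<Longrightarrow> cgr R c x w"
proof -
  assume "cgr R c x y" "cgr R c y w"
  then obtain r s where "r \<in> R" "s \<in> R" "x - y = c * r" "y - w = c * s"
    by (auto simp: cgr_def)
  then show ?thesis
    unfolding cgr_def by (intro bexI[of _ "r + s"] add_in) (auto simp: algebra_simps)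
qed

lemma cgr_add: "cgr R c x y \<Longrightarrow> cgr R c x' y' \<Longrightarrow> cgr R c (x + x') (y + y')"
proof -
  assume "cgr R c x y" "cgr R c x' y'"
  then obtain r s where "r \<in> R" "s \<in> R" "x - y = c * r" "x' - y' = c * s"
    by (auto simp: cgr_def)
  then show ?thesis
    unfolding cgr_def by (intro bexI[of _ "r + s"] add_in) (auto simp: algebra_simps)
qed

lemma cgr_mult:
  assumes "cgr R c x y" "cgr R c x' y'" "x' \<in> R" "y \<in> R"
  shows "cgr R c (x * x') (y * y')"
proof -
  obtain r s where *: "r \<in> R" "s \<in> R" "x - y = c * r" "x' - y' = c * s"
    using assms by (auto simp: cgr_def)
  have "x * x' - y * y' = (x - y) * x' + y * (x' - y')"
    by (simp add: algebra_simps)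
  also have "\<dots> = c * (r * x' + y * s)"
    unfolding * by (simp add: algebra_simps)
  finally show ?thesis
    unfolding cgr_def using * assms by (blast intro: add_in mult_in)
qed

lemma cgr_power:
  assumes "cgr R c x y" "x \<in> R" "y \<in> R"
  shows "cgr R c (x ^ i) (y ^ i)"
proof (induction i)
  case 0
  show ?case by (simp add: cgr_refl)
next
  case (Suc i)
  then show ?case using assms by (auto intro!: cgr_mult power_in)
qed

lemma cgr_weaken:
  assumes "cgr R c x y" "c = c' * s" "s \<in> R"
  shows "cgr R c' x y"
proof -
  obtain r where "r \<in> R" "x - y = c * r"
    using assms by (auto simp: cgr_def)
  then show ?thesis
    unfolding cgr_def by (intro bexI[of _ "s * r"] mult_in) (use assms in \<open>auto simp: mult.assoc\<close>)
qed

lemma freshman: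
  assumes p: "prime (p::nat)" and x: "x \<in> R" and y: "y \<in> R"
  shows "cgr R (of_nat p) ((x + y) ^ p) (x ^ p + y ^ p)"
proof -
  have p0: "p > 0" using p by (rule prime_gt_0_nat)
  let ?t = "\<lambda>i. of_nat (p choose i) * x ^ i * y ^ (p - i)"
  have "(x + y) ^ p = (\<Sum>i\<le>p. ?t i)"
    by (simp add: binomial_ring)
  also have "{..p} = insert 0 (insert p {1..<p})"
    using p0 by auto
  also have "sum ?t \<dots> = y ^ p + (x ^ p + (\<Sum>i\<in>{1..<p}. ?t i))"
    using p0 by simp
  also have "(\<Sum>i\<in>{1..<p}. ?t i) =
      (\<Sum>i\<in>{1..<p}. of_nat p * (of_nat ((p choose i) div p) * x ^ i * y ^ (p - i)))"
  proof (rule sum.cong)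
    fix i assume "i \<in> {1..<p}"
    then have "p dvd (p choose i)"
      using p by (intro dvd_choose_prime) auto
    then have "p choose i = p * ((p choose i) div p)"
      by simp
    then have "of_nat (p choose i) = (of_nat p * of_nat ((p choose i) div p) :: complex)"
      by (metis of_nat_mult)
    then show "?t i = of_nat p * (of_nat ((p choose i) div p) * x ^ i * y ^ (p - i))"
      by (simp add: mult.assoc)
  qed simp
  also have "\<dots> = of_nat p * (\<Sum>i\<in>{1..<p}. of_nat ((p choose i) div p) * x ^ i * y ^ (p - i))"
    by (simp add: sum_distrib_left)
  finally have "(x + y) ^ p - (x ^ p + y ^ p)
      = of_nat p * (\<Sum>i\<in>{1..<p}. of_nat ((p choose i) div p) * x ^ i * y ^ (p - i))"
    by simp
  moreover have "(\<Sum>i\<in>{1..<p}. of_nat ((p choose i) div p) * x ^ i * y ^ (p - i)) \<in> R"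
    using x y by (intro sum_in mult_in power_in of_nat_in)
  ultimately show ?thesis
    unfolding cgr_def by blast
qed

lemma fermat_int:
  assumes p: "prime (p::nat)"
  shows "cgr R (of_nat p) (of_int a ^ p) (of_int a)"
proof -
  have nat: "[n ^ p = n] (mod p)" for n :: nat
  proof (cases "p dvd n")
    case True
    then have "p dvd n ^ p" using p by (meson dvd_power prime_gt_0_nat dvd_trans)
    with True show ?thesis by (metis cong_0_iff cong_sym cong_trans)
  next
    case False
    then have "[n ^ (p - 1) = 1] (mod p)" using p by (intro fermat_theorem) auto
    then have "[n ^ (p - 1) * n = 1 * n] (mod p)" by (rule cong_scalar_right)
    then show ?thesis using prime_gt_0_nat[OF p]
      by (metis Suc_diff_1 mult_1 power_Suc2)
  qed
  define n where "n = nat (a mod int p)"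
  have n: "[a = int n] (mod int p)"
    using prime_gt_0_nat[OF p] by (simp add: n_def cong_def)
  have "[a ^ p = int n ^ p] (mod int p)" using n by (rule cong_pow)
  also have "[int n ^ p = int n] (mod int p)"
    using nat[of n] by (metis cong_int_iff of_nat_power)
  also have "[int n = a] (mod int p)" using n by (rule cong_sym)
  finally obtain c where "a ^ p - a = int p * c"
    by (auto simp: cong_iff_dvd_diff dvd_def)
  then have "of_int a ^ p - of_int a = (of_nat p * of_int c :: complex)"
    by (metis of_int_diff of_int_mult of_int_of_nat_eq of_int_power)
  then show ?thesis
    unfolding cgr_def using of_int_in by blast
qed

end


section \<open>The ring generated by a root of unity\<close>

abbreviation ip :: "int poly \<Rightarrow> complex \<Rightarrow> complex" where
  "ip f z \<equiv> poly (map_poly of_int f) z"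

lemma ip_add: "ip (f + g) z = ip f z + ip g z"
  by (simp add: of_int_poly_hom.hom_add)

lemma ip_mult: "ip (f * g) z = ip f z * ip g z"
  by (simp add: of_int_poly_hom.hom_mult)

lemma ip_minus: "ip (- f) z = - ip f z"
  by (simp add: of_int_poly_hom.hom_uminus)

lemma ip_pCons: "ip (pCons a f) z = of_int a + z * ip f z"
  by (simp add: Polynomial.map_poly_pCons)

lemma ip_monom: "ip (monom a i) z = of_int a * z ^ i"
  by (simp add: map_poly_monom Polynomial.poly_monom)

lemma ip_smult: "ip (smult a f) z = of_int a * ip f z"
  by (simp add: Polynomial.map_poly_smult)

definition zring :: "complex \<Rightarrow> complex set" where
  "zring z = range (\<lambda>f. ip f z)"

lemma zringI: "ip f z \<in> zring z"
  by (auto simp: zring_def)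

lemma csubring_zring: "csubring (zring z)"
proof
  show "1 \<in> zring z"
    using zringI[of 1 z] by simp
next
  fix x y assume "x \<in> zring z" "y \<in> zring z"
  then obtain f g where "x = ip f z" "y = ip g z" by (auto simp: zring_def)
  then show "x + y \<in> zring z" "x * y \<in> zring z" "- x \<in> zring z"
    using zringI[of "f + g" z] zringI[of "f * g" z] zringI[of "- f" z]
    by (simp_all add: ip_add ip_mult ip_minus del: hom_distribs)
qed

interpretation zr: csubring "zring z" for z
  by (rule csubring_zring)

lemma self_in_zring: "z \<in> zring z"
  using zringI[of "[:0, 1:]" z] by (simp add: ip_pCons)

lemma ip_in_zring: "x \<in> zring z \<Longrightarrow> ip f x \<in> zring z"
  by (intro zr.poly_in) (auto simp: coeff_map_poly intro: zr.of_int_in)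

lemma zring_subset: "x \<in> zring z \<Longrightarrow> zring x \<subseteq> zring z"
  by (auto simp: zring_def[of x] intro: ip_in_zring)

text \<open>Horner's rule reduces this to \<open>freshman\<close> for the sum and to Fermat for the
  integer coefficients. It serves twice: in the proof that conjugation is well defined and,
  iterated, as the source of the congruence x^Q = x modulo l.\<close>

lemma frobenius_poly:
  assumes p: "prime (p::nat)" and z: "x \<in> zring z"
  shows "cgr (zring z) (of_nat p) (ip f x ^ p) (ip f (x ^ p))"
proof (induction f)
  case 0
  then show ?case using prime_gt_0_nat[OF p] by (simp add: zr.cgr_refl power_0_left)
next
  case (pCons a f)
  have "cgr (zring z) (of_nat p) (ip (pCons a f) x ^ p) (of_int a ^ p + (x * ip f x) ^ p)"
    unfolding ip_pCons by (intro zr.freshman p zr.of_int_in zr.mult_in z ip_in_zring)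
  moreover have "cgr (zring z) (of_nat p) (of_int a ^ p + (x * ip f x) ^ p)
      (of_int a + x ^ p * ip f (x ^ p))"
    unfolding power_mult_distrib
    by (intro zr.cgr_add zr.fermat_int p zr.cgr_mult zr.cgr_refl pCons.IH zr.power_in ip_in_zring z)
  ultimately show ?case
    unfolding ip_pCons by (rule zr.cgr_trans)
qed

lemma frobenius_poly_iter:
  assumes p: "prime (p::nat)" and x: "x \<in> zring z"
  shows "cgr (zring z) (of_nat p) (ip f x ^ (p ^ j)) (ip f (x ^ (p ^ j)))"
proof (induction j)
  case 0
  show ?case by (simp add: zr.cgr_refl)
next
  case (Suc j)
  have "cgr (zring z) (of_nat p) ((ip f x ^ (p ^ j)) ^ p) ((ip f (x ^ (p ^ j))) ^ p)"
    by (intro zr.cgr_power Suc zr.power_in ip_in_zring x)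
  moreover have "cgr (zring z) (of_nat p) ((ip f (x ^ (p ^ j))) ^ p) (ip f ((x ^ (p ^ j)) ^ p))"
    by (intro frobenius_poly p zr.power_in x)
  ultimately show ?case
    by (simp add: power_mult[symmetric] mult.commute) (rule zr.cgr_trans)
qed

lemma cgr_ip:
  assumes "cgr (zring z) c x y" "x \<in> zring z" "y \<in> zring z"
  shows "cgr (zring z) c (ip f x) (ip f y)"
  by (induction f) (use assms in \<open>auto simp: ip_pCons intro!: zr.cgr_refl zr.cgr_add zr.cgr_mult ip_in_zring\<close>)


text \<open>Multiplication by x acts on 1, z, ..., z^(M-1) through an integer matrix, of which the
  vector of these powers is an eigenvector; so x is a root of a monic integer polynomial. The powers
  may be linearly dependent; it is enough that the eigenvector has first entry 1.\<close>

lemma zring_algebraic_int: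
  assumes M: "M \<ge> (1::nat)" and zM: "z ^ M = 1" and x: "x \<in> zring z"
  shows "algebraic_int x"
proof -
  obtain f where f: "x = ip f z" using x by (auto simp: zring_def)
  \<comment> \<open>Exponents are reduced modulo M: row i collects the coefficients of f so that x
    z^i is the sum of the c i j z^j.\<close>
  define c where "c i j = (\<Sum>l\<in>{l. l \<le> degree f \<and> (i + l) mod M = j}. coeff f l)" for i j
  define A :: "int mat" where "A = mat M M (\<lambda>(i, j). c i j)"
  define v where "v = vec M (\<lambda>j. z ^ j)"
  have A: "A \<in> carrier_mat M M" by (simp add: A_def)
  have zmod: "z ^ (i mod M) = z ^ i" for i
  proof -
    have "z ^ i = z ^ (M * (i div M) + i mod M)" by simp
    also have "\<dots> = z ^ (i mod M)" unfolding power_add power_mult zM by simp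
    finally show ?thesis by simp
  qed
  have row: "(\<Sum>j<M. of_int (c i j) * z ^ j) = x * z ^ i" for i
  proof -
    have "(\<Sum>j<M. of_int (c i j) * z ^ j)
        = (\<Sum>j<M. \<Sum>l\<in>{l. l \<le> degree f \<and> (i + l) mod M = j}. of_int (coeff f l) * z ^ j)"
      by (simp add: c_def sum_distrib_right)
    also have "\<dots> = (\<Sum>j<M. \<Sum>l\<in>{l. l \<le> degree f \<and> (i + l) mod M = j}. of_int (coeff f l) * z ^ (i + l))"
      by (intro sum.cong) (auto simp: zmod)
    also have "\<dots> = (\<Sum>j<M. \<Sum>l\<in>{l\<in>{..degree f}. (i + l) mod M = j}. of_int (coeff f l) * z ^ (i + l))"
      by simp
    also have "\<dots> = (\<Sum>l\<in>{..degree f}. of_int (coeff f l) * z ^ (i + l))"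
      by (rule sum.group) (use M in auto)
    also have "\<dots> = x * z ^ i"
      unfolding f poly_altdef sum_distrib_right
      by (intro sum.mono_neutral_cong_right)
         (auto simp: power_add coeff_map_poly degree_map_poly intro: coeff_eq_0)
    finally show ?thesis .
  qed
  have "eigenvector (map_mat of_int A) v x"
    unfolding eigenvector_def
  proof (intro conjI)
    show "v \<in> carrier_vec (dim_row (map_mat of_int A))" by (simp add: v_def A_def)
    have "v $ 0 = 1" using M by (simp add: v_def)
    then show "v \<noteq> 0\<^sub>v (dim_row (map_mat of_int A))" using M by (auto simp: A_def)
    show "map_mat of_int A *\<^sub>v v = x \<cdot>\<^sub>v v"
    proof (intro eq_vecI)
      fix i assume "i < dim_vec (x \<cdot>\<^sub>v v)"
      then have i: "i < M" by (simp add: v_def)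
      have "(map_mat of_int A *\<^sub>v v) $ i = (\<Sum>j<M. of_int (c i j) * z ^ j)"
        using i by (simp add: A_def v_def scalar_prod_def atLeast0LessThan)
      then show "(map_mat of_int A *\<^sub>v v) $ i = (x \<cdot>\<^sub>v v) $ i"
        using i by (simp add: row v_def)
    qed (simp add: A_def v_def)
  qed
  then have "poly (char_poly (map_mat of_int A)) x = 0"
    using eigenvalue_root_char_poly[of "map_mat of_int A :: complex mat" M x] A
    by (auto simp: eigenvalue_def)
  then have "ip (char_poly A) x = 0"
    by (simp add: of_int_hom.char_poly_hom[OF A])
  moreover have "lead_coeff (char_poly A) = 1"
    using degree_monic_char_poly[OF A] by simp
  ultimately have "\<exists>p. ip p x = 0 \<and> lead_coeff p = 1"
    by blast
  then show ?thesis
    by (simp only: algebraic_int_altdef_ipoly)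
qed

lemma zring_Rats:
  assumes "M \<ge> (1::nat)" "z ^ M = 1" "x \<in> zring z" "x \<in> \<rat>"
  shows "x \<in> \<int>"
  using zring_algebraic_int[OF assms(1-3)] assms(4) by (rule rational_algebraic_int_is_int)

text \<open>In a monic equation for x, powers of the variable are cancelled until the constant term
  is nonzero; that term is a multiple of x.\<close>

lemma zring_dvd_int:
  assumes "M \<ge> (1::nat)" "z ^ M = 1" "x \<in> zring z" "x \<noteq> 0"
  shows "\<exists>y\<in>zring z. \<exists>n::int. n \<noteq> 0 \<and> x * y = of_int n"
proof -
  obtain F where F: "ip F x = 0" "lead_coeff F = 1"
    using zring_algebraic_int[OF assms(1-3)] unfolding algebraic_int_altdef_ipoly by (elim exE conjE)
  from F(2) have "F \<noteq> 0" by (metis leading_coeff_0_iff zero_neq_one)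
  with F(1) show ?thesis
  proof (induction F)
    case (pCons a F)
    show ?case
    proof (cases "a = 0")
      case True
      then show ?thesis using pCons \<open>x \<noteq> 0\<close> by (auto simp: ip_pCons)
    next
      case False
      have "x * (- ip F x) = of_int a"
        using pCons.prems(1) by (simp add: ip_pCons add_eq_0_iff)
      with False show ?thesis
        by (intro bexI[of _ "- ip F x"]) (auto intro!: zr.minus_in ip_in_zring assms(3))
    qed
  qed simp
qed


section \<open>Irreducibility of the cyclotomic polynomials\<close>

text \<open>The polynomial h is a prime factor, vanishing at z, of an integer polynomial of least
  degree that vanishes at z. Pseudo-division gives h | c f with a nonzero integer c, and primality
  passes from c f to f, since a divisor of c cannot vanish at z. Working with a prime element over
  the integers keeps all cofactors integral.\<close>

lemma minimal_int_poly:
  assumes g: "g \<noteq> 0" "ip g z = 0"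
  obtains h where "ip h z = 0" "h \<noteq> 0" "\<And>f. ip f z = 0 \<Longrightarrow> h dvd f"
proof -
  define P where "P h \<longleftrightarrow> h \<noteq> 0 \<and> ip h z = 0" for h :: "int poly"
  obtain h0 where h0: "P h0" "\<And>f. P f \<Longrightarrow> degree h0 \<le> degree f"
    using ex_has_least_nat[of P g degree] g unfolding P_def by blast
  have "\<exists>h. prime_elem h \<and> h dvd h0 \<and> ip h z = 0"
    using h0(1)
  proof (induction h0 rule: prime_divisors_induct)
    case zero
    then show ?case by (simp add: P_def)
  next
    case (unit x)
    then obtain c where "x = [:c:]" "c dvd 1" by (auto simp: is_unit_poly_iff)
    with unit show ?case by (auto simp: P_def ip_pCons)
  next
    case (factor p x)
    show ?case
    proof (cases "ip p z = 0")
      case True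
      with factor show ?thesis by auto
    next
      case False
      then have "P x" using factor(3) by (auto simp: P_def ip_mult simp del: hom_distribs)
      with factor show ?thesis by auto
    qed
  qed
  then obtain h where h: "prime_elem h" "h dvd h0" "ip h z = 0" by blast
  have h_nz: "h \<noteq> 0" using h(1) by auto
  have min: "degree h \<le> degree f" if "P f" for f
    using h0 that dvd_imp_degree_le[OF h(2)] unfolding P_def by (meson order_trans)
  have "h dvd f" if f: "ip f z = 0" for f
  proof -
    obtain q r where qr: "pseudo_divmod f h = (q, r)" by fastforce
    define c where "c = coeff h (degree h) ^ (Suc (degree f) - degree h)"
    have *: "smult c f = h * q + r" "r = 0 \<or> degree r < degree h"
      using pseudo_divmod[OF h_nz qr] by (auto simp: c_def)
    have "ip (smult c f) z = ip (h * q + r) z" by (simp only: *)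
    then have "ip r z = 0" using f h(3) by (simp add: ip_add ip_mult ip_smult del: hom_distribs)
    with *(2) min[of r] have "r = 0" unfolding P_def by (meson linorder_not_less)
    then have "h dvd [:c:] * f" using *(1) by auto
    then have "h dvd [:c:] \<or> h dvd f"
      using h(1) prime_elem_dvd_mult_iff by blast
    moreover have "\<not> h dvd [:c:]"
    proof
      assume "h dvd [:c:]"
      then obtain u where "[:c:] = h * u" ..
      then have "ip [:c:] z = 0" using h(3) by (simp add: ip_mult del: hom_distribs)
      then show False using h_nz by (auto simp: ip_pCons c_def)
    qed
    ultimately show ?thesis by blast
  qed
  with that h h_nz show ?thesis by blast
qed

text \<open>Dedekind's argument without reduction to a finite field. If h(w) were nonzero for w =
  z^p, the derivative of X^M - 1 = h g at w would be h(w) g'(w), and h(w) lies in p Z[z] by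
  Frobenius. Then M / p would be a rational element of Z[z], hence an integer.\<close>

lemma conj_prime_power:
  assumes M: "M \<ge> (1::nat)" and zM: "z ^ M = 1" and p: "prime (p::nat)" and pM: "\<not> p dvd M"
    and h: "ip h z = 0" "\<And>f. ip f z = 0 \<Longrightarrow> h dvd f"
  shows "ip h (z ^ p) = 0"
proof (rule ccontr)
  assume nz: "ip h (z ^ p) \<noteq> 0"
  define X where "X = (monom 1 M - 1 :: int poly)"
  have X: "ip X w = w ^ M - 1" for w
    by (simp add: X_def of_int_poly_hom.hom_minus map_poly_monom Polynomial.poly_monom)
  have X': "ip (pderiv X) w = of_nat M * w ^ (M - 1)" for w
    by (simp add: X_def pderiv_diff pderiv_monom map_poly_monom Polynomial.poly_monom)
  have "h dvd X" using h(2) zM by (simp add: X)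
  then obtain g where g: "X = h * g" ..
  define w where "w = z ^ p"
  have wM: "w ^ M = 1" by (metis w_def zM power_mult mult.commute power_one)
  then have "ip h w * ip g w = 0" using X[of w] unfolding g by (simp add: ip_mult del: hom_distribs)
  then have gw: "ip g w = 0" using nz by (simp add: w_def)
  have "ip (pderiv X) w = ip h w * ip (pderiv g) w"
    unfolding g pderiv_mult ip_add ip_mult gw by simp
  then have 1: "of_nat M * w ^ (M - 1) = ip h w * ip (pderiv g) w" by (simp add: X')
  have "cgr (zring z) (of_nat p) (ip h z ^ p) (ip h w)"
    unfolding w_def by (intro frobenius_poly p self_in_zring)
  then have "cgr (zring z) (of_nat p) (ip h w) 0"
    using zr.cgr_sym[of z] h(1) prime_gt_0_nat[OF p] by (simp add: power_0_left)
  then obtain r where r: "r \<in> zring z" "ip h w = of_nat p * r"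
    by (auto simp: cgr_def)
  have w: "w \<in> zring z" unfolding w_def by (intro zr.power_in self_in_zring)
  define y where "y = r * ip (pderiv g) w * w"
  have y: "y \<in> zring z" unfolding y_def using r w by (intro zr.mult_in ip_in_zring)
  have "w ^ (M - 1) * w = 1"
    using power_minus_mult[of M w] wM M by simp
  then have "of_nat M = of_nat M * (w ^ (M - 1) * w)"
    by simp
  also have "\<dots> = of_nat p * y" using 1 r(2) by (simp add: y_def algebra_simps)
  finally have My: "of_nat M = of_nat p * y" .
  then have "y = of_nat M / of_nat p" using prime_gt_0_nat[OF p] by (simp add: field_simps)
  then have "y \<in> \<rat>" by simp
  then have "y \<in> \<int>" using zring_Rats[OF M zM y] by simp
  then obtain i where "y = of_int i" by (auto elim: Ints_cases)
  then have "(of_int (int M) :: complex) = of_int (int p * i)" using My by simp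
  then have "int M = int p * i" by (simp only: of_int_eq_iff)
  then have "int p dvd int M" by simp
  then show False using pM by simp
qed

lemma ip_prime_power_root:
  assumes M: "M \<ge> (1::nat)" and zM: "z ^ M = 1" and p: "prime (p::nat)" "\<not> p dvd M"
    and f: "ip f z = 0"
  shows "ip f (z ^ p) = 0"
proof -
  have "ip (monom 1 M - 1) z = 0"
    by (simp add: of_int_poly_hom.hom_minus map_poly_monom Polynomial.poly_monom zM)
  moreover have "monom 1 M - 1 \<noteq> (0 :: int poly)"
  proof
    assume "monom 1 M - 1 = (0 :: int poly)"
    then have "coeff (monom 1 M - 1 :: int poly) M = 0" by simp
    then show False using M by simp
  qed
  ultimately obtain h where h: "ip h z = 0" "h \<noteq> 0" "\<And>f. ip f z = 0 \<Longrightarrow> h dvd f"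
    using minimal_int_poly by metis
  from h(3)[OF f] obtain g where g: "f = h * g" ..
  have "ip h (z ^ p) = 0"
    by (rule conj_prime_power[OF M zM p h(1,3)])
  then show ?thesis
    by (simp only: g ip_mult mult_zero_left)
qed

text \<open>One prime factor of k is treated at a time; the prime step is applied at z^x, which is
  again an M-th root of unity. This is what makes z |-> z^k a well-defined automorphism.\<close>

lemma ip_coprime_power_root:
  assumes M: "M \<ge> (1::nat)" and zM: "z ^ M = 1" and k: "Rings.coprime k M" "k > 0"
    and f: "ip f z = 0"
  shows "ip f (z ^ k) = 0"
  using k
proof (induction k rule: prime_divisors_induct)
  case zero
  then show ?case by simp
next
  case (unit x)
  then show ?case using f by simp
next
  case (factor p x)
  have p: "prime p" using factor(1) by simp
  have co: "Rings.coprime p M" "Rings.coprime x M" using factor(3) by simp_all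
  have "x > 0" using factor(4) by simp
  have pM: "\<not> p dvd M" using co(1) p coprime_absorb_left not_prime_unit by blast
  have "(z ^ x) ^ M = 1" by (metis zM power_mult mult.commute power_one)
  then have "ip f ((z ^ x) ^ p) = 0"
    by (intro ip_prime_power_root[OF M _ p pM] factor.IH co \<open>x > 0\<close>)
  then show ?case by (simp add: power_mult[symmetric] mult.commute)
qed

lemma (in csubring) cgr_sum:
  "(\<And>i. i \<in> I \<Longrightarrow> cgr R c (f i) (g i)) \<Longrightarrow> cgr R c (sum f I) (sum g I)"
  by (induction I rule: infinite_finite_induct) (auto intro: cgr_refl cgr_add)

lemma (in csubring) cgr_zero_iff: "cgr R c x 0 \<longleftrightarrow> (\<exists>r\<in>R. x = c * r)"
  by (simp add: cgr_def)

lemma ip_pcompose_monom: "ip (pcompose f (monom 1 k)) z = ip f (z ^ k)"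
  by (induction f) (simp_all add: pcompose_pCons ip_add ip_mult ip_pCons ip_monom Polynomial.poly_monom del: hom_distribs)

section \<open>Arithmetic of Z[z]: the radical of a prime number and integral closedness\<close>

locale prim_root =
  fixes z :: complex and M :: nat
  assumes M_pos: "M \<ge> 1"
    and root: "z ^ M = 1"
    and primitive: "0 < d \<Longrightarrow> d < M \<Longrightarrow> z ^ d \<noteq> 1"
begin

lemma z_nz: "z \<noteq> 0"
  using root M_pos by (metis not_one_le_zero power_0_left zero_neq_one)

lemma pow_mod: "z ^ (i mod M) = z ^ i"
proof -
  have "z ^ i = z ^ (M * (i div M) + i mod M)" by simp
  also have "\<dots> = z ^ (i mod M)" unfolding power_add power_mult root by simp
  finally show ?thesis by simp
qed

lemma pow_eq_1_iff: "z ^ i = 1 \<longleftrightarrow> M dvd i"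
proof
  assume "z ^ i = 1"
  then have "z ^ (i mod M) = 1" by (simp add: pow_mod)
  then have "i mod M = 0" using primitive[of "i mod M"] M_pos by fastforce
  then show "M dvd i" by auto
next
  assume "M dvd i"
  then show "z ^ i = 1" using pow_mod[of i] by simp
qed

lemma pow_eq_iff: "z ^ i = z ^ j \<longleftrightarrow> [i = j] (mod M)"
proof -
  have *: "z ^ i = z ^ j \<longleftrightarrow> [i = j] (mod M)" if "i \<le> j" for i j
  proof -
    have "z ^ j = z ^ i * z ^ (j - i)" using that by (simp flip: power_add)
    then have "z ^ i = z ^ j \<longleftrightarrow> z ^ (j - i) = 1" using z_nz by auto
    also have "\<dots> \<longleftrightarrow> [j = i] (mod M)" using that by (simp add: pow_eq_1_iff cong_altdef_nat)
    finally show ?thesis by (simp add: cong_sym_eq)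
  qed
  show ?thesis
    using *[of i j] *[of j i] by (cases "i \<le> j") (auto simp: cong_sym_eq)
qed

lemma root_is_power:
  assumes "w ^ M = 1"
  shows "\<exists>i<M. w = z ^ i"
proof -
  have "inj_on (\<lambda>i. z ^ i) {..<M}"
    by (auto simp: inj_on_def pow_eq_iff cong_def)
  then have "card ((\<lambda>i. z ^ i) ` {..<M}) = card {w::complex. w ^ M = 1}"
    using M_pos by (simp add: card_image card_roots_unity_eq)
  moreover have "(\<lambda>i. z ^ i) ` {..<M} \<subseteq> {w. w ^ M = 1}"
    using root by (auto simp: power_commutes simp flip: power_mult) (simp add: mult.commute[of _ M] power_mult)
  moreover have "finite {w::complex. w ^ M = 1}"
    using M_pos by (intro finite_roots_unity) auto
  ultimately have "(\<lambda>i. z ^ i) ` {..<M} = {w. w ^ M = 1}"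
    by (intro card_subset_eq)
  with assms show ?thesis by blast
qed

text \<open>The root of unity attached to the representation will be an eigenvalue of \<phi>(a), not
  the given \<eta>; this allows the exchange.\<close>

lemma zring_root_eq:
  assumes "prim_root w M"
  shows "zring w = zring z"
proof -
  interpret w: prim_root w M by fact
  obtain i where i: "w = z ^ i" using root_is_power[OF w.root] by blast
  obtain j where j: "z = w ^ j" using w.root_is_power[OF root] by blast
  have "w \<in> zring z" unfolding i by (intro zr.power_in self_in_zring)
  moreover have "z \<in> zring w" by (subst j) (intro zr.power_in self_in_zring)
  ultimately show ?thesis using zring_subset by blast
qed

text \<open>The element \<open>ip f z\<close> generates the radical of \<open>p\<close> in \<open>\<int>[z]\<close>: it is \<open>p\<close> when \<open>p\<close> does not divide
  \<open>M\<close> and \<open>1 - \<omega>\<close> for a primitive \<open>p\<^sup>s\<close>-th root of unity \<open>\<omega>\<close> otherwise.\<close>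

lemma radical_generator:
  assumes p: "prime (p::nat)"
  obtains f d Q where "d \<ge> 1" "Q \<ge> 2"
    "\<exists>r\<in>zring z. of_nat p = ip f z * r" "\<exists>r\<in>zring z. ip f z ^ d = of_nat p * r"
    "\<And>x. x \<in> zring z \<Longrightarrow> cgr (zring z) (ip f z) (x ^ Q) x"
    "\<And>k. \<exists>r\<in>zring z. ip f (z ^ k) = ip f z * r"
proof -
  have M0: "M \<noteq> 0" using M_pos by simp
  obtain m where m: "M = p ^ multiplicity p M * m" "\<not> p dvd m"
    using multiplicity_decompose'[of M p] M0 p not_prime_unit by blast
  define s where "s = multiplicity p M"
  have M_eq: "M = p ^ s * m" using m(1) by (simp add: s_def)
  have m_pos: "m > 0" using m(2) by (cases m) auto
  \<comment> \<open>A primitive p^s-th root of unity, equal to 1 if p does not divide M.\<close>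
  define w where "w = z ^ m"
  have w_in: "w \<in> zring z" unfolding w_def by (intro zr.power_in self_in_zring)
  \<comment> \<open>Euler's theorem gives Q = 1 modulo m, so z^Q is z times a power of w. As w = 1
    modulo \<open>ip f z\<close>, the Q-power map fixes z modulo \<open>ip f z\<close>, and by
    Frobenius then every element of Z[z].\<close>
  define Q where "Q = p ^ totient m"
  have p2: "p \<ge> 2" using p by (rule prime_ge_2_nat)
  have "totient m \<ge> 1" using m_pos by (simp add: Suc_leI)
  then have Q2: "Q \<ge> 2" unfolding Q_def using p2
    by (metis One_nat_def le_trans power_increasing power_one_right Suc_1 Suc_leD)
  have "[Q = 1] (mod m)" unfolding Q_def using m(2) p
    by (intro euler_theorem) (simp add: prime_imp_coprime)
  then have "m dvd Q - 1" using Q2 by (simp add: cong_altdef_nat)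
  then obtain c where c: "Q - 1 = m * c" ..
  have zQ: "z ^ Q = w ^ c * z"
    using Q2 c by (metis power_minus_mult w_def power_mult less_le_trans zero_less_numeral)
  \<comment> \<open>A polynomial instead of an element, so that the generator can also be evaluated
    at the conjugates z^k.\<close>
  define f where "f = (if s = 0 then [:int p:] else monom 1 0 - monom 1 m :: int poly)"
  have f_0: "ip f y = of_nat p" if "s = 0" for y using that by (simp add: f_def ip_pCons)
  have f_1: "ip f y = 1 - y ^ m" if "s \<noteq> 0" for y
    using that by (simp add: f_def of_int_poly_hom.hom_minus map_poly_monom Polynomial.poly_monom)
  have w1: "cgr (zring z) (ip f z) w 1"
  proof (cases "s = 0")
    case True
    then have "w = 1" using M_eq root by (simp add: w_def)
    then show ?thesis by (simp add: zr.cgr_refl)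
  next
    case False
    then show ?thesis unfolding f_1[OF False] cgr_def w_def
      by (intro bexI[of _ "-1"]) (auto intro: zr.minus_in zr.one_in)
  qed
  have wc: "cgr (zring z) (ip f z) (w ^ i) 1" for i
    using zr.cgr_power[OF w1 w_in zr.one_in, of i] by simp
  have p_lam: "\<exists>r\<in>zring z. of_nat p = ip f z * r"
  proof (cases "s = 0")
    case True
    then show ?thesis by (auto simp: f_0 intro: zr.one_in)
  next
    case False
    \<comment> \<open>A primitive p-th root of unity: its p powers sum to 0, while each of them is 1
      modulo \<open>ip f z\<close>.\<close>
    define u where "u = w ^ (p ^ (s - 1))"
    have "u = z ^ (m * p ^ (s - 1))" by (simp add: u_def w_def power_mult)
    moreover have "m * p ^ (s - 1) < M"
    proof -
      have "p ^ (s - 1) < p ^ s" using p2 False by (intro power_strict_increasing) auto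
      then show ?thesis using m_pos by (simp add: M_eq)
    qed
    ultimately have u1: "u \<noteq> 1" using primitive[of "m * p ^ (s - 1)"] m_pos p2 by simp
    have "u ^ p = z ^ (m * (p ^ (s - 1) * p))" by (simp add: u_def w_def power_mult)
    also have "p ^ (s - 1) * p = p ^ s" using False power_minus_mult[of s p] by simp
    also have "z ^ (m * p ^ s) = 1" using root by (simp add: M_eq mult.commute)
    finally have "(\<Sum>i<p. u ^ i) = 0" using u1 by (simp add: geometric_sum)
    moreover have "cgr (zring z) (ip f z) (\<Sum>i<p. u ^ i) (\<Sum>i<p. 1)"
      unfolding u_def power_mult[symmetric] by (rule zr.cgr_sum) (rule wc)
    ultimately have "cgr (zring z) (ip f z) (of_nat p) 0"
      using zr.cgr_sym by simp
    then show ?thesis by (simp add: zr.cgr_zero_iff)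
  qed
  show thesis
  proof (rule that[of "p ^ s" Q f])
    show "p ^ s \<ge> 1" using p2 by simp
    show "Q \<ge> 2" by (fact Q2)
    show "\<exists>r\<in>zring z. of_nat p = ip f z * r" by (fact p_lam)
    show "\<exists>r\<in>zring z. ip f z ^ p ^ s = of_nat p * r"
    proof (cases "s = 0")
      case True
      then show ?thesis by (auto simp: f_0 intro: zr.one_in)
    next
      case False
      \<comment> \<open>Frobenius for the polynomial 1 - X: modulo p, the p^s-th power of 1 - w is 1
        - w^(p^s) = 0.\<close>
      have "cgr (zring z) (of_nat p) (ip [:1, -1:] w ^ p ^ s) (ip [:1, -1:] (w ^ p ^ s))"
        by (rule frobenius_poly_iter[OF p w_in])
      moreover have "w ^ p ^ s = 1" using root unfolding w_def M_eq
        by (simp add: power_mult[symmetric] mult.commute)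
      ultimately show ?thesis
        by (simp add: f_1[OF False] ip_pCons w_def zr.cgr_zero_iff)
    qed
    show "cgr (zring z) (ip f z) (x ^ Q) x" if x: "x \<in> zring z" for x
    proof -
      obtain g where g: "x = ip g z" using x by (auto simp: zring_def)
      have "cgr (zring z) (of_nat p) (x ^ Q) (ip g (z ^ Q))"
        unfolding g Q_def by (intro frobenius_poly_iter p self_in_zring)
      then have "cgr (zring z) (ip f z) (x ^ Q) (ip g (z ^ Q))"
        using p_lam zr.cgr_weaken by blast
      moreover have "cgr (zring z) (ip f z) (z ^ Q) (1 * z)"
        unfolding zQ by (intro zr.cgr_mult wc zr.cgr_refl self_in_zring zr.one_in)
      then have "cgr (zring z) (ip f z) (ip g (z ^ Q)) (ip g z)"
        by (intro cgr_ip zr.power_in self_in_zring) simp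
      ultimately show ?thesis unfolding g by (rule zr.cgr_trans)
    qed
    show "\<exists>r\<in>zring z. ip f (z ^ k) = ip f z * r" for k
    proof (cases "s = 0")
      case True
      then show ?thesis by (auto simp: f_0 intro: zr.one_in)
    next
      case False
      have "cgr (zring z) (ip f z) (w ^ k) 1" by (rule wc)
      then have "cgr (zring z) (ip f z) (1 - w ^ k) 0"
        using zr.cgr_add[OF zr.cgr_refl[of z "ip f z" 1], of "- (w ^ k)" "-1"]
        by (auto simp: cgr_def intro: zr.minus_in bexI[of _ "- _"])
           (metis minus_diff_eq mult_minus_right zr.minus_in)
      then show ?thesis
        by (simp add: zr.cgr_zero_iff f_1[OF False] w_def power_mult[symmetric] mult.commute)
    qed
  qed
qed

text \<open>Iterating the congruence gives x = x^(Q^D) modulo l, and Q^D >= D, so this power of x is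
  a multiple of x^D. Thus Z[z] has no nilpotents modulo l.\<close>

lemma zring_reduced:
  assumes Q: "Q \<ge> (2::nat)" and fr: "\<And>x. x \<in> zring z \<Longrightarrow> cgr (zring z) l (x ^ Q) x"
    and x: "x \<in> zring z" and xD: "\<exists>r\<in>zring z. x ^ D = l * r"
  shows "\<exists>r\<in>zring z. x = l * r"
proof -
  have it: "cgr (zring z) l (x ^ (Q ^ j)) x" for j
  proof (induction j)
    case 0
    show ?case by (simp add: zr.cgr_refl)
  next
    case (Suc j)
    have "cgr (zring z) l ((x ^ (Q ^ j)) ^ Q) (x ^ Q)"
      by (intro zr.cgr_power Suc zr.power_in x)
    then show ?case
      using zr.cgr_trans[OF _ fr[OF x]] by (simp add: power_mult[symmetric] mult.commute)
  qed
  have "D \<le> Q ^ D" using Q by (meson less_exp less_imp_le_nat order_trans power_mono zero_le)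
  then have "x ^ (Q ^ D) = x ^ D * x ^ (Q ^ D - D)" by (simp flip: power_add)
  then obtain r where r: "r \<in> zring z" "x ^ (Q ^ D) = l * r"
    using xD x by (metis mult.assoc zr.mult_in zr.power_in)
  have "cgr (zring z) l x (x ^ (Q ^ D))" by (rule zr.cgr_sym[OF it])
  moreover have "cgr (zring z) l (x ^ (Q ^ D)) 0" using r by (auto simp: zr.cgr_zero_iff)
  ultimately show ?thesis using zr.cgr_trans zr.cgr_zero_iff by blast
qed

text \<open>If \<open>y\<close> is integral, a monic equation for \<open>y\<close> makes a power of \<open>l c y\<close> divisible by \<open>l\<close>.\<close>

lemma integral_div_radical:
  assumes Q: "Q \<ge> (2::nat)" and fr: "\<And>x. x \<in> zring z \<Longrightarrow> cgr (zring z) l (x ^ Q) x"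
    and l: "l \<in> zring z" "l \<noteq> 0" and c: "c \<in> zring z"
    and y: "algebraic_int y" and x: "l * (c * y) \<in> zring z"
  shows "c * y \<in> zring z"
proof -
  obtain F where F: "ip F y = 0" "lead_coeff F = 1"
    using y unfolding algebraic_int_altdef_ipoly by (elim exE conjE)
  define D where "D = degree F"
  define b where "b = l * c"
  have "ip F y = (\<Sum>i\<le>D. of_int (coeff F i) * y ^ i)"
    by (simp add: poly_altdef D_def coeff_map_poly degree_map_poly)
  also have "{..D} = insert D {..<D}" by auto
  finally have "of_int (coeff F D) * y ^ D + (\<Sum>i<D. of_int (coeff F i) * y ^ i) = 0"
    using F(1) by simp
  then have yD: "y ^ D = - (\<Sum>i<D. of_int (coeff F i) * y ^ i)"
    using F(2) by (simp add: D_def add_eq_0_iff2)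
  \<comment> \<open>The monic equation is multiplied by b^D. In a term with i < D at least one
    factor b = l c is left over after forming (b y)^i, and it supplies the factor l.\<close>
  have "(b * y) ^ D = - (\<Sum>i<D. of_int (coeff F i) * (b ^ D * y ^ i))"
    by (simp add: power_mult_distrib yD sum_distrib_left algebra_simps)
  also have "(\<Sum>i<D. of_int (coeff F i) * (b ^ D * y ^ i))
      = (\<Sum>i<D. of_int (coeff F i) * (l * (c * b ^ (D - i - 1) * (b * y) ^ i)))"
  proof (rule sum.cong)
    fix i assume "i \<in> {..<D}"
    then have "D = Suc (i + (D - i - 1))" by auto
    then have "b ^ D = b * b ^ i * b ^ (D - i - 1)" by (metis power_Suc power_add mult.assoc)
    then show "of_int (coeff F i) * (b ^ D * y ^ i)
        = of_int (coeff F i) * (l * (c * b ^ (D - i - 1) * (b * y) ^ i))"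
      by (simp add: b_def power_mult_distrib)
  qed simp
  also have "- \<dots> = l * - (\<Sum>i<D. of_int (coeff F i) * (c * b ^ (D - i - 1) * (b * y) ^ i))"
    by (simp add: sum_distrib_left algebra_simps)
  finally have "(b * y) ^ D = l * - (\<Sum>i<D. of_int (coeff F i) * (c * b ^ (D - i - 1) * (b * y) ^ i))" .
  moreover have by_in: "b * y \<in> zring z" using x by (simp add: b_def mult.assoc)
  moreover have "- (\<Sum>i<D. of_int (coeff F i) * (c * b ^ (D - i - 1) * (b * y) ^ i)) \<in> zring z"
  proof -
    have "b \<in> zring z" unfolding b_def using zr.mult_in[OF l(1) c] .
    then have "of_int (coeff F i) * (c * b ^ (D - i - 1) * (b * y) ^ i) \<in> zring z" for i
      by (rule zr.mult_in[OF zr.of_int_in zr.mult_in[OF zr.mult_in[OF c zr.power_in] zr.power_in[OF by_in]]])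
    then show ?thesis by (intro zr.minus_in zr.sum_in)
  qed
  ultimately have "\<exists>r\<in>zring z. (b * y) ^ D = l * r"
    by blast
  from zring_reduced[OF Q fr by_in this] have "\<exists>r\<in>zring z. b * y = l * r" .
  then show ?thesis using l(2) by (auto simp: b_def mult.assoc)
qed

text \<open>The denominator is removed one prime p at a time. Since l^d is a multiple of p, the
  product l^d n y lies in Z[z]; \<open>integral_div_radical\<close> then strips the factors l
  singly, the remaining ones being absorbed in its c.\<close>

lemma zring_integrally_closed:
  assumes y: "algebraic_int y" and n: "n > (0::nat)" "of_nat n * y \<in> zring z"
  shows "y \<in> zring z"
  using n
proof (induction n rule: prime_divisors_induct)
  case zero
  then show ?case by simp
next
  case (unit n)
  then show ?case by simp
next
  case (factor p n)
  obtain f d Q where *: "d \<ge> 1" "Q \<ge> 2"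
    "\<exists>r\<in>zring z. of_nat p = ip f z * r" "\<exists>r\<in>zring z. ip f z ^ d = of_nat p * r"
    "\<And>x. x \<in> zring z \<Longrightarrow> cgr (zring z) (ip f z) (x ^ Q) x"
    using radical_generator[of p] factor(1) by metis
  define l where "l = ip f z"
  have l_in: "l \<in> zring z" by (simp add: l_def zringI)
  have "of_nat p \<noteq> (0::complex)" using factor(1) by (auto dest: prime_gt_0_nat)
  then have l_nz: "l \<noteq> 0" using *(3) by (auto simp: l_def)
  obtain r where r: "r \<in> zring z" "l ^ d = of_nat p * r" using *(4) by (auto simp: l_def)
  have "l ^ d * (of_nat n * y) = r * (of_nat (p * n) * y)" by (simp add: r(2) mult_ac)
  then have 1: "l ^ d * (of_nat n * y) \<in> zring z"
    using zr.mult_in[OF r(1) factor.prems(2)] by (simp only:)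
  have "l ^ i * (of_nat n * y) \<in> zring z \<Longrightarrow> of_nat n * y \<in> zring z" for i
  proof (induction i)
    case (Suc i)
    have "(l ^ i * of_nat n) * y \<in> zring z"
      by (rule integral_div_radical[OF *(2) *(5)[folded l_def] l_in l_nz _ y])
         (use Suc.prems l_in in \<open>auto intro: zr.mult_in zr.power_in zr.of_nat_in simp: mult.assoc\<close>)
    then show ?case using Suc.IH by (simp add: mult.assoc)
  qed simp
  with 1 have "of_nat n * y \<in> zring z" by blast
  moreover have "n > 0" using factor.prems by simp
  ultimately show ?case using factor.IH by blast
qed

end


section \<open>Cyclotomic fields and their automorphisms\<close>

text \<open>The field Q(z), encoded by integer denominators; closure under inverses comes from
  \<open>zring_dvd_int\<close>.\<close>

definition zfield :: "complex \<Rightarrow> complex set" where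
  "zfield z = {x. \<exists>n>(0::nat). of_nat n * x \<in> zring z}"

text \<open>The automorphism of Q(z) with z |-> z^k. The choice of f and n is immaterial by
  \<open>gal_eq\<close>; outside \<open>zfield z\<close> the value is unspecified, hence the
  membership premises of the laws of addition and multiplication.\<close>

definition gal :: "complex \<Rightarrow> nat \<Rightarrow> complex \<Rightarrow> complex" where
  "gal z k x = (SOME y. \<exists>f n. n > (0::nat) \<and> of_nat n * x = ip f z \<and> of_nat n * y = ip f (z ^ k))"

lemma zring_zfield: "zring z \<subseteq> zfield z"
  by (auto simp: zfield_def intro!: exI[of _ 1])

lemma csubring_zfield: "csubring (zfield z)"
proof
  show "1 \<in> zfield z" using zring_zfield zr.one_in by blast
next
  fix x y assume "x \<in> zfield z" "y \<in> zfield z"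
  then obtain a b where ab: "a > 0" "b > 0" "of_nat a * x \<in> zring z" "of_nat b * y \<in> zring z"
    by (auto simp: zfield_def)
  have "of_nat (a * b) * (x + y) = of_nat b * (of_nat a * x) + of_nat a * (of_nat b * y)"
    by (simp add: algebra_simps)
  then have "of_nat (a * b) * (x + y) \<in> zring z"
    using zr.add_in[OF zr.mult_in[OF zr.of_nat_in ab(3)] zr.mult_in[OF zr.of_nat_in ab(4)]]
    by (simp only:)
  then show "x + y \<in> zfield z" unfolding zfield_def using ab by (blast intro: mult_pos_pos)
  have "of_nat (a * b) * (x * y) = (of_nat a * x) * (of_nat b * y)"
    by (simp add: algebra_simps)
  then have "of_nat (a * b) * (x * y) \<in> zring z"
    using zr.mult_in[OF ab(3,4)] by (simp only:)
  then show "x * y \<in> zfield z" unfolding zfield_def using ab by (blast intro: mult_pos_pos)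
  show "- x \<in> zfield z" unfolding zfield_def using ab zr.minus_in by fastforce
qed

interpretation zf: csubring "zfield z" for z
  by (rule csubring_zfield)

context prim_root
begin

lemma zfield_inverse:
  assumes "x \<in> zfield z"
  shows "inverse x \<in> zfield z"
proof (cases "x = 0")
  case True
  then show ?thesis by (simp add: zf.zero_in)
next
  case False
  obtain n where n: "n > 0" "of_nat n * x \<in> zring z" using assms by (auto simp: zfield_def)
  obtain y m where y: "y \<in> zring z" "m \<noteq> 0" "of_nat n * x * y = of_int m"
    using zring_dvd_int[OF M_pos root n(2)] False n(1) by auto
  have "of_int m * inverse x = of_nat n * y * (x * inverse x)"
    unfolding y(3)[symmetric] by (simp add: mult_ac)
  also have "x * inverse x = 1" using False by simp
  finally have "inverse x = of_nat n * y / of_int m"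
    using y(2) by (simp add: eq_divide_eq mult.commute)
  then have "of_nat (nat \<bar>m\<bar>) * inverse x = of_int (sgn m) * (of_nat n * y)"
    using y(2) by (auto simp: sgn_if abs_if)
  then have "of_nat (nat \<bar>m\<bar>) * inverse x \<in> zring z"
    using zr.mult_in[OF zr.of_int_in zr.mult_in[OF zr.of_nat_in y(1)]] by (simp only:)
  then show ?thesis unfolding zfield_def using y(2) by (intro CollectI exI[of _ "nat \<bar>m\<bar>"]) simp
qed

end

text \<open>N is the exact order of k modulo M, so that z has N distinct conjugates z^(k^i).\<close>

locale cyclic_galois = prim_root +
  fixes k N :: nat
  assumes k_pos: "k > 0" and k_coprime: "Rings.coprime k M"
    and N_pos: "N > 0" and k_N: "[k ^ N = 1] (mod M)"
    and k_order: "0 < i \<Longrightarrow> i < N \<Longrightarrow> \<not> [k ^ i = 1] (mod M)"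
begin

abbreviation \<sigma> where "\<sigma> \<equiv> gal z k"

lemma ip_pow_cong:
  assumes "ip f z = ip g z"
  shows "ip f (z ^ k) = ip g (z ^ k)"
proof -
  have "ip (f - g) z = 0" using assms by (simp add: of_int_poly_hom.hom_minus)
  then have "ip (f - g) (z ^ k) = 0"
    by (rule ip_coprime_power_root[OF M_pos root k_coprime k_pos])
  then show ?thesis by (simp add: of_int_poly_hom.hom_minus)
qed

text \<open>Two representations f/n and g/m of x give m f = n g at z, and such an integer relation
  survives the substitution of z^k for z.\<close>

lemma gal_eq:
  assumes "n > 0" "of_nat n * x = ip f z"
  shows "of_nat n * \<sigma> x = ip f (z ^ k)"
proof -
  have "\<exists>y. \<exists>f n. n > (0::nat) \<and> of_nat n * x = ip f z \<and> of_nat n * y = ip f (z ^ k)"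
    using assms by (intro exI[of _ "ip f (z ^ k) / of_nat n"] exI[of _ f] exI[of _ n]) simp
  from someI_ex[OF this] obtain g m where g: "m > 0" "of_nat m * x = ip g z"
    "of_nat m * \<sigma> x = ip g (z ^ k)"
    unfolding gal_def by blast
  have "ip (smult (int m) f) z = ip (smult (int n) g) z"
    unfolding ip_smult using assms g by (simp flip: assms(2) g(2))
  from ip_pow_cong[OF this] have "of_nat m * ip f (z ^ k) = of_nat n * ip g (z ^ k)"
    unfolding ip_smult by simp
  then have "of_nat m * ip f (z ^ k) = of_nat m * (of_nat n * \<sigma> x)"
    unfolding g(3)[symmetric] by (simp add: mult_ac)
  then show ?thesis using g(1) by simp
qed

lemma gal_ip: "\<sigma> (ip f z) = ip f (z ^ k)"
  using gal_eq[of 1 "ip f z" f] by simp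

lemma zfieldE:
  assumes "x \<in> zfield z"
  obtains n f where "n > 0" "of_nat n * x = ip f z"
  using assms by (auto simp: zfield_def zring_def)

lemma gal_zring: "x \<in> zring z \<Longrightarrow> \<sigma> x \<in> zring z"
  unfolding zring_def[of z] by (auto simp: gal_ip) (metis ip_in_zring rangeE self_in_zring zr.power_in zring_def)

lemma gal_zfield: "x \<in> zfield z \<Longrightarrow> \<sigma> x \<in> zfield z"
proof -
  assume "x \<in> zfield z"
  then obtain n f where n: "n > 0" "of_nat n * x = ip f z" by (rule zfieldE)
  have "of_nat n * \<sigma> x \<in> zring z"
    unfolding gal_eq[OF n] by (intro ip_in_zring zr.power_in self_in_zring)
  then show ?thesis using n(1) by (auto simp: zfield_def)
qed

lemma gal_add: "x \<in> zfield z \<Longrightarrow> y \<in> zfield z \<Longrightarrow> \<sigma> (x + y) = \<sigma> x + \<sigma> y"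
proof -
  assume "x \<in> zfield z" "y \<in> zfield z"
  then obtain n f m g where n: "n > 0" "of_nat n * x = ip f z" and m: "m > 0" "of_nat m * y = ip g z"
    by (metis zfieldE)
  let ?h = "smult (int m) f + smult (int n) g"
  have "of_nat (n * m) * (x + y) = of_nat m * (of_nat n * x) + of_nat n * (of_nat m * y)"
    by (simp add: algebra_simps)
  also have "\<dots> = ip ?h z" unfolding n m ip_add ip_smult by simp
  finally have "of_nat (n * m) * \<sigma> (x + y) = ip ?h (z ^ k)"
    using n m by (intro gal_eq) auto
  also have "\<dots> = of_nat m * (of_nat n * \<sigma> x) + of_nat n * (of_nat m * \<sigma> y)"
    unfolding gal_eq[OF n] gal_eq[OF m] ip_add ip_smult by simp
  also have "\<dots> = of_nat (n * m) * (\<sigma> x + \<sigma> y)" by (simp add: algebra_simps)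
  finally show ?thesis using n(1) m(1) by simp
qed

lemma gal_mult: "x \<in> zfield z \<Longrightarrow> y \<in> zfield z \<Longrightarrow> \<sigma> (x * y) = \<sigma> x * \<sigma> y"
proof -
  assume "x \<in> zfield z" "y \<in> zfield z"
  then obtain n f m g where n: "n > 0" "of_nat n * x = ip f z" and m: "m > 0" "of_nat m * y = ip g z"
    by (metis zfieldE)
  have "of_nat (n * m) * (x * y) = (of_nat n * x) * (of_nat m * y)"
    by (simp add: algebra_simps)
  also have "\<dots> = ip (f * g) z" unfolding n m ip_mult ..
  finally have "of_nat (n * m) * \<sigma> (x * y) = ip (f * g) (z ^ k)"
    using n m by (intro gal_eq) auto
  also have "\<dots> = (of_nat n * \<sigma> x) * (of_nat m * \<sigma> y)"
    unfolding gal_eq[OF n] gal_eq[OF m] ip_mult ..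
  also have "\<dots> = of_nat (n * m) * (\<sigma> x * \<sigma> y)" by (simp add: algebra_simps)
  finally show ?thesis using n(1) m(1) by simp
qed

lemma gal_of_int: "\<sigma> (of_int i) = of_int i"
  using gal_ip[of "[:i:]"] by (simp add: ip_pCons)

lemma gal_z: "\<sigma> z = z ^ k"
  using gal_ip[of "[:0, 1:]"] by (simp add: ip_pCons)

lemma gal_pow: "x \<in> zfield z \<Longrightarrow> \<sigma> (x ^ i) = \<sigma> x ^ i"
  using gal_of_int[of 1] by (induction i) (auto simp: gal_mult zf.power_in)

lemma funpow_gal_eq:
  assumes "n > 0" "of_nat n * x = ip f z"
  shows "of_nat n * (\<sigma> ^^ j) x = ip f (z ^ (k ^ j))"
  using assms
proof (induction j arbitrary: x f)
  case (Suc j)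
  have "of_nat n * \<sigma> x = ip f (z ^ k)" by (rule gal_eq[OF Suc.prems])
  also have "\<dots> = ip (pcompose f (monom 1 k)) z"
    by (simp add: ip_pcompose_monom)
  finally have "of_nat n * (\<sigma> ^^ j) (\<sigma> x) = ip (pcompose f (monom 1 k)) (z ^ (k ^ j))"
    by (rule Suc.IH[OF Suc.prems(1)])
  then show ?case
    by (simp add: funpow_swap1 ip_pcompose_monom power_mult[symmetric] mult.commute)
qed simp

lemma funpow_gal_z: "(\<sigma> ^^ j) z = z ^ (k ^ j)"
  using funpow_gal_eq[of 1 z "[:0, 1:]" j] by (simp add: ip_pCons)

lemma gal_order: "x \<in> zfield z \<Longrightarrow> (\<sigma> ^^ N) x = x"
proof -
  assume "x \<in> zfield z"
  then obtain n f where n: "n > 0" "of_nat n * x = ip f z" by (rule zfieldE)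
  have "z ^ (k ^ N) = z ^ 1" using k_N by (subst pow_eq_iff)
  then have "of_nat n * (\<sigma> ^^ N) x = of_nat n * x"
    using funpow_gal_eq[OF n, of N] n(2) by simp
  then show ?thesis using n(1) by simp
qed

lemma conj_inj: "i < N \<Longrightarrow> j < N \<Longrightarrow> z ^ (k ^ i) = z ^ (k ^ j) \<Longrightarrow> i = j"
proof -
  have *: False if "i < j" "j < N" "z ^ (k ^ i) = z ^ (k ^ j)" for i j
  proof -
    have "[k ^ i * 1 = k ^ i * k ^ (j - i)] (mod M)"
      using that by (simp add: pow_eq_iff flip: power_add)
    then have "[1 = k ^ (j - i)] (mod M)"
      using k_coprime by (subst (asm) cong_mult_lcancel_nat) (auto intro: coprime_power_left_iff[THEN iffD2])
    then have "[k ^ (j - i) = 1] (mod M)" by (rule cong_sym)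
    with k_order[of "j - i"] that show False by simp
  qed
  show "i < N \<Longrightarrow> j < N \<Longrightarrow> z ^ (k ^ i) = z ^ (k ^ j) \<Longrightarrow> i = j"
    using *[of i j] *[of j i] linorder_less_linear[of i j] by auto
qed

end

section \<open>Stable modules over a localised order\<close>

text \<open>An order R in a field L with an automorphism s of finite order, stated without roots of
  unity. \<open>L_frac\<close> and \<open>R_dvd\<close> stand in for finiteness over the integers:
  denominators are integers, and nonzero elements of R divide nonzero integers.\<close>

locale galois_order = R: csubring R + L: csubring L
  for R L :: "complex set" +
  fixes s :: "complex \<Rightarrow> complex" and N :: nat
  assumes R_L: "R \<subseteq> L"
    and L_inverse: "x \<in> L \<Longrightarrow> inverse x \<in> L"
    and L_frac: "x \<in> L \<Longrightarrow> \<exists>n>(0::nat). of_nat n * x \<in> R"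
    and R_dvd: "x \<in> R \<Longrightarrow> x \<noteq> 0 \<Longrightarrow> \<exists>y\<in>R. \<exists>n::int. n \<noteq> 0 \<and> x * y = of_int n"
    and s_L: "x \<in> L \<Longrightarrow> s x \<in> L"
    and s_R: "x \<in> R \<Longrightarrow> s x \<in> R"
    and s_add: "x \<in> L \<Longrightarrow> y \<in> L \<Longrightarrow> s (x + y) = s x + s y"
    and s_mult: "x \<in> L \<Longrightarrow> y \<in> L \<Longrightarrow> s (x * y) = s x * s y"
    and s_one: "s 1 = 1"
    and s_order: "x \<in> L \<Longrightarrow> (s ^^ N) x = x"
    and N_pos: "N > 0"
begin

definition K where "K = {x\<in>L. s x = x}"
definition O_K where "O_K = R \<inter> K"

lemma R_in_L: "x \<in> R \<Longrightarrow> x \<in> L" using R_L by blast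

lemma s_zero: "s 0 = 0"
  using s_add[OF L.zero_in L.zero_in] by simp

lemma s_minus: "x \<in> L \<Longrightarrow> s (- x) = - s x"
  using s_add[of x "- x"] L.minus_in[of x] by (simp add: s_zero add_eq_0_iff)

lemma s_diff: "x \<in> L \<Longrightarrow> y \<in> L \<Longrightarrow> s (x - y) = s x - s y"
  using s_add[of x "- y"] s_minus[of y] L.minus_in[of y] by simp

lemma s_power: "x \<in> L \<Longrightarrow> s (x ^ i) = s x ^ i"
  by (induction i) (auto simp: s_one s_mult L.power_in)

lemma s_inverse: "x \<in> L \<Longrightarrow> s (inverse x) = inverse (s x)"
proof (cases "x = 0")
  case False
  assume x: "x \<in> L"
  have "s x * s (inverse x) = 1"
    using s_mult[OF x L_inverse[OF x]] False by (simp add: s_one)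
  then show ?thesis by (metis inverse_unique)
qed (simp add: s_zero)

lemma s_powi: "x \<in> L \<Longrightarrow> s (x powi c) = s x powi c"
  by (auto simp: power_int_def s_power s_inverse L_inverse)

lemma s_sum: "(\<And>i. i \<in> I \<Longrightarrow> f i \<in> L) \<Longrightarrow> s (sum f I) = (\<Sum>i\<in>I. s (f i))"
  by (induction I rule: infinite_finite_induct) (auto simp: s_zero s_add L.sum_in)

lemma s_prod: "(\<And>i. i \<in> I \<Longrightarrow> f i \<in> L) \<Longrightarrow> s (prod f I) = (\<Prod>i\<in>I. s (f i))"
  by (induction I rule: infinite_finite_induct) (auto simp: s_one s_mult L.prod_in)

lemma funpow_L: "x \<in> L \<Longrightarrow> (s ^^ i) x \<in> L"
  by (induction i) (auto intro: s_L)

lemma funpow_R: "x \<in> R \<Longrightarrow> (s ^^ i) x \<in> R"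
  by (induction i) (auto intro: s_R)

lemma csubring_K: "csubring K"
  by unfold_locales (auto simp: K_def s_one s_add s_mult s_minus L.one_in L.add_in L.mult_in L.minus_in)

sublocale K: csubring K by (rule csubring_K)

lemma csubring_O_K: "csubring O_K"
  by unfold_locales (auto simp: O_K_def K.one_in K.add_in K.mult_in K.minus_in
      R.one_in R.add_in R.mult_in R.minus_in)

sublocale O_K: csubring O_K by (rule csubring_O_K)

lemma K_L: "x \<in> K \<Longrightarrow> x \<in> L" by (simp add: K_def)
lemma O_K_R: "x \<in> O_K \<Longrightarrow> x \<in> R" by (simp add: O_K_def)
lemma O_K_K: "x \<in> O_K \<Longrightarrow> x \<in> K" by (simp add: O_K_def)
lemma O_K_L: "x \<in> O_K \<Longrightarrow> x \<in> L" by (simp add: O_K_def K_L)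

lemma K_inverse: "x \<in> K \<Longrightarrow> inverse x \<in> K"
  by (simp add: K_def L_inverse s_inverse)

lemma K_divide: "x \<in> K \<Longrightarrow> y \<in> K \<Longrightarrow> x / y \<in> K"
  by (simp add: divide_inverse K.mult_in K_inverse)

lemma K_powi: "x \<in> K \<Longrightarrow> x powi c \<in> K"
  by (auto simp: power_int_def intro: K.power_in K_inverse)

lemma sum_conj_K: "x \<in> L \<Longrightarrow> (\<Sum>i<N. (s ^^ i) x) \<in> K"
proof -
  assume x: "x \<in> L"
  have "s (\<Sum>i<N. (s ^^ i) x) = (\<Sum>i<N. (s ^^ Suc i) x)"
    using x by (simp add: s_sum funpow_L)
  also have "\<dots> + (s ^^ 0) x = (\<Sum>i<Suc N. (s ^^ i) x)"
    by (simp only: sum.lessThan_Suc_shift add.commute)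
  finally have "s (\<Sum>i<N. (s ^^ i) x) = (\<Sum>i<N. (s ^^ i) x)"
    using s_order[OF x] by simp
  then show ?thesis using x by (simp add: K_def L.sum_in funpow_L)
qed

text \<open>The norm: s shifts the factors cyclically. The shifted product is compared after
  multiplication by x, so x = 0 is treated apart.\<close>

lemma prod_conj_K: "x \<in> L \<Longrightarrow> (\<Prod>i<N. (s ^^ i) x) \<in> K"
proof -
  assume x: "x \<in> L"
  have "s (\<Prod>i<N. (s ^^ i) x) = (\<Prod>i<N. (s ^^ Suc i) x)"
    using x by (simp add: s_prod funpow_L)
  also have "\<dots> * (s ^^ 0) x = (\<Prod>i<Suc N. (s ^^ i) x)"
    by (simp only: prod.lessThan_Suc_shift mult.commute)
  finally have *: "s (\<Prod>i<N. (s ^^ i) x) * (s ^^ 0) x = (\<Prod>i<Suc N. (s ^^ i) x)" .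
  have "s (\<Prod>i<N. (s ^^ i) x) = (\<Prod>i<N. (s ^^ i) x)"
  proof (cases "x = 0")
    case True
    have "(s ^^ 0) x = 0" "0 \<in> {..<N}" using N_pos True by auto
    then have "(\<Prod>i<N. (s ^^ i) x) = 0" by (intro prod_zero) blast+
    then show ?thesis by (simp only: s_zero)
  next
    case False
    with * s_order[OF x] show ?thesis by simp
  qed
  then show ?thesis using x by (simp add: K_def L.prod_in funpow_L)
qed

end

text \<open>The element \<open>l\<close> plays the role of a generator of the radical of \<open>p R\<close>.\<close>

locale frobenius_order = galois_order +
  fixes p :: nat and l :: complex and Q d :: nat
  assumes p_prime: "prime p"
    and l_in: "l \<in> R"
    and p_l: "\<exists>r\<in>R. of_nat p = l * r"
    and l_p: "\<exists>r\<in>R. l ^ d = of_nat p * r"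
    and Q_ge: "Q \<ge> 2"
    and frob: "x \<in> R \<Longrightarrow> cgr R l (x ^ Q) x"
    and s_l: "\<exists>r\<in>R. s l = l * r"
begin

lemma p_nz: "of_nat p \<noteq> (0::complex)"
  using p_prime by (auto dest: prime_gt_0_nat)

lemma l_nz: "l \<noteq> 0"
  using p_l p_nz by auto

lemma l_L: "l \<in> L" using l_in R_L by blast

lemma l_powi_L: "l powi c \<in> L"
  by (auto simp: power_int_def intro: L.power_in L_inverse l_L)

text \<open>Since s l lies in l R, so do all iterates of l under s. Applying s to the iterate of
  index N - 1 closes the cycle and gives l in s(l) R, so l and s l differ by a unit of R.\<close>

lemma l_dvd_s_l: "\<exists>r\<in>R. l = s l * r"
proof -
  have "\<exists>r\<in>R. (s ^^ i) l = l * r" for i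
  proof (induction i)
    case 0
    show ?case using R.one_in by auto
  next
    case (Suc i)
    then obtain r where r: "r \<in> R" "(s ^^ i) l = l * r" by blast
    obtain r' where r': "r' \<in> R" "s l = l * r'" using s_l by blast
    have "(s ^^ Suc i) l = l * (r' * s r)" using r r' by (simp add: s_mult l_L R_in_L mult.assoc)
    then show ?case using r r' by (blast intro: R.mult_in s_R)
  qed
  then obtain r where r: "r \<in> R" "(s ^^ (N - 1)) l = l * r" by blast
  have "s ((s ^^ (N - 1)) l) = (s ^^ Suc (N - 1)) l" by simp
  also have "Suc (N - 1) = N" using N_pos by simp
  finally have "l = s (l * r)" using r(2) s_order[OF l_L] by simp
  also have "\<dots> = s l * s r" using r by (simp add: s_mult l_L R_in_L)
  finally show ?thesis using r s_R by blast
qed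

end

section \<open>Localisation at a prime of the fixed field and the filtration by powers of l\<close>

locale frobenius_place = frobenius_order +
  fixes P :: "complex set"
  assumes P_O_K: "P \<subseteq> O_K"
    and P_add: "x \<in> P \<Longrightarrow> y \<in> P \<Longrightarrow> x + y \<in> P"
    and P_mult: "x \<in> O_K \<Longrightarrow> y \<in> P \<Longrightarrow> x * y \<in> P"
    and P_prime: "x \<in> O_K \<Longrightarrow> y \<in> O_K \<Longrightarrow> x * y \<in> P \<Longrightarrow> x \<in> P \<or> y \<in> P"
    and one_P: "1 \<notin> P"
    and p_P: "of_nat p \<in> P"
begin

definition T where "T = O_K - P"

text \<open>Only elements of the fixed field are inverted, which keeps this ring stable under s; in
  general several primes of R survive in it.\<close>

definition R_P where "R_P = {x\<in>L. \<exists>t\<in>T. t * x \<in> R}"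

lemma T_O_K: "t \<in> T \<Longrightarrow> t \<in> O_K" by (simp add: T_def)

lemma one_T: "1 \<in> T" using one_P O_K.one_in by (simp add: T_def)

lemma T_mult: "t \<in> T \<Longrightarrow> u \<in> T \<Longrightarrow> t * u \<in> T"
  unfolding T_def using P_prime O_K.mult_in by blast

lemma zero_P: "0 \<in> P"
  using P_mult[OF O_K.zero_in p_P] by simp

lemma T_nz: "t \<in> T \<Longrightarrow> t \<noteq> 0"
  using zero_P by (auto simp: T_def)

lemma R_R_P: "x \<in> R \<Longrightarrow> x \<in> R_P"
  using one_T R_L by (auto simp: R_P_def intro!: bexI[of _ 1])

lemma inverse_T: "t \<in> T \<Longrightarrow> inverse t \<in> R_P"
  using R.one_in T_nz[of t] L_inverse[OF O_K_L[OF T_O_K[of t]]]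
  unfolding R_P_def by (intro CollectI conjI bexI[of _ t]) auto

lemma csubring_R_P: "csubring R_P"
proof
  show "1 \<in> R_P" by (intro R_R_P R.one_in)
next
  fix x y assume "x \<in> R_P" "y \<in> R_P"
  then obtain t u where tu: "t \<in> T" "u \<in> T" "t * x \<in> R" "u * y \<in> R" "x \<in> L" "y \<in> L"
    by (auto simp: R_P_def)
  have "t * u * (x + y) = u * (t * x) + t * (u * y)" by (simp add: algebra_simps)
  also have "\<dots> \<in> R"
    using R.add_in[OF R.mult_in[OF O_K_R[OF T_O_K[OF tu(2)]] tu(3)] R.mult_in[OF O_K_R[OF T_O_K[OF tu(1)]] tu(4)]] .
  finally show "x + y \<in> R_P" unfolding R_P_def using tu by (blast intro: T_mult L.add_in)
  have "t * u * (x * y) = (t * x) * (u * y)" by (simp add: algebra_simps)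
  also have "\<dots> \<in> R" by (rule R.mult_in[OF tu(3,4)])
  finally show "x * y \<in> R_P" unfolding R_P_def using tu by (blast intro: T_mult L.mult_in)
  have "t * (- x) \<in> R" using R.minus_in[OF tu(3)] by simp
  then show "- x \<in> R_P" unfolding R_P_def using tu by (blast intro: L.minus_in)
qed

sublocale R_P: csubring R_P by (rule csubring_R_P)

lemma R_P_L: "x \<in> R_P \<Longrightarrow> x \<in> L" by (simp add: R_P_def)

lemma s_R_P: "x \<in> R_P \<Longrightarrow> s x \<in> R_P"
proof -
  assume "x \<in> R_P"
  then obtain t where t: "t \<in> T" "t * x \<in> R" "x \<in> L" by (auto simp: R_P_def)
  then have "s (t * x) = t * s x" by (simp add: s_mult T_def O_K_def K_def)
  then have "t * s x \<in> R" using s_R t by metis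
  then show ?thesis unfolding R_P_def using t s_L by blast
qed

text \<open>The fractional ideal l^c R_P, for negative c as well; \<open>J_iff\<close> is the
  multiplicative form.\<close>

definition J :: "int \<Rightarrow> complex set" where "J c = {x\<in>L. l powi (- c) * x \<in> R_P}"

lemma J_0: "J 0 = R_P"
  by (auto simp: J_def R_P_L)

lemma J_iff: "x \<in> J c \<longleftrightarrow> (\<exists>r\<in>R_P. x = l powi c * r)"
proof
  assume "x \<in> J c"
  then show "\<exists>r\<in>R_P. x = l powi c * r"
    using l_nz by (intro bexI[of _ "l powi (- c) * x"])
      (auto simp: J_def power_int_minus)
next
  assume "\<exists>r\<in>R_P. x = l powi c * r"
  then obtain r where r: "r \<in> R_P" "x = l powi c * r" by blast
  moreover have "l powi (- c) * l powi c = 1" using l_nz by (simp add: power_int_minus)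
  ultimately have *: "l powi (- c) * x = r" by (metis mult.assoc mult_1)
  have "x \<in> L" unfolding r(2) by (rule L.mult_in[OF l_powi_L R_P_L[OF r(1)]])
  then show "x \<in> J c" using r(1) unfolding J_def by (simp only: * mem_Collect_eq)
qed

lemma J_L: "x \<in> J c \<Longrightarrow> x \<in> L" by (simp add: J_def)

lemma J_mult: "x \<in> J c \<Longrightarrow> y \<in> J e \<Longrightarrow> x * y \<in> J (c + e)"
proof -
  assume "x \<in> J c" "y \<in> J e"
  then obtain r u where "r \<in> R_P" "u \<in> R_P" "x = l powi c * r" "y = l powi e * u"
    by (auto simp: J_iff)
  then show ?thesis using l_nz unfolding J_iff
    by (intro bexI[of _ "r * u"]) (auto simp: power_int_add R_P.mult_in)
qed

lemma J_smult: "r \<in> R_P \<Longrightarrow> x \<in> J c \<Longrightarrow> r * x \<in> J c"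
  using J_mult[of r 0 x c] by (simp add: J_0)

lemma l_powi_J: "l powi c \<in> J c"
  unfolding J_iff using R_P.one_in by auto

lemma J_antimono: "c \<le> e \<Longrightarrow> J e \<subseteq> J c"
proof
  fix x assume "c \<le> e" "x \<in> J e"
  then obtain r where r: "r \<in> R_P" "x = l powi e * r" by (auto simp: J_iff)
  have "e = c + int (nat (e - c))" using \<open>c \<le> e\<close> by simp
  then have "l powi e = l powi c * l ^ nat (e - c)"
    using l_nz by (metis power_int_add power_int_of_nat)
  then show "x \<in> J c" using r unfolding J_iff
    by (intro bexI[of _ "l ^ nat (e - c) * r"] R_P.mult_in R_P.power_in R_R_P[OF l_in])
      (simp add: mult.assoc)
qed

text \<open>The quotient s l / l is a unit of R, so negative exponents are covered too. This makes
  every \<open>J c\<close> stable under s.\<close>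

lemma s_l_powi: "\<exists>r\<in>R. s (l powi c) = l powi c * r"
proof -
  obtain r where r: "r \<in> R" "s l = l * r" using s_l by blast
  obtain u where u: "u \<in> R" "l = s l * u" using l_dvd_s_l by blast
  have ru: "r * u = 1" using u(2) r(2) l_nz by (metis mult.assoc mult_cancel_left1)
  have "r powi c \<in> R"
    using r u inverse_unique[OF ru] by (auto simp: power_int_def intro: R.power_in)
  moreover have "s (l powi c) = l powi c * r powi c"
    using r(2) by (simp add: s_powi l_L power_int_mult_distrib)
  ultimately show ?thesis by blast
qed

lemma s_J: "x \<in> J c \<Longrightarrow> s x \<in> J c"
proof -
  assume "x \<in> J c"
  then obtain r where r: "r \<in> R_P" "x = l powi c * r" by (auto simp: J_iff)
  obtain u where u: "u \<in> R" "s (l powi c) = l powi c * u" using s_l_powi by blast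
  have "s x = l powi c * (u * s r)" using r u by (simp add: s_mult l_powi_L R_P_L mult.assoc)
  then show ?thesis unfolding J_iff using r u by (blast intro: R_P.mult_in R_R_P s_R_P)
qed

text \<open>If t / p were in R for some t in T, it would lie in R and in K, hence in
  \<open>O_K\<close>, and t, a multiple of p, would be in P.\<close>

lemma inverse_p_notin: "inverse (of_nat p) \<notin> R_P"
proof
  assume "inverse (of_nat p) \<in> R_P"
  then obtain t where t: "t \<in> T" "t * inverse (of_nat p) \<in> R" by (auto simp: R_P_def)
  have "t * inverse (of_nat p) \<in> K"
    using t(1) by (intro K.mult_in K_inverse K.of_nat_in O_K_K T_O_K)
  then have "t * inverse (of_nat p) \<in> O_K" using t(2) by (simp add: O_K_def)
  from P_mult[OF this p_P] have "t \<in> P" using p_nz by (simp add: mult.assoc)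
  then show False using t(1) by (simp add: T_def)
qed

lemma inverse_l_notin: "inverse l \<notin> R_P"
proof
  assume *: "inverse l \<in> R_P"
  obtain r where r: "r \<in> R" "l ^ d = of_nat p * r" using l_p by blast
  moreover have "r \<noteq> 0" using r(2) l_nz by (metis mult_zero_right power_not_zero)
  ultimately have "inverse (of_nat p) = r * inverse l ^ d"
    using l_nz p_nz by (auto simp: field_simps)
  then show False using * r(1) inverse_p_notin by (metis R_P.mult_in R_P.power_in R_R_P)
qed

lemma J_strict: "l powi c \<in> J e \<Longrightarrow> e \<le> c"
proof (rule ccontr)
  assume *: "l powi c \<in> J e" "\<not> e \<le> c"
  then have "l powi c \<in> J (c + 1)" using J_antimono[of "c + 1" e] by auto
  then obtain r where "r \<in> R_P" "l powi c = l powi (c + 1) * r" by (auto simp: J_iff)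
  then have "l * r = 1" using l_nz by (auto simp: power_int_add)
  then have "inverse l = r" by (rule inverse_unique)
  then show False using inverse_l_notin \<open>r \<in> R_P\<close> by simp
qed

lemma J_inject: "J c = J e \<Longrightarrow> c = e"
  using J_strict l_powi_J by (metis order_antisym)

lemma int_coprime_T: "\<not> p dvd n \<Longrightarrow> of_nat n \<in> T"
proof -
  assume "\<not> p dvd n"
  then have "gcd (int n) (int p) = 1"
    using p_prime by (metis coprime_iff_gcd_eq_1 gcd_int_int_eq of_nat_1 prime_imp_coprime_nat coprime_commute)
  then obtain u v where uv: "u * int n + v * int p = 1" by (metis bezout_int)
  have "of_nat n \<notin> P"
  proof
    assume n: "of_nat n \<in> P"
    have "of_int u * of_nat n + of_int v * of_nat p \<in> P"
      by (intro P_add P_mult n p_P O_K.of_int_in)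
    also have "of_int u * of_nat n + of_int v * of_nat p = (of_int (u * int n + v * int p) :: complex)"
      by simp
    finally show False using uv one_P by simp
  qed
  then show ?thesis using O_K.of_nat_in by (simp add: T_def)
qed

text \<open>A positive integer divides some power of l in \<open>R_P\<close>: its part prime to p is
  a unit there, and l^d is a multiple of p. So an integer denominator of x bounds the order of x
  along the filtration from below, and a nonzero integer divisible by a multiple of x bounds it from
  above.\<close>

lemma J_bounds:
  assumes x: "x \<in> L"
  shows "\<exists>c. x \<in> J c" and "x \<noteq> 0 \<Longrightarrow> \<exists>b. \<forall>c. x \<in> J c \<longrightarrow> c \<le> b"
proof -
  have nat: "\<exists>r\<in>R_P. \<exists>c. l powi c = of_nat n * r" if n: "n > 0" for n
  proof -
    obtain m where m: "n = p ^ multiplicity p n * m" "\<not> p dvd m"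
      using multiplicity_decompose'[of n p] n p_prime not_prime_unit by (metis gr_implies_not0)
    obtain r where r: "r \<in> R" "l ^ d = of_nat p * r" using l_p by blast
    let ?i = "multiplicity p n"
    have mT: "of_nat m \<in> T" by (rule int_coprime_T[OF m(2)])
    have "l powi int (d * ?i) = (of_nat p * r) ^ ?i"
      by (simp only: power_int_of_nat power_mult r(2))
    also have "\<dots> = of_nat n * (r ^ ?i * inverse (of_nat m))"
      using T_nz[OF mT] by (subst (2) m(1)) (simp add: power_mult_distrib)
    finally show ?thesis
      using r mT by (intro bexI[of _ "r ^ ?i * inverse (of_nat m)"] exI R_P.mult_in
        R_P.power_in R_R_P[OF r(1)] inverse_T[OF mT])
  qed
  obtain n where n: "n > 0" "of_nat n * x \<in> R" using L_frac[OF x] by blast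
  obtain r c where r: "r \<in> R_P" "l powi c = of_nat n * r" using nat[OF n(1)] by blast
  have "l powi (- c) * l powi c = 1" using l_nz by (simp add: power_int_minus)
  then have "x = l powi (- c) * (r * (of_nat n * x))"
    unfolding r(2) by (metis mult.assoc mult.commute mult_1)
  moreover have "r * (of_nat n * x) \<in> R_P" by (rule R_P.mult_in[OF r(1) R_R_P[OF n(2)]])
  ultimately show "\<exists>c. x \<in> J c" unfolding J_iff by blast
  assume "x \<noteq> 0"
  then obtain y m where y: "y \<in> R" "m \<noteq> 0" "of_nat n * x * y = of_int m"
    using R_dvd[OF n(2)] n(1) by auto
  then obtain u e where u: "u \<in> R_P" "l powi e = of_nat (nat \<bar>m\<bar>) * u"
    using nat[of "nat \<bar>m\<bar>"] by auto
  have "(of_nat (nat \<bar>m\<bar>) :: complex) = of_int (sgn m) * of_int m"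
    by (auto simp: sgn_if abs_if)
  then have e: "l powi e = (of_int (sgn m) * of_nat n * y * u) * x"
    unfolding u(2) y(3)[symmetric] by (simp add: mult_ac)
  have "c \<le> e" if "x \<in> J c" for c
  proof -
    have "l powi e \<in> J c" unfolding e
      using that u y by (intro J_smult R_P.mult_in R_P.of_int_in R_P.of_nat_in R_R_P[OF y(1)])
    then show ?thesis by (rule J_strict)
  qed
  then show "\<exists>b. \<forall>c. x \<in> J c \<longrightarrow> c \<le> b" by blast
qed

text \<open>
  With \<open>\<epsilon>\<^sub>i = 1 - s\<^sup>i(x)\<^sup>Q\<^sup>-\<^sup>1\<close>, the product \<open>\<Prod> \<epsilon>\<^sub>i\<close> is fixed by \<open>s\<close>, kills \<open>x\<close> modulo \<open>l\<close>, and is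
  \<open>1\<close> modulo the ideal generated by the conjugates of \<open>x\<close>. This replaces the fact that \<open>s\<close> permutes
  the maximal ideals of \<open>R_P\<close> transitively.
\<close>

lemma stable_ideal_dichotomy:
  assumes M_add: "\<And>x y. x \<in> M \<Longrightarrow> y \<in> M \<Longrightarrow> x + y \<in> M"
    and M_mult: "\<And>r x. r \<in> R_P \<Longrightarrow> x \<in> M \<Longrightarrow> r * x \<in> M"
    and M_s: "\<And>x. x \<in> M \<Longrightarrow> s x \<in> M"
    and M_R_P: "M \<subseteq> R_P"
    and x: "x \<in> M" "x \<notin> J 1"
  shows "1 \<in> M"
proof -
  \<comment> \<open>Clearing the denominator brings x into R, where the Q-power congruence is
    available.\<close>
  obtain t where t: "t \<in> T" "t * x \<in> R" using x(1) M_R_P by (auto simp: R_P_def)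
  define y where "y = t * x"
  have y: "y \<in> R" "y \<in> M"
    unfolding y_def using t x M_mult R_R_P O_K_R T_O_K by blast+
  have y_L: "y \<in> L" using y(1) R_in_L by blast
  have M0: "0 \<in> M" using M_mult[OF R_P.zero_in x(1)] by simp
  define f where "f i = 1 - (s ^^ i) y ^ (Q - 1)" for i
  have f_R: "f i \<in> R" for i
    unfolding f_def by (intro R.diff_in R.one_in R.power_in funpow_R y)
  have f_conj: "f i = (s ^^ i) (f 0)" for i
  proof (induction i)
    case (Suc i)
    have "f (Suc i) = s (f i)"
      unfolding f_def using y_L
      by (subst s_diff) (auto simp: s_one s_power funpow_L L.one_in L.power_in)
    then show ?case using Suc by simp
  qed simp
  define u where "u = (\<Prod>i<N. f i)"
  have u_R: "u \<in> R" unfolding u_def by (intro R.prod_in f_R)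
  have "u = (\<Prod>i<N. (s ^^ i) (f 0))" unfolding u_def by (rule prod.cong) (auto intro: f_conj)
  also have "\<dots> \<in> K" by (intro prod_conj_K R_in_L f_R)
  finally have u: "u \<in> O_K" using u_R by (simp add: O_K_def)
  have y_conj: "(s ^^ i) y \<in> M" for i by (induction i) (auto intro: y M_s)
  have "1 - prod f I \<in> M" if "finite I" for I
    using that
  proof induction
    case (insert i I)
    have "1 - prod f (insert i I) = (1 - prod f I) + prod f I * ((s ^^ i) y ^ (Q - 2)) * (s ^^ i) y"
    proof -
      have "(s ^^ i) y ^ (Q - 1) = (s ^^ i) y ^ (Q - 2) * (s ^^ i) y"
        using Q_ge by (metis Suc_1 Suc_diff_Suc Suc_le_lessD diff_Suc_1 mult.commute power_Suc)
      then show ?thesis using insert by (simp add: f_def algebra_simps)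
    qed
    also have "\<dots> \<in> M"
      by (intro M_add insert M_mult R_P.mult_in R_R_P R.prod_in f_R R.power_in funpow_R y y_conj)
    finally show ?case .
  qed (use M0 in simp)
  then have 1: "1 - u \<in> M" unfolding u_def by blast
  \<comment> \<open>If u lies in P, then 1 - u is a unit of \<open>R_P\<close> that belongs to M.
    Otherwise u is a unit itself, and since u x is in l \<open>R_P\<close>, also x would be in
    \<open>J 1\<close>.\<close>
  show ?thesis
  proof (cases "u \<in> P")
    case True
    have "1 - u \<notin> P" using P_add[OF True, of "1 - u"] one_P by auto
    then have "1 - u \<in> T" using u by (simp add: T_def O_K.diff_in O_K.one_in)
    from M_mult[OF inverse_T[OF this] 1] show ?thesis
      using T_nz[OF \<open>1 - u \<in> T\<close>] by simp
  next
    case False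
    then have uT: "u \<in> T" using u by (simp add: T_def)
    obtain r where r: "r \<in> R" "y ^ Q - y = l * r"
      using frob[OF y(1)] by (auto simp: cgr_def)
    have "y * y ^ (Q - 1) = y ^ Q" using Q_ge by (simp flip: power_Suc)
    then have yf: "y * f 0 = l * (- r)" using r(2) by (simp add: f_def algebra_simps)
    have "u = f 0 * prod f ({..<N} - {0})"
      unfolding u_def using N_pos by (intro prod.remove) auto
    then have "u * t * x = y * f 0 * prod f ({..<N} - {0})"
      by (simp add: y_def mult_ac)
    also note yf
    finally have "u * t * x = l * (- r * prod f ({..<N} - {0}))"
      by (simp only: mult.assoc)
    then have "x = l powi 1 * (- r * prod f ({..<N} - {0}) * inverse u * inverse t)"
      using T_nz[OF uT] T_nz[OF t(1)] by (simp add: field_simps)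
    moreover have "- r * prod f ({..<N} - {0}) * inverse u * inverse t \<in> R_P"
      using r uT t by (intro R_P.mult_in inverse_T R_R_P R.minus_in R.prod_in f_R)
    ultimately have "x \<in> J 1" unfolding J_iff by blast
    with x show ?thesis by simp
  qed
qed

text \<open>Let e be the largest exponent with M inside \<open>J e\<close>; it exists because x0 has
  finite order. Then l^(-e) M is a stable ideal of \<open>R_P\<close> not contained in
  \<open>J 1\<close>, so the dichotomy puts 1 into it, that is, l^e into M.\<close>

theorem stable_module_eq_J:
  assumes M_add: "\<And>x y. x \<in> M \<Longrightarrow> y \<in> M \<Longrightarrow> x + y \<in> M"
    and M_mult: "\<And>r x. r \<in> R_P \<Longrightarrow> x \<in> M \<Longrightarrow> r * x \<in> M"
    and M_s: "\<And>x. x \<in> M \<Longrightarrow> s x \<in> M"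
    and M_bound: "M \<subseteq> J b" and M_nz: "x0 \<in> M" "x0 \<noteq> 0"
  shows "\<exists>c. M = J c"
proof -
  have M_L: "M \<subseteq> L" using M_bound J_L by blast
  obtain b' where b': "\<And>c. x0 \<in> J c \<Longrightarrow> c \<le> b'" using J_bounds(2) M_nz M_L by (metis subsetD)
  \<comment> \<open>Counted from b, so that the maximum runs over natural numbers;
    \<open>bnd\<close> is what guarantees its existence.\<close>
  define c where "c = (GREATEST n. M \<subseteq> J (b + int n))"
  have bnd: "n \<le> nat (b' - b)" if "M \<subseteq> J (b + int n)" for n
    using b'[of "b + int n"] that M_nz by auto
  have "M \<subseteq> J (b + int 0)" using M_bound by simp
  then have 1: "M \<subseteq> J (b + int c)" unfolding c_def
    by (rule GreatestI_nat[where b = "nat (b' - b)"]) (use bnd in auto)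
  have 2: "\<not> M \<subseteq> J (b + int (Suc c))"
  proof
    assume "M \<subseteq> J (b + int (Suc c))"
    then have "Suc c \<le> c" unfolding c_def
      by (rule Greatest_le_nat[where b = "nat (b' - b)"]) (use bnd in auto)
    then show False by simp
  qed
  define e where "e = b + int c"
  define M' where "M' = {x\<in>L. l powi e * x \<in> M}"
  have "b + int (Suc c) = e + 1" by (simp add: e_def)
  with 2 have "\<not> M \<subseteq> J (e + 1)" by metis
  then obtain x where x: "x \<in> M" "x \<notin> J (e + 1)" by blast
  have "1 \<in> M'"
  proof (rule stable_ideal_dichotomy)
    show "x + y \<in> M'" if "x \<in> M'" "y \<in> M'" for x y
      using that M_add by (auto simp: M'_def distrib_left L.add_in)
    show "r * x \<in> M'" if "r \<in> R_P" "x \<in> M'" for r x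
      using that M_mult[of r "l powi e * x"] by (auto simp: M'_def mult_ac L.mult_in R_P_L)
    show "s x \<in> M'" if x: "x \<in> M'" for x
    proof -
      \<comment> \<open>The power l^(-e) is not fixed by s but only multiplied by an element u of R,
        which M absorbs.\<close>
      obtain u where u: "u \<in> R" "s (l powi (- e)) = l powi (- e) * u" using s_l_powi by blast
      have "x = l powi (- e) * (l powi e * x)" using l_nz by (simp add: power_int_minus)
      moreover have "l powi e * x \<in> M" "x \<in> L" using x by (auto simp: M'_def)
      ultimately have "s x = l powi (- e) * u * s (l powi e * x)"
        using u(2) M_L by (metis s_mult l_powi_L subsetD)
      then have "l powi e * s x = u * s (l powi e * x)"
        using l_nz by (simp add: power_int_minus)
      then show ?thesis using M_mult[OF R_R_P[OF u(1)] M_s] x s_L by (auto simp: M'_def)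
    qed
    show "M' \<subseteq> R_P"
    proof
      fix x assume "x \<in> M'"
      then have "l powi e * x \<in> J e" using 1 by (auto simp: M'_def e_def)
      then show "x \<in> R_P" using l_nz by (auto simp: J_iff)
    qed
    have x_L: "x \<in> L" using x(1) M_L by blast
    have "l powi e * (l powi (- e) * x) = x" using l_nz by (simp add: power_int_minus)
    then show "l powi (- e) * x \<in> M'"
      using x(1) L.mult_in[OF l_powi_L x_L] unfolding M'_def by (simp only: mem_Collect_eq)
    show "l powi (- e) * x \<notin> J 1"
    proof
      assume "l powi (- e) * x \<in> J 1"
      from J_mult[OF l_powi_J[of e] this] have "x \<in> J (e + 1)"
        by (simp only: \<open>l powi e * (l powi (- e) * x) = x\<close>)
      with x(2) show False by simp
    qed
  qed
  then have "l powi e \<in> M" by (simp add: M'_def)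
  then have "J e \<subseteq> M" using M_mult by (auto simp: J_iff mult.commute)
  then show ?thesis using 1 unfolding e_def by blast
qed

text \<open>Multiplication by an element a of K commutes with s, so a \<open>R_P\<close> is a stable
  module and therefore some \<open>J c\<close>. In other words, nonzero elements of K are powers of
  l up to units of \<open>R_P\<close>, although l itself need not lie in K.\<close>

lemma principal_eq_J:
  assumes a: "a \<in> K" "a \<noteq> 0"
  obtains c where "\<And>x e. x \<in> L \<Longrightarrow> a * x \<in> J (c + e) \<longleftrightarrow> x \<in> J e" "\<And>x. x \<in> R_P \<Longrightarrow> a * x \<in> J c" "a \<in> J c" "l powi c * inverse a \<in> R_P"
proof -
  have a_L: "a \<in> L" using a K_L by blast
  obtain b where b: "a \<in> J b" using J_bounds(1) a_L by blast
  have "\<exists>c. (\<lambda>x. a * x) ` R_P = J c"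
  proof (rule stable_module_eq_J)
    show "(\<lambda>x. a * x) ` R_P \<subseteq> J b" using b J_smult by (auto simp: mult.commute)
    show "a * 1 \<in> (\<lambda>x. a * x) ` R_P" using R_P.one_in by blast
    show "a * 1 \<noteq> 0" using a by simp
    show "x + y \<in> (\<lambda>x. a * x) ` R_P" if "x \<in> (\<lambda>x. a * x) ` R_P" "y \<in> (\<lambda>x. a * x) ` R_P" for x y
      using that by (auto simp flip: distrib_left intro!: imageI R_P.add_in)
    show "r * x \<in> (\<lambda>x. a * x) ` R_P" if "r \<in> R_P" "x \<in> (\<lambda>x. a * x) ` R_P" for r x
      using that by (auto simp: mult.left_commute intro!: imageI R_P.mult_in)
    show "s x \<in> (\<lambda>x. a * x) ` R_P" if "x \<in> (\<lambda>x. a * x) ` R_P" for x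
      using that a by (auto simp: K_def s_mult R_P_L intro!: imageI s_R_P)
  qed
  then obtain c where c: "(\<lambda>x. a * x) ` R_P = J c" by blast
  have aJ: "a \<in> J c" using c R_P.one_in by (metis image_eqI mult.right_neutral)
  obtain r where r: "r \<in> R_P" "l powi c = a * r" using l_powi_J[of c] unfolding c[symmetric] by blast
  have r': "r = l powi c * inverse a" using r(2) a by simp
  have 3: "a * x \<in> J (c + e) \<longleftrightarrow> x \<in> J e" if "x \<in> L" for x e
  proof
    show "x \<in> J e \<Longrightarrow> a * x \<in> J (c + e)" by (rule J_mult[OF aJ])
    assume "a * x \<in> J (c + e)"
    then obtain u where u: "u \<in> R_P" "a * x = l powi (c + e) * u" by (auto simp: J_iff)
    have "x = l powi e * (r * u)"
      using u(2) r a l_nz by (simp add: power_int_add)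
    then show "x \<in> J e" unfolding J_iff using r u by (blast intro: R_P.mult_in)
  qed
  show thesis
  proof (rule that[of c])
    show "a * x \<in> J (c + e) \<longleftrightarrow> x \<in> J e" if "x \<in> L" for x e using 3[OF that] .
    show "a * x \<in> J c" if "x \<in> R_P" for x using that c by blast
    show "a \<in> J c" by (fact aJ)
    show "l powi c * inverse a \<in> R_P" using r(1) unfolding r' .
  qed
qed

end

section \<open>Ideals of rings of algebraic integers\<close>

definition sub_ring :: "complex set \<Rightarrow> complex ring" where
  "sub_ring R = class_ring \<lparr>carrier := R\<rparr>"

lemma sub_ring_simps [simp]:
  "carrier (sub_ring R) = R" "x \<otimes>\<^bsub>sub_ring R\<^esub> y = x * y" "x \<oplus>\<^bsub>sub_ring R\<^esub> y = x + y"
  "\<one>\<^bsub>sub_ring R\<^esub> = 1" "\<zero>\<^bsub>sub_ring R\<^esub> = 0"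
  by (simp_all add: sub_ring_def class_ring_simps)

lemma (in csubring) cring_sub_ring: "cring (sub_ring R)"
proof (rule cringI)
  show "abelian_group (sub_ring R)"
  proof (rule abelian_groupI)
    fix x assume "x \<in> carrier (sub_ring R)"
    then show "\<exists>y\<in>carrier (sub_ring R). y \<oplus>\<^bsub>sub_ring R\<^esub> x = \<zero>\<^bsub>sub_ring R\<^esub>"
      by (intro bexI[of _ "- x"]) (auto simp: minus_in)
  qed (auto simp: add_in zero_in)
  show "comm_monoid (sub_ring R)"
    by (rule comm_monoidI) (auto simp: mult_in one_in)
qed (auto simp: distrib_right)

lemma (in csubring) ideal_sub_ring_iff:
  "ideal I (sub_ring R) \<longleftrightarrow> I \<subseteq> R \<and> 0 \<in> I \<and> (\<forall>x\<in>I. \<forall>y\<in>I. x + y \<in> I) \<and> (\<forall>r\<in>R. \<forall>x\<in>I. r * x \<in> I)"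
proof
  assume I: "ideal I (sub_ring R)"
  interpret I: ideal I "sub_ring R" by fact
  show "I \<subseteq> R \<and> 0 \<in> I \<and> (\<forall>x\<in>I. \<forall>y\<in>I. x + y \<in> I) \<and> (\<forall>r\<in>R. \<forall>x\<in>I. r * x \<in> I)"
    using I.a_subset additive_subgroup.zero_closed[OF ideal.axioms(1)[OF I]]
      additive_subgroup.a_closed[OF ideal.axioms(1)[OF I]] I.I_l_closed by auto
next
  assume *: "I \<subseteq> R \<and> 0 \<in> I \<and> (\<forall>x\<in>I. \<forall>y\<in>I. x + y \<in> I) \<and> (\<forall>r\<in>R. \<forall>x\<in>I. r * x \<in> I)"
  then have comm: "x * r \<in> I" if "r \<in> R" "x \<in> I" for r x
    using that by (metis mult.commute)
  interpret cring "sub_ring R" by (rule cring_sub_ring)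
  show "ideal I (sub_ring R)"
  proof (rule idealI)
    show "ring (sub_ring R)" by (rule ring_axioms)
    show "subgroup I (add_monoid (sub_ring R))"
    proof (rule add.subgroupI)
      fix x assume x: "x \<in> I"
      have "- 1 \<in> R" by (intro minus_in one_in)
      with x * have "(- 1) * x \<in> I" by blast
      then have mx: "- x \<in> I" by simp
      have "\<ominus>\<^bsub>sub_ring R\<^esub> x = - x"
        using x mx * by (intro minus_equality) auto
      then show "\<ominus>\<^bsub>sub_ring R\<^esub> x \<in> I"
        using mx by simp
    qed (use * in auto)
  qed (use * comm in auto)
qed

lemma (in csubring) primeideal_sub_ring_iff:
  "primeideal I (sub_ring R) \<longleftrightarrow> ideal I (sub_ring R) \<and> 1 \<notin> I \<and>
    (\<forall>x\<in>R. \<forall>y\<in>R. x * y \<in> I \<longrightarrow> x \<in> I \<or> y \<in> I)"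
proof
  assume I: "primeideal I (sub_ring R)"
  interpret I: primeideal I "sub_ring R" by fact
  have "1 \<notin> I" using I.one_imp_carrier I.I_notcarr by auto
  then show "ideal I (sub_ring R) \<and> 1 \<notin> I \<and> (\<forall>x\<in>R. \<forall>y\<in>R. x * y \<in> I \<longrightarrow> x \<in> I \<or> y \<in> I)"
    using I.I_prime I.ideal_axioms by auto
next
  assume *: "ideal I (sub_ring R) \<and> 1 \<notin> I \<and> (\<forall>x\<in>R. \<forall>y\<in>R. x * y \<in> I \<longrightarrow> x \<in> I \<or> y \<in> I)"
  show "primeideal I (sub_ring R)"
  proof (rule primeidealI)
    show "carrier (sub_ring R) \<noteq> I" using * one_in by auto
  qed (use * cring_sub_ring in auto)
qed

lemma ideal_pow_0: "ideal_pow R I 0 = carrier R"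
  by (simp add: ideal_pow_def nat_pow_def ideals_set_def)

lemma ideal_pow_Suc: "ideal_pow R I (Suc m) = ideal_prod R (ideal_pow R I m) I"
  by (simp add: ideal_pow_def nat_pow_def ideals_set_def)

lemma (in csubring) ideal_ideal_pow:
  assumes "ideal I (sub_ring R)"
  shows "ideal (ideal_pow (sub_ring R) I m) (sub_ring R)"
proof -
  interpret cring "sub_ring R" by (rule cring_sub_ring)
  show ?thesis
    by (induction m) (use oneideal in \<open>auto simp: ideal_pow_0 ideal_pow_Suc assms intro!: ideal_prod_is_ideal\<close>)
qed

lemma (in csubring) ideal_pow_subset:
  assumes "ideal I (sub_ring R)" "m \<ge> 1"
  shows "ideal_pow (sub_ring R) I m \<subseteq> I"
proof -
  interpret cring "sub_ring R" by (rule cring_sub_ring)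
  obtain m' where m: "m = Suc m'" using assms(2) by (cases m) auto
  have I: "I \<subseteq> R" "\<And>x y. x \<in> I \<Longrightarrow> y \<in> I \<Longrightarrow> x + y \<in> I" "\<And>r x. r \<in> R \<Longrightarrow> x \<in> I \<Longrightarrow> r * x \<in> I"
    using ideal_sub_ring_iff[THEN iffD1, OF assms(1)] by blast+
  have sub: "ideal_pow (sub_ring R) I m' \<subseteq> R"
    using ideal_sub_ring_iff[THEN iffD1, OF ideal_ideal_pow[OF assms(1), of m']] by blast
  show ?thesis
  proof
    fix x assume "x \<in> ideal_pow (sub_ring R) I m"
    then show "x \<in> I" unfolding m ideal_pow_Suc
      by (induction rule: ideal_prod.induct) (use sub I in auto)
  qed
qed

section \<open>Completions\<close>

locale integral_galois = galois_order +
  assumes R_eq: "R = {x\<in>L. algebraic_int x}"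
begin

lemma int_ring_L: "int_ring L = sub_ring R"
  by (simp only: int_ring_def sub_ring_def flip: R_eq)

lemma int_ring_K: "int_ring K = sub_ring O_K"
proof -
  have "x \<in> O_K \<longleftrightarrow> x \<in> K \<and> algebraic_int x" for x
    using R_eq K_L[of x] unfolding O_K_def by (metis (lifting) IntE IntI mem_Collect_eq)
  then have "{x\<in>K. algebraic_int x} = O_K" by blast
  then show ?thesis by (simp only: int_ring_def sub_ring_def)
qed

end

locale valued_field =
  fixes v :: "'f::field \<Rightarrow> int"
  assumes v_mult: "x \<noteq> 0 \<Longrightarrow> y \<noteq> 0 \<Longrightarrow> v (x * y) = v x + v y"
    and v_add: "x \<noteq> 0 \<Longrightarrow> y \<noteq> 0 \<Longrightarrow> x + y \<noteq> 0 \<Longrightarrow> min (v x) (v y) \<le> v (x + y)"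
begin

lemma v_one: "v 1 = 0"
  using v_mult[of 1 1] by simp

lemma v_minus_one: "v (- 1) = 0"
  using v_mult[of "-1" "-1"] by (simp add: v_one)

lemma v_minus: "v (- x) = v x"
proof (cases "x = 0")
  case False
  then show ?thesis using v_mult[of "-1" x] by (simp add: v_minus_one)
qed simp

lemma v_inverse: "x \<noteq> 0 \<Longrightarrow> v (inverse x) = - v x"
  using v_mult[of x "inverse x"] by (simp add: v_one)

lemma v_power: "x \<noteq> 0 \<Longrightarrow> v (x ^ i) = int i * v x"
  by (induction i) (auto simp: v_one v_mult algebra_simps)

lemma v_powi: "x \<noteq> 0 \<Longrightarrow> v (x powi c) = c * v x"
  by (auto simp: power_int_def v_power v_inverse)

lemma val_ring_add: "x \<in> val_ring v \<Longrightarrow> y \<in> val_ring v \<Longrightarrow> x + y \<in> val_ring v"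
proof (cases "x = 0 \<or> y = 0 \<or> x + y = 0")
  case False
  assume "x \<in> val_ring v" "y \<in> val_ring v"
  then have "min (v x) (v y) \<ge> 0" using False by (simp add: val_ring_def)
  moreover have "min (v x) (v y) \<le> v (x + y)" using False by (intro v_add) auto
  ultimately show ?thesis unfolding val_ring_def by (simp only: mem_Collect_eq) linarith
qed (auto simp: val_ring_def)

lemma val_ring_mult: "x \<in> val_ring v \<Longrightarrow> y \<in> val_ring v \<Longrightarrow> x * y \<in> val_ring v"
  by (cases "x = 0"; cases "y = 0") (auto simp: val_ring_def v_mult)

lemma val_ring_minus: "x \<in> val_ring v \<Longrightarrow> - x \<in> val_ring v"
  by (auto simp: val_ring_def v_minus)

lemma val_ring_0: "0 \<in> val_ring v" and val_ring_1: "1 \<in> val_ring v"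
  by (auto simp: val_ring_def v_one)

lemma val_ring_sum: "(\<And>i. i \<in> I \<Longrightarrow> f i \<in> val_ring v) \<Longrightarrow> sum f I \<in> val_ring v"
  by (induction I rule: infinite_finite_induct) (auto intro: val_ring_0 val_ring_add)

end

locale galois_completion = integral_galois +
  fixes P :: "complex set" and \<iota> :: "complex \<Rightarrow> 'f::field" and v :: "'f \<Rightarrow> int"
  assumes place: "finite_place K P"
    and completion: "completion_at K P \<iota> v"
    and ex_unif: "\<exists>\<pi>. uniformizer v \<pi>"
begin

sublocale completion_at K P \<iota> v by (rule completion)

sublocale valued_field v using v_mult v_add by unfold_locales

lemma P_facts: "P \<subseteq> O_K" "0 \<in> P" "x \<in> P \<Longrightarrow> y \<in> P \<Longrightarrow> x + y \<in> P"
  "r \<in> O_K \<Longrightarrow> x \<in> P \<Longrightarrow> r * x \<in> P" "1 \<notin> P"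
  "x \<in> O_K \<Longrightarrow> y \<in> O_K \<Longrightarrow> x * y \<in> P \<Longrightarrow> x \<in> P \<or> y \<in> P"
  "ideal P (sub_ring O_K)"
  using place by (auto simp: finite_place_def int_ring_K O_K.primeideal_sub_ring_iff O_K.ideal_sub_ring_iff)

lemma iota_mult: "x \<in> K \<Longrightarrow> y \<in> K \<Longrightarrow> \<iota> (x * y) = \<iota> x * \<iota> y"
  using embedding by (auto simp: Ring.ring_hom_def class_ring_simps)

lemma iota_add: "x \<in> K \<Longrightarrow> y \<in> K \<Longrightarrow> \<iota> (x + y) = \<iota> x + \<iota> y"
  using embedding by (auto simp: Ring.ring_hom_def class_ring_simps)

lemma iota_one: "\<iota> 1 = 1"
  using embedding by (auto simp: Ring.ring_hom_def class_ring_simps)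

lemma iota_zero: "\<iota> 0 = 0"
proof -
  have "\<iota> 0 + \<iota> 0 = \<iota> 0 + 0" using iota_add[OF K.zero_in K.zero_in] by (simp only: add_0_right)
  then show ?thesis by (simp only: add_left_cancel)
qed

lemma iota_minus: "x \<in> K \<Longrightarrow> \<iota> (- x) = - \<iota> x"
  using iota_add[of x "- x"] K.minus_in[of x] by (simp add: iota_zero add_eq_0_iff)

lemma iota_sum: "(\<And>i. i \<in> I \<Longrightarrow> f i \<in> K) \<Longrightarrow> \<iota> (sum f I) = (\<Sum>i\<in>I. \<iota> (f i))"
  by (induction I rule: infinite_finite_induct) (auto simp: iota_zero iota_add K.sum_in)

lemma iota_inverse: "x \<in> K \<Longrightarrow> \<iota> (inverse x) = inverse (\<iota> x)"
proof (cases "x = 0")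
  case False
  assume x: "x \<in> K"
  have "\<iota> x * \<iota> (inverse x) = 1"
    using iota_mult[OF x K_inverse[OF x]] False by (simp add: iota_one)
  then show ?thesis by (metis inverse_unique)
qed (simp add: iota_zero)

lemma iota_nz: "x \<in> K \<Longrightarrow> x \<noteq> 0 \<Longrightarrow> \<iota> x \<noteq> 0"
proof
  assume x: "x \<in> K" "x \<noteq> 0" "\<iota> x = 0"
  have "\<iota> (x * inverse x) = 0" using x by (simp only: iota_mult K_inverse mult_zero_left)
  then show False using x by (simp add: iota_one)
qed

lemma iota_powi: "x \<in> K \<Longrightarrow> \<iota> (x powi c) = \<iota> x powi c"
proof -
  assume x: "x \<in> K"
  have "\<iota> (y ^ i) = \<iota> y ^ i" if "y \<in> K" for y i
    using that by (induction i) (auto simp: iota_one iota_mult K.power_in)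
  then show ?thesis using x by (auto simp: power_int_def iota_inverse K_inverse)
qed

lemma O_K_val_ring: "a \<in> O_K \<Longrightarrow> \<iota> a \<in> val_ring v"
  using v_extends[of a] iota_zero by (cases "a = 0") (auto simp: val_ring_def int_ring_K)

text \<open>Density: by the ultrametric inequality, an element of K that approximates a uniformizer
  to precision 2 has value exactly 1.\<close>

lemma ex_unif_K: "\<exists>a\<in>K. a \<noteq> 0 \<and> v (\<iota> a) = 1"
proof -
  obtain \<pi> where \<pi>: "\<pi> \<noteq> 0" "v \<pi> = 1" using ex_unif by (auto simp: uniformizer_def)
  obtain a where a: "a \<in> K" "val_close v 2 \<pi> (\<iota> a)" using dense by blast
  have "v (\<iota> a) = 1"
  proof (cases "\<pi> = \<iota> a")
    case False
    then have 1: "\<pi> - \<iota> a \<noteq> 0" "v (\<pi> - \<iota> a) \<ge> 2" using a by (auto simp: val_close_def)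
    have nz: "\<iota> a \<noteq> 0" using 1 \<pi> by auto
    have "v (\<iota> a) \<ge> 1"
      using v_add[of \<pi> "- (\<pi> - \<iota> a)"] 1 \<pi> nz v_minus[of "\<pi> - \<iota> a"] by auto
    moreover have "v \<pi> \<ge> min (v (\<pi> - \<iota> a)) (v (\<iota> a))"
      using v_add[of "\<pi> - \<iota> a" "\<iota> a"] 1 \<pi> nz by auto
    ultimately show ?thesis using 1 \<pi> by auto
  qed (use \<pi> in simp)
  moreover have "a \<noteq> 0"
  proof
    assume "a = 0"
    then have "v \<pi> \<ge> 2" using a \<pi> by (auto simp: val_close_def iota_zero)
    then show False using \<pi> by simp
  qed
  ultimately show ?thesis using a by blast
qed

text \<open>This will turn out to be P. That P is contained in it is not immediate: a greatest
  exponent carries information only once the exponents are known to be bounded. \<open>P_eq\<close>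
  obtains the equality from maximality.\<close>

definition P' where "P' = {a\<in>O_K. a = 0 \<or> v (\<iota> a) \<ge> 1}"

text \<open>For an integer of K outside P the only power of P that contains it is the zeroth, so
  here the greatest exponent is known to be 0.\<close>

lemma P'_P: "P' \<subseteq> P"
proof
  fix a assume a: "a \<in> P'"
  show "a \<in> P"
  proof (rule ccontr)
    assume na: "a \<notin> P"
    then have nz: "a \<noteq> 0" using P_facts by auto
    have "a \<in> ideal_pow (int_ring K) P m \<longleftrightarrow> m = 0" for m
      using O_K.ideal_pow_subset[OF P_facts(7), of m] a na
      by (cases m) (auto simp: int_ring_K ideal_pow_0 P'_def)
    then have "(GREATEST m. a \<in> ideal_pow (int_ring K) P m) = 0"
      by (intro Greatest_equality) auto
    then show False using a nz v_extends[of a] by (auto simp: P'_def int_ring_K)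
  qed
qed

text \<open>An element of K of value 1, cleared of its denominator, divides a nonzero integer with
  cofactor in \<open>O_K\<close>. That integer has positive value, hence so has one of its prime
  factors.\<close>

lemma residue_prime: "\<exists>p. prime p \<and> of_nat p \<in> P'"
proof -
  obtain a where a: "a \<in> K" "a \<noteq> 0" "v (\<iota> a) = 1" using ex_unif_K by blast
  obtain n where n: "n > 0" "of_nat n * a \<in> R" using L_frac K_L a by blast
  have b: "of_nat n * a \<in> O_K" using n a by (simp add: O_K_def K.mult_in K.of_nat_in)
  obtain y m where y: "y \<in> R" "m \<noteq> 0" "of_nat n * a * y = of_int m"
    using R_dvd[OF n(2)] n(1) a(2) by auto
  have "y = of_int m / (of_nat n * a)" using y(3) n(1) a(2) by (simp add: field_simps)
  then have "y \<in> K" using b by (auto intro: K_divide K.of_int_in simp: O_K_def)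
  then have y': "y \<in> O_K" using y by (simp add: O_K_def)
  have nO: "of_nat n \<in> O_K" by (rule O_K.of_nat_in)
  have y_nz: "y \<noteq> 0" using y by auto
  have "v (\<iota> (of_int m)) = v (\<iota> (of_nat n)) + v (\<iota> a) + v (\<iota> y)"
    unfolding y(3)[symmetric] using a n y' y_nz nO
    by (simp add: iota_mult v_mult iota_nz O_K_K K.mult_in)
  moreover have "v (\<iota> (of_nat n)) \<ge> 0" "v (\<iota> y) \<ge> 0"
    using O_K_val_ring[OF nO] O_K_val_ring[OF y'] iota_nz[OF O_K_K[OF nO]] iota_nz[OF O_K_K[OF y']] n y_nz
    by (auto simp: val_ring_def)
  ultimately have "v (\<iota> (of_int m)) \<ge> 1" using a by simp
  moreover have "\<iota> (of_int m) = \<iota> (of_nat (nat \<bar>m\<bar>)) \<or> \<iota> (of_int m) = - \<iota> (of_nat (nat \<bar>m\<bar>))"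
    using iota_minus[OF K.of_nat_in, of "nat \<bar>m\<bar>"] by (auto simp: abs_if)
  ultimately have "v (\<iota> (of_nat (nat \<bar>m\<bar>))) \<ge> 1" by (auto simp: v_minus)
  moreover have "nat \<bar>m\<bar> > 0" using y by simp
  moreover have *: "\<exists>p. prime p \<and> v (\<iota> (of_nat p)) \<ge> 1" if "v (\<iota> (of_nat n)) \<ge> 1" "n > 0" for n
    using that
  proof (induction n rule: prime_divisors_induct)
    case (unit n)
    then show ?case by (simp add: iota_one v_one)
  next
    case (factor q n)
    have nz: "\<iota> (of_nat q) \<noteq> 0" "\<iota> (of_nat n) \<noteq> 0"
      using factor.prems by (intro iota_nz K.of_nat_in; simp)+
    have "v (\<iota> (of_nat (q * n))) = v (\<iota> (of_nat q)) + v (\<iota> (of_nat n))"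
      using nz by (simp add: iota_mult K.of_nat_in v_mult)
    then consider "v (\<iota> (of_nat q)) \<ge> 1" | "v (\<iota> (of_nat n)) \<ge> 1" using factor.prems by linarith
    then show ?case
    proof cases
      case 1
      then show ?thesis using factor.hyps by auto
    next
      case 2
      then show ?thesis using factor by auto
    qed
  qed simp
  ultimately have "\<exists>p. prime p \<and> v (\<iota> (of_nat p)) \<ge> 1" by blast
  then show ?thesis unfolding P'_def using O_K.of_nat_in by blast
qed

end

section \<open>Comparison of the filtration with the valuation of the completion\<close>

locale frobenius_completion = galois_completion + frobenius_order +
  assumes p_P': "of_nat p \<in> P'"
begin

sublocale frobenius_place R L s N p l Q d P
proof
  show "of_nat p \<in> P" using p_P' P'_P by blast
qed (use P_facts in auto)

text \<open>Divisibility by l cannot be expressed inside K. Raising to the d-th power replaces l by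
  p, and then the quotient lies both in R and in K.\<close>

lemma frob_O_K:
  assumes a: "a \<in> O_K"
  shows "\<exists>b\<in>O_K. (a ^ Q - a) ^ d = of_nat p * b"
proof -
  obtain r where r: "r \<in> R" "a ^ Q - a = l * r" using frob[OF O_K_R[OF a]] by (auto simp: cgr_def)
  obtain u where u: "u \<in> R" "l ^ d = of_nat p * u" using l_p by blast
  have 1: "(a ^ Q - a) ^ d = of_nat p * (u * r ^ d)"
    by (simp add: r(2) u(2) power_mult_distrib mult.assoc)
  have "u * r ^ d = (a ^ Q - a) ^ d / of_nat p" unfolding 1 using p_nz by simp
  moreover have "\<dots> \<in> K"
    using a by (intro K_divide K.power_in K.diff_in K.of_nat_in O_K_K)
  ultimately have "u * r ^ d \<in> K" by (simp only:)
  then have "u * r ^ d \<in> O_K" using R.mult_in[OF u(1) R.power_in[OF r(1)]] by (simp add: O_K_def)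
  with 1 show ?thesis by blast
qed

lemma P'_mult: "x \<in> O_K \<Longrightarrow> y \<in> P' \<Longrightarrow> x * y \<in> P'"
proof -
  assume *: "x \<in> O_K" "y \<in> P'"
  then have y: "y \<in> O_K" by (simp add: P'_def)
  show ?thesis
  proof (cases "x = 0 \<or> y = 0")
    case False
    have nz: "\<iota> x \<noteq> 0" "\<iota> y \<noteq> 0" using False iota_nz * y O_K_K by metis+
    have "v (\<iota> x) \<ge> 0" using O_K_val_ring[OF *(1)] nz by (auto simp: val_ring_def)
    then show ?thesis using * y nz False v_mult[of "\<iota> x" "\<iota> y"]
      by (auto simp: P'_def iota_mult O_K_K O_K.mult_in)
  qed (use O_K.zero_in in \<open>auto simp: P'_def\<close>)
qed

lemma P'_prime: "x \<in> O_K \<Longrightarrow> y \<in> O_K \<Longrightarrow> x * y \<in> P' \<Longrightarrow> x \<in> P' \<or> y \<in> P'"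
proof (cases "x = 0 \<or> y = 0")
  case False
  assume *: "x \<in> O_K" "y \<in> O_K" "x * y \<in> P'"
  have nz: "\<iota> x \<noteq> 0" "\<iota> y \<noteq> 0" using False iota_nz * O_K_K by metis+
  have "v (\<iota> x) \<ge> 0" "v (\<iota> y) \<ge> 0"
    using O_K_val_ring *(1,2) nz by (auto simp: val_ring_def)
  then show ?thesis using * nz False v_mult[of "\<iota> x" "\<iota> y"]
    by (auto simp: P'_def iota_mult O_K_K)
qed (use O_K.zero_in in \<open>auto simp: P'_def\<close>)

text \<open>Modulo a prime ideal above \<open>p\<close>, every element is fixed by the \<open>Q\<close>-power map, so the quotient is a field.\<close>

lemma prime_above_p_maximal:
  assumes I: "of_nat p \<in> I" "I \<subseteq> P" "\<And>x y. x \<in> O_K \<Longrightarrow> y \<in> I \<Longrightarrow> x * y \<in> I"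
    "\<And>x y. x \<in> O_K \<Longrightarrow> y \<in> O_K \<Longrightarrow> x * y \<in> I \<Longrightarrow> x \<in> I \<or> y \<in> I"
  shows "I = P"
proof
  show "P \<subseteq> I"
  proof
    fix a assume a: "a \<in> P"
    then have aO: "a \<in> O_K" using P_O_K by blast
    show "a \<in> I"
    proof (rule ccontr)
      assume na: "a \<notin> I"
      obtain b where "b \<in> O_K" "(a ^ Q - a) ^ d = of_nat p * b" using frob_O_K[OF aO] by blast
      then have "(a ^ Q - a) ^ d \<in> I" using I(1,3) by (simp add: mult.commute)
      moreover have "x ^ i \<in> I \<Longrightarrow> x \<in> I" if "x \<in> O_K" for x i
      proof (induction i)
        case 0
        then show ?case using I(3)[OF that, of 1] by simp
      next
        case (Suc i)
        then show ?case using I(4)[OF that, of "x ^ i"] that O_K.power_in by auto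
      qed
      ultimately have "a ^ Q - a \<in> I" using aO by (meson O_K.diff_in O_K.power_in)
      moreover have "a ^ Q - a = a * (a ^ (Q - 1) - 1)"
        using Q_ge by (simp add: right_diff_distrib flip: power_Suc)
      \<comment> \<open>With a in P and Q >= 2, the power a^(Q-1) is in P; since a^(Q-1) - 1 is in
        I, hence in P, so is 1, the contradiction sought.\<close>
      ultimately have "a ^ (Q - 1) - 1 \<in> I"
        using I(4)[OF aO, of "a ^ (Q - 1) - 1"] na aO
        by (auto intro: O_K.diff_in O_K.power_in O_K.one_in)
      then have 1: "(-1) * (a ^ (Q - 1) - 1) \<in> P"
        using I(2) by (intro P_mult O_K.minus_in O_K.one_in) auto
      have "a ^ (Q - 2) * a \<in> P" using aO a by (intro P_mult O_K.power_in)
      moreover have "a ^ (Q - 2) * a = a ^ (Q - 1)"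
        using Q_ge by (metis Suc_1 Suc_diff_Suc Suc_le_lessD diff_Suc_1 mult.commute power_Suc)
      ultimately show False using P_add[OF 1, of "a ^ (Q - 1)"] one_P by simp
    qed
  qed
qed (fact I(2))

lemma P_eq: "P = P'"
  using prime_above_p_maximal[OF p_P' P'_P P'_mult P'_prime] by simp

lemma v_T: "t \<in> T \<Longrightarrow> v (\<iota> t) = 0"
proof -
  assume t: "t \<in> T"
  have "\<iota> t \<noteq> 0" using t T_nz by (intro iota_nz O_K_K T_O_K)
  then have "v (\<iota> t) \<ge> 0" using O_K_val_ring[OF T_O_K[OF t]] by (auto simp: val_ring_def)
  moreover have "\<not> v (\<iota> t) \<ge> 1"
  proof
    assume "v (\<iota> t) \<ge> 1"
    then have "t \<in> P" unfolding P_eq using T_O_K[OF t] by (simp add: P'_def)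
    then show False using t by (simp add: T_def)
  qed
  ultimately show ?thesis by simp
qed

lemma R_P_K: "x \<in> R_P \<Longrightarrow> x \<in> K \<Longrightarrow> \<exists>t\<in>T. t * x \<in> O_K"
  by (auto simp: R_P_def O_K_def T_def intro!: K.mult_in)

text \<open>An element of K in \<open>R_P\<close> has a denominator of value 0, which gives one
  direction. For the other, if x is not in \<open>R_P\<close>, then x \<open>R_P\<close> =
  \<open>J c\<close> with c < 0, so the inverse of x lies in \<open>J 1\<close>, and nonzero
  elements of K in \<open>J 1\<close> have positive value.\<close>

lemma R_P_val_ring: "x \<in> K \<Longrightarrow> x \<in> R_P \<longleftrightarrow> \<iota> x \<in> val_ring v"
proof (cases "x = 0")
  case False
  assume x: "x \<in> K"
  have 1: "v (\<iota> x) \<ge> 0" if x: "x \<in> K" "x \<in> R_P" "x \<noteq> 0" for x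
  proof -
    obtain t where t: "t \<in> T" "t * x \<in> O_K" using R_P_K x by blast
    have nz: "\<iota> t \<noteq> 0" "\<iota> x \<noteq> 0" using x t T_nz iota_nz O_K_K T_O_K by metis+
    have "\<iota> (t * x) = \<iota> t * \<iota> x" using t x by (simp add: iota_mult O_K_K T_O_K)
    then have "0 \<le> v (\<iota> t) + v (\<iota> x)"
      using O_K_val_ring[OF t(2)] nz by (auto simp: val_ring_def v_mult)
    then show ?thesis using v_T[OF t(1)] by simp
  qed
  \<comment> \<open>The d-th power of x lies in p \<open>R_P\<close>, because l^d is a multiple of
    p, and p has positive value.\<close>
  have 2: "v (\<iota> x) \<ge> 1" if x: "x \<in> K" "x \<in> J 1" "x \<noteq> 0" for x
  proof -
    have "x \<in> R_P" using x(2) J_antimono[of 0 1] by (auto simp: J_0)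
    then obtain t where t: "t \<in> T" "t * x \<in> O_K" using R_P_K x by blast
    obtain u where u: "u \<in> R" "l ^ d = of_nat p * u" using l_p by blast
    obtain r where r: "r \<in> R_P" "x = l * r" using x(2) by (auto simp: J_iff)
    obtain w where w: "w \<in> T" "w * (u * r ^ d) \<in> R"
      using R_P.mult_in[OF R_R_P[OF u(1)] R_P.power_in[OF r(1)]] by (auto simp: R_P_def)
    have "x ^ d = of_nat p * (u * r ^ d)" by (simp add: r(2) u(2) power_mult_distrib mult.assoc)
    then have eq: "w * x ^ d = of_nat p * (w * (u * r ^ d))" by simp
    have "w * (u * r ^ d) = w * x ^ d / of_nat p"
      unfolding eq using nonzero_mult_div_cancel_left[OF p_nz] by metis
    also have "\<dots> \<in> K"
      by (intro K_divide K.mult_in K.power_in K.of_nat_in O_K_K[OF T_O_K[OF w(1)]] x(1))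
    finally have "w * (u * r ^ d) \<in> O_K" using w by (simp add: O_K_def)
    then have "w * x ^ d \<in> P'" unfolding eq mult.commute[of "of_nat p"] using p_P' by (intro P'_mult)
    moreover have nz: "\<iota> w \<noteq> 0" "\<iota> x \<noteq> 0" using x w T_nz iota_nz O_K_K T_O_K by metis+
    moreover have "\<iota> (w * x powi int d) = \<iota> w * \<iota> x powi int d"
      using w x K_powi by (simp only: iota_mult iota_powi O_K_K T_O_K)
    ultimately have "1 \<le> v (\<iota> w) + int d * v (\<iota> x)"
      using x w T_nz[OF w(1)] by (auto simp: P'_def v_mult v_power)
    then show ?thesis using v_T[OF w(1)] by (smt (verit) mult_nonneg_nonpos of_nat_0_le_iff)
  qed
  obtain c where c: "\<And>y e. y \<in> L \<Longrightarrow> x * y \<in> J (c + e) \<longleftrightarrow> y \<in> J e" "x \<in> J c"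
    using principal_eq_J[OF x False] by metis
  have nz: "\<iota> x \<noteq> 0" using iota_nz x False by blast
  show ?thesis
  proof
    assume "x \<in> R_P"
    then show "\<iota> x \<in> val_ring v" using 1[OF x _ False] by (simp add: val_ring_def)
  next
    assume xv: "\<iota> x \<in> val_ring v"
    show "x \<in> R_P"
    proof (rule ccontr)
      assume "x \<notin> R_P"
      then have "c < 0" using c(2) J_antimono[of 0 c] by (force simp: J_0)
      have "x * inverse x \<in> J (c + (- c))" using False R_P.one_in by (simp add: J_0)
      then have "inverse x \<in> J (- c)" using c(1) L_inverse K_L x by blast
      then have "inverse x \<in> J 1" using J_antimono[of 1 "- c"] \<open>c < 0\<close> by auto
      then have "v (\<iota> (inverse x)) \<ge> 1" using 2[of "inverse x"] x False K_inverse by simp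
      then show False using xv nz by (simp add: iota_inverse x v_inverse val_ring_def)
    qed
  qed
qed (simp add: R_P.zero_in iota_zero val_ring_0)

text \<open>For q in K of value 1, multiplication by q shifts the filtration by some e. Any other a
  is q^(v a) times an element of value 0, and \<open>R_P_val_ring\<close>, applied to that element
  and to its inverse, makes it a unit of \<open>R_P\<close>.\<close>

lemma ex_ramification_exponent:
  "\<exists>e>0. \<forall>a\<in>K. a \<noteq> 0 \<longrightarrow> (\<forall>x\<in>L. \<forall>c. a * x \<in> J (c + e * v (\<iota> a)) \<longleftrightarrow> x \<in> J c)"
proof -
  obtain q where q: "q \<in> K" "q \<noteq> 0" "v (\<iota> q) = 1" using ex_unif_K by blast
  have q_L: "q \<in> L" using q K_L by blast
  obtain e where e: "\<And>x c. x \<in> L \<Longrightarrow> q * x \<in> J (e + c) \<longleftrightarrow> x \<in> J c"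
    using principal_eq_J[OF q(1,2)] by metis
  have e0: "e > 0"
  proof (rule ccontr)
    assume "\<not> e > 0"
    then have "q * inverse q \<in> J (e + 0)"
      using q R_P.one_in J_antimono[of e 0] by (auto simp: J_0)
    then have "inverse q \<in> R_P" using e[of "inverse q" 0] L_inverse[OF q_L] by (simp add: J_0)
    then have "\<iota> (inverse q) \<in> val_ring v" using R_P_val_ring[OF K_inverse[OF q(1)]] by simp
    then show False using q iota_nz[OF q(1,2)] by (simp add: iota_inverse val_ring_def v_inverse)
  qed
  have nat: "q ^ i * x \<in> J (c + e * int i) \<longleftrightarrow> x \<in> J c" if "x \<in> L" for i x c
    using that
  proof (induction i arbitrary: x c)
    case (Suc i)
    have "q ^ Suc i * x = q ^ i * (q * x)" by simp
    moreover have "c + e * int (Suc i) = (e + c) + e * int i" by (simp add: algebra_simps)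
    ultimately show ?case using Suc e L.mult_in[OF q_L] by metis
  qed simp
  have int: "q powi i * x \<in> J (c + e * i) \<longleftrightarrow> x \<in> J c" if x: "x \<in> L" for i x c
  proof (cases "i \<ge> 0")
    case True
    then show ?thesis using nat[OF x, of "nat i" c] by (simp add: power_int_def)
  next
    case False
    have "inverse q ^ nat (- i) * x \<in> L" using x q_L by (intro L.mult_in L.power_in L_inverse)
    from nat[OF this, of "nat (- i)" "c + e * i"] False show ?thesis
      using q by (simp add: power_int_def field_simps)
  qed
  have "a * x \<in> J (c + e * v (\<iota> a)) \<longleftrightarrow> x \<in> J c" if a: "a \<in> K" "a \<noteq> 0" and x: "x \<in> L" for a x c
  proof -
    define u where "u = q powi (- v (\<iota> a)) * a"
    have u: "u \<in> K" "u \<noteq> 0" using a q by (auto simp: u_def intro!: K.mult_in K_powi)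
    have "v (\<iota> u) = 0"
      using a q iota_nz by (simp add: u_def iota_mult K_powi iota_powi v_mult v_powi)
    then have "\<iota> u \<in> val_ring v" "\<iota> (inverse u) \<in> val_ring v"
      using iota_nz[OF u] u by (auto simp: val_ring_def iota_inverse v_inverse)
    then have uR: "u \<in> R_P" "inverse u \<in> R_P" using R_P_val_ring u K_inverse by blast+
    have a_eq: "a * x = q powi (v (\<iota> a)) * (u * x)"
      using q by (simp add: u_def power_int_minus)
    have "a * x \<in> J (c + e * v (\<iota> a)) \<longleftrightarrow> u * x \<in> J c"
      unfolding a_eq using u x K_L by (intro int L.mult_in) auto
    also have "\<dots> \<longleftrightarrow> x \<in> J c"
    proof
      assume "u * x \<in> J c"
      from J_smult[OF uR(2) this] have "inverse u * (u * x) \<in> J c" .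
      also have "inverse u * (u * x) = x" using u by (simp flip: mult.assoc)
      finally show "x \<in> J c" .
    qed (rule J_smult[OF uR(1)])
    finally show ?thesis .
  qed
  with e0 show ?thesis by blast
qed

definition e where
  "e = (SOME e. e > 0 \<and> (\<forall>a\<in>K. a \<noteq> 0 \<longrightarrow> (\<forall>x\<in>L. \<forall>c. a * x \<in> J (c + e * v (\<iota> a)) \<longleftrightarrow> x \<in> J c)))"

lemma e_pos: "e > 0"
  and J_scale: "a \<in> K \<Longrightarrow> a \<noteq> 0 \<Longrightarrow> x \<in> L \<Longrightarrow> a * x \<in> J (c + e * v (\<iota> a)) \<longleftrightarrow> x \<in> J c"
  using someI_ex[OF ex_ramification_exponent] unfolding e_def by blast+

section \<open>Ramification indices\<close>

text \<open>Locally at q the ideal q is generated by l: for y in q the factor t = 1 - y^(Q-1) lies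
  outside q, and t y = y - y^Q is a multiple of l. For powers of q such denominators are
  multiplied.\<close>

lemma ideal_pow_localised:
  assumes q: "primeideal q (sub_ring R)" "l \<in> q" and x: "x \<in> ideal_pow (sub_ring R) q m"
  shows "\<exists>t\<in>R - q. \<exists>r\<in>R. t * x = l ^ m * r"
proof -
  note q' = R.primeideal_sub_ring_iff[THEN iffD1, OF q(1)]
  have q_id: "ideal q (sub_ring R)" using q' by blast
  note q_id' = R.ideal_sub_ring_iff[THEN iffD1, OF q_id]
  have mult: "t * u \<in> R - q" if "t \<in> R - q" "u \<in> R - q" for t u
    using that q' R.mult_in by blast
  have base: "\<exists>t\<in>R - q. \<exists>r\<in>R. t * y = l * r" if y: "y \<in> q" for y
  proof -
    have yR: "y \<in> R" using y q_id' by blast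
    obtain r where r: "r \<in> R" "y ^ Q - y = l * r" using frob[OF yR] by (auto simp: cgr_def)
    define t where "t = 1 - y ^ (Q - 1)"
    have tR: "t \<in> R" unfolding t_def by (intro R.diff_in R.one_in R.power_in yR)
    have "y ^ (Q - 2) * y = y ^ (Q - 1)"
      using Q_ge by (metis Suc_1 Suc_diff_Suc Suc_le_lessD diff_Suc_1 mult.commute power_Suc)
    then have "y ^ (Q - 1) \<in> q" using q_id' y R.power_in[OF yR] by metis
    then have "t \<notin> q" using q' q_id' by (metis t_def diff_add_cancel)
    moreover have "y * y ^ (Q - 1) = y ^ Q" using Q_ge by (simp flip: power_Suc)
    then have "t * y = l * (- r)" using r(2) by (simp add: t_def algebra_simps)
    ultimately show ?thesis using tR r R.minus_in by blast
  qed
  show ?thesis using x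
  proof (induction m arbitrary: x)
    case 0
    then show ?case using q' R.one_in by (auto simp: ideal_pow_0 intro!: bexI[of _ 1])
  next
    case (Suc m)
    from Suc.prems show ?case unfolding ideal_pow_Suc
    proof (induction rule: ideal_prod.induct)
      case (prod i j)
      obtain t r where t: "t \<in> R - q" "r \<in> R" "t * i = l ^ m * r" using Suc.IH[OF prod(1)] by blast
      obtain u w where u: "u \<in> R - q" "w \<in> R" "u * j = l * w" using base[OF prod(2)] by blast
      have "t * u * (i * j) = (t * i) * (u * j)" by (simp add: mult_ac)
      also have "\<dots> = l ^ Suc m * (r * w)" unfolding t(3) u(3) by (simp add: mult_ac)
      finally show ?case using mult[OF t(1) u(1)] R.mult_in[OF t(2) u(2)] by auto
    next
      case (sum s1 s2)
      obtain t r where t: "t \<in> R - q" "r \<in> R" "t * s1 = l ^ Suc m * r" using sum.IH(1) by blast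
      obtain u w where u: "u \<in> R - q" "w \<in> R" "u * s2 = l ^ Suc m * w" using sum.IH(2) by blast
      have "t * u * (s1 + s2) = u * (t * s1) + t * (u * s2)" by (simp add: algebra_simps)
      also have "\<dots> = l ^ Suc m * (u * r + t * w)" unfolding t(3) u(3) by (simp add: algebra_simps)
      moreover have "u * r + t * w \<in> R" using t u by (intro R.add_in R.mult_in) auto
      ultimately show ?case using mult[OF t(1) u(1)] by auto
    qed
  qed
qed

lemma power_in_ideal_pow:
  assumes "ideal q (sub_ring R)" "y \<in> q"
  shows "y ^ m \<in> ideal_pow (sub_ring R) q m"
proof (induction m)
  case 0
  show ?case by (simp add: ideal_pow_0 R.one_in)
next
  case (Suc m)
  have "y ^ m \<otimes>\<^bsub>sub_ring R\<^esub> y \<in> ideal_prod (sub_ring R) (ideal_pow (sub_ring R) q m) q"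
    using Suc assms(2) by (rule ideal_prod.prod)
  then show ?case by (simp add: ideal_pow_Suc mult.commute)
qed

lemma J_nat_R: "x \<in> R \<Longrightarrow> x \<in> J (int m) \<Longrightarrow> \<exists>t\<in>T. \<exists>r\<in>R. t * x = l ^ m * r"
proof -
  assume "x \<in> J (int m)"
  then obtain r where r: "r \<in> R_P" "x = l ^ m * r" by (auto simp: J_iff)
  then obtain t where "t \<in> T" "t * r \<in> R" by (auto simp: R_P_def)
  moreover have "t * x = l ^ m * (t * r)" using r by (simp add: mult_ac)
  ultimately show ?thesis by blast
qed

text \<open>The exponent of q is measured by l, which generates q locally. An element a of P lies in
  \<open>J e\<close>, so t a is in l^e R for some t outside q, and t can be cancelled modulo the
  e-th power of q. Conversely, an element of \<open>O_K\<close> of value exactly 1 lies in no higher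
  power.\<close>

theorem ramification_index_eq:
  assumes q: "lies_over L q K P"
  shows "ramification_index L q P = nat e"
proof -
  have qp: "primeideal q (sub_ring R)" and qK: "q \<inter> K = P"
    using q by (auto simp: lies_over_def finite_place_def int_ring_L)
  note q' = R.primeideal_sub_ring_iff[THEN iffD1, OF qp]
  have q_id: "ideal q (sub_ring R)" using q' by blast
  note q_id' = R.ideal_sub_ring_iff[THEN iffD1, OF q_id]
  interpret Rr: cring "sub_ring R" by (rule R.cring_sub_ring)
  have T_q: "t \<notin> q" if "t \<in> T" for t
    using that qK O_K_K by (auto simp: T_def)
  have lq: "l \<in> q"
  proof -
    obtain r where r: "r \<in> R" "l ^ d = of_nat p * r" using l_p by blast
    have "of_nat p \<in> q" using p_P qK by blast
    then have ld: "l ^ d \<in> q" using q_id' r by (metis mult.commute)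
    have "l ^ i \<in> q \<Longrightarrow> l \<in> q" for i
    proof (induction i)
      case (Suc i)
      then show ?case using q' l_in R.power_in[OF l_in, of i] by (metis power_Suc)
    qed (use q' in auto)
    with ld show ?thesis by blast
  qed
  define m0 where "m0 = nat e"
  have m0: "int m0 = e" using e_pos by (simp add: m0_def)
  have val: "a \<in> J (e * v (\<iota> a))" if "a \<in> K" "a \<noteq> 0" for a
    using J_scale[OF that L.one_in, of 0] R_P.one_in by (simp add: J_0)
  have "P \<subseteq> ideal_pow (sub_ring R) q m0"
  proof
    fix a assume a: "a \<in> P"
    note I = R.ideal_sub_ring_iff[THEN iffD1, OF R.ideal_ideal_pow[OF q_id, of m0]]
    show "a \<in> ideal_pow (sub_ring R) q m0"
    proof (cases "a = 0")
      case False
      have aO: "a \<in> O_K" using a P_O_K by blast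
      have "v (\<iota> a) \<ge> 1" using a False unfolding P_eq by (simp add: P'_def)
      then have "e \<le> e * v (\<iota> a)" using e_pos by simp
      then have "J (e * v (\<iota> a)) \<subseteq> J e" by (rule J_antimono)
      then have "a \<in> J (int m0)" unfolding m0 using val[OF O_K_K[OF aO] False] by (rule subsetD)
      then obtain t r where t: "t \<in> T" "r \<in> R" "t * a = l ^ m0 * r"
        using J_nat_R[OF O_K_R[OF aO]] by blast
      have ta: "t * a \<in> ideal_pow (sub_ring R) q m0"
        unfolding t(3) mult.commute[of "l ^ m0"] using I t(2) power_in_ideal_pow[OF q_id lq] by blast
      have tR: "t \<in> R" using t by (simp add: O_K_R T_O_K)
      obtain r' where r': "r' \<in> R" "t ^ Q - t = l * r'" using frob[OF tR] by (auto simp: cgr_def)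
      \<comment> \<open>An inverse of t modulo q, because t^Q = t modulo l and t is not in q. Thus y
        = 1 - t u lies in q, and writing y^m0 as 1 - t g inverts t modulo the m0-th power of
        q.\<close>
      define u where "u = t ^ (Q - 2)"
      have uR: "u \<in> R" unfolding u_def by (intro R.power_in tR)
      have tu: "t * u = t ^ (Q - 1)"
        using Q_ge unfolding u_def by (metis Suc_1 Suc_diff_Suc Suc_le_lessD diff_Suc_1 power_Suc)
      define y where "y = 1 - t * u"
      have yR: "y \<in> R" unfolding y_def by (intro R.diff_in R.one_in R.mult_in tR uR)
      have "t * t ^ (Q - 1) = t ^ Q" using Q_ge by (simp flip: power_Suc)
      then have "t * y = (- r') * l" using r'(2) by (simp add: y_def tu algebra_simps)
      then have "t * y \<in> q" using q_id' lq R.minus_in[OF r'(1)] by metis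
      then have yq: "y \<in> q" using q' tR yR T_q[OF t(1)] by blast
      have "\<exists>g\<in>R. y ^ i = 1 - t * g" for i
      proof (induction i)
        case 0
        show ?case using R.zero_in by (intro bexI[of _ 0]) auto
      next
        case (Suc i)
        then obtain g where g: "g \<in> R" "y ^ i = 1 - t * g" by blast
        have "y ^ Suc i = 1 - t * (u + g - t * u * g)"
          unfolding power_Suc g(2) by (simp add: y_def algebra_simps)
        moreover have "u + g - t * u * g \<in> R" using g uR tR by (intro R.add_in R.diff_in R.mult_in)
        ultimately show ?case by blast
      qed
      then obtain g where g: "g \<in> R" "y ^ m0 = 1 - t * g" by blast
      have "a = a * y ^ m0 + g * (t * a)" unfolding g(2) by (simp add: algebra_simps)
      moreover have "a * y ^ m0 \<in> ideal_pow (sub_ring R) q m0"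
        using I power_in_ideal_pow[OF q_id yq] O_K_R[OF aO] by blast
      moreover have "g * (t * a) \<in> ideal_pow (sub_ring R) q m0" using I g(1) ta by blast
      ultimately show ?thesis using I by metis
    qed (use I in simp)
  qed
  then have 1: "genideal (sub_ring R) P \<subseteq> ideal_pow (sub_ring R) q m0"
    by (intro Rr.genideal_minimal R.ideal_ideal_pow q_id)
  have 2: "m \<le> m0" if m: "genideal (sub_ring R) P \<subseteq> ideal_pow (sub_ring R) q m" for m
  proof (rule ccontr)
    assume "\<not> m \<le> m0"
    then have "m = m0 + Suc (m - m0 - 1)" by simp
    then obtain j where j: "m = m0 + Suc j" by blast
    have P_R: "P \<subseteq> carrier (sub_ring R)" using P_O_K by (auto simp: O_K_R)
    obtain b where b: "b \<in> K" "b \<noteq> 0" "v (\<iota> b) = 1" using ex_unif_K by blast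
    have "b \<in> R_P" using R_P_val_ring[OF b(1)] b(3) by (simp add: val_ring_def)
    then obtain t where t: "t \<in> T" "t * b \<in> O_K" using R_P_K b(1) by blast
    \<comment> \<open>An element of value 1, cleared of its denominator by an element of T, which
      has value 0.\<close>
    define a where "a = t * b"
    have a: "a \<in> O_K" "a \<noteq> 0" using t b T_nz by (auto simp: a_def)
    have va: "v (\<iota> a) = 1"
      using b t T_nz[OF t(1)] iota_nz v_T[OF t(1)] by (simp add: a_def iota_mult T_O_K O_K_K v_mult)
    then have "a \<in> P" unfolding P_eq using a by (simp add: P'_def)
    then have "a \<in> ideal_pow (sub_ring R) q m" using m Rr.genideal_self[OF P_R] by blast
    from ideal_pow_localised[OF qp lq this] obtain u r where
      u: "u \<in> R - q" "r \<in> R" "u * a = l ^ m * r" by blast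
    have "inverse a * l ^ m0 \<in> L"
      by (intro L.mult_in[OF L_inverse[OF O_K_L[OF a(1)]] L.power_in[OF l_L]])
    moreover have "a * (inverse a * l ^ m0) = l powi e"
      unfolding m0[symmetric] using a(2) by (simp flip: mult.assoc)
    then have "a * (inverse a * l ^ m0) \<in> J (0 + e * v (\<iota> a))"
      using l_powi_J[of e] by (simp only: va mult_1_right add_0)
    ultimately have "inverse a * l ^ m0 \<in> R_P"
      using J_scale[OF O_K_K[OF a(1)] a(2)] J_0 by blast
    then obtain w where w: "w \<in> T" "w * (inverse a * l ^ m0) \<in> R" by (auto simp: R_P_def)
    \<comment> \<open>As a has value 1, l^m0 is a multiple of a in \<open>R_P\<close>. Combined with
      u a in l^m R for m > m0, this leaves l as a factor of u w, although neither u nor w is in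
      q.\<close>
    define c where "c = w * (inverse a * l ^ m0)"
    have ac: "a * c = w * l ^ m0" using a by (simp add: c_def field_simps)
    have "u * w * l ^ m0 = (u * a) * c" by (simp add: ac mult.assoc)
    also have "\<dots> = l ^ m0 * (l ^ j * r * c * l)" unfolding u(3) j by (simp add: power_add mult_ac)
    finally have "u * w = (l ^ j * r * c) * l" using l_nz by simp
    moreover have "(l ^ j * r * c) * l \<in> q"
      using q_id' lq u(2) w(2) l_in unfolding c_def[symmetric] by (meson R.mult_in R.power_in)
    ultimately have "u * w \<in> q" by simp
    then show False using q' u(1) T_q[OF w(1)] O_K_R[OF T_O_K[OF w(1)]] by blast
  qed
  have "(GREATEST m. genideal (sub_ring R) P \<subseteq> ideal_pow (sub_ring R) q m) = m0"
    using 1 2 by (rule Greatest_equality)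
  then show ?thesis by (simp add: ramification_index_def int_ring_L m0_def)
qed

text \<open>Zorn's lemma is applied to the ideals that contain p and meet K inside P; p R is one of
  them. A maximal one is prime, and its intersection with K is all of P by
  \<open>prime_above_p_maximal\<close>. Without such a prime, \<open>ramified\<close> would fail
  whatever \<open>e\<close> is.\<close>

lemma ex_lies_over: "\<exists>q. lies_over L q K P"
proof -
  define Z where "Z = {I. ideal I (sub_ring R) \<and> of_nat p \<in> I \<and> I \<inter> K \<subseteq> P}"
  define I0 where "I0 = (\<lambda>r. of_nat p * r) ` R"
  have "I0 \<in> Z"
  proof -
    have "ideal I0 (sub_ring R)"
      unfolding R.ideal_sub_ring_iff I0_def
    proof (intro conjI ballI)
      show "(\<lambda>r. of_nat p * r) ` R \<subseteq> R" by (auto intro: R.mult_in R.of_nat_in)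
      show "0 \<in> (\<lambda>r. of_nat p * r) ` R" using R.zero_in by force
      fix x y assume xy: "y \<in> (\<lambda>r. of_nat p * r) ` R"
      show "x + y \<in> (\<lambda>r. of_nat p * r) ` R" if "x \<in> (\<lambda>r. of_nat p * r) ` R"
        using that xy by (auto simp flip: distrib_left intro!: imageI R.add_in)
      show "x * y \<in> (\<lambda>r. of_nat p * r) ` R" if "x \<in> R"
        using that xy by (auto simp: mult.left_commute intro!: imageI R.mult_in)
    qed
    moreover have "of_nat p \<in> I0" unfolding I0_def using R.one_in by force
    moreover have "I0 \<inter> K \<subseteq> P"
    proof
      fix x assume "x \<in> I0 \<inter> K"
      then obtain r where r: "r \<in> R" "x = of_nat p * r" "x \<in> K" by (auto simp: I0_def)
      then have "r = x / of_nat p" using p_nz by simp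
      then have "r \<in> K" using r(3) by (auto intro: K_divide K.of_nat_in)
      then show "x \<in> P" using r P_mult[OF _ p_P, of r] by (simp add: O_K_def mult.commute)
    qed
    ultimately show ?thesis by (simp add: Z_def)
  qed
  have "\<exists>q\<in>Z. \<forall>I\<in>Z. q \<subseteq> I \<longrightarrow> I = q"
  proof (rule subset_Zorn_nonempty)
    show "Z \<noteq> {}" using \<open>I0 \<in> Z\<close> by blast
    fix C assume C: "C \<noteq> {}" "subset.chain Z C"
    have CZ: "I \<in> Z" if "I \<in> C" for I using C that by (auto simp: subset.chain_def)
    have id: "I \<subseteq> R \<and> 0 \<in> I \<and> (\<forall>x\<in>I. \<forall>y\<in>I. x + y \<in> I) \<and> (\<forall>r\<in>R. \<forall>x\<in>I. r * x \<in> I)" if "I \<in> C" for I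
      using CZ[OF that] by (auto simp: Z_def R.ideal_sub_ring_iff)
    have tot: "I \<subseteq> I' \<or> I' \<subseteq> I" if "I \<in> C" "I' \<in> C" for I I'
      using C that unfolding subset.chain_def by blast
    have "ideal (\<Union>C) (sub_ring R)"
      unfolding R.ideal_sub_ring_iff
    proof (intro conjI ballI)
      show "\<Union>C \<subseteq> R" using id by blast
      show "0 \<in> \<Union>C" using id C by blast
      show "x + y \<in> \<Union>C" if xy: "x \<in> \<Union>C" "y \<in> \<Union>C" for x y
      proof -
        obtain I I' where I: "I \<in> C" "x \<in> I" "I' \<in> C" "y \<in> I'" using xy by blast
        from tot[OF I(1,3)] show ?thesis
        proof
          assume "I \<subseteq> I'"
          then show ?thesis using id[OF I(3)] I by blast
        next
          assume "I' \<subseteq> I"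
          then show ?thesis using id[OF I(1)] I by blast
        qed
      qed
      show "r * x \<in> \<Union>C" if rx: "r \<in> R" "x \<in> \<Union>C" for r x
      proof -
        obtain I where I: "I \<in> C" "x \<in> I" using rx by blast
        then show ?thesis using id[OF I(1)] rx(1) by blast
      qed
    qed
    moreover have "of_nat p \<in> \<Union>C" using C CZ by (auto simp: Z_def)
    moreover have "\<Union>C \<inter> K \<subseteq> P" using CZ by (auto simp: Z_def)
    ultimately show "\<Union>C \<in> Z" by (simp add: Z_def)
  qed
  then obtain q where q: "q \<in> Z" "\<And>I. I \<in> Z \<Longrightarrow> q \<subseteq> I \<Longrightarrow> I = q" by blast
  have q_id: "ideal q (sub_ring R)" and pq: "of_nat p \<in> q" and qK: "q \<inter> K \<subseteq> P"
    using q(1) by (auto simp: Z_def)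
  note q_id' = R.ideal_sub_ring_iff[THEN iffD1, OF q_id]
  \<comment> \<open>By maximality, an element x outside q generates together with q an ideal that
    meets K outside P, hence meets T.\<close>
  have max: "\<exists>y\<in>q. \<exists>r\<in>R. y + r * x \<in> T" if x: "x \<in> R" "x \<notin> q" for x
  proof -
    define I where "I = {y + r * x |y r. y \<in> q \<and> r \<in> R}"
    have "ideal I (sub_ring R)" unfolding R.ideal_sub_ring_iff
    proof (intro conjI ballI)
      show "I \<subseteq> R" using q_id' x by (auto simp: I_def intro: R.add_in R.mult_in)
      show "0 \<in> I" unfolding I_def using q_id' R.zero_in by force
      fix a b assume b: "b \<in> I"
      then obtain y r where y: "b = y + r * x" "y \<in> q" "r \<in> R" by (auto simp: I_def)
      show "a + b \<in> I" if a: "a \<in> I"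
      proof -
        obtain y' r' where y': "a = y' + r' * x" "y' \<in> q" "r' \<in> R" using a by (auto simp: I_def)
        have "a + b = (y' + y) + (r' + r) * x" by (simp add: y y' algebra_simps)
        then show ?thesis unfolding I_def using y y' q_id' R.add_in by blast
      qed
      show "a * b \<in> I" if "a \<in> R"
      proof -
        have "a * b = a * y + (a * r) * x" by (simp add: y algebra_simps)
        then show ?thesis unfolding I_def using y that q_id' R.mult_in by blast
      qed
    qed
    moreover have "q \<subseteq> I"
    proof
      fix y assume "y \<in> q"
      then have "y = y + 0 * x \<and> y \<in> q \<and> 0 \<in> R" using R.zero_in by simp
      then show "y \<in> I" unfolding I_def by blast
    qed
    moreover have "x \<in> I"
    proof -
      have "x = 0 + 1 * x \<and> 0 \<in> q \<and> 1 \<in> R" using R.one_in q_id' by simp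
      then show ?thesis unfolding I_def by blast
    qed
    ultimately have "\<not> I \<inter> K \<subseteq> P" using q(2)[of I] pq x(2) by (auto simp: Z_def)
    then obtain t where t: "t \<in> I" "t \<in> K" "t \<notin> P" by blast
    then have "t \<in> T" using \<open>ideal I (sub_ring R)\<close> by (auto simp: T_def O_K_def R.ideal_sub_ring_iff)
    with t show ?thesis by (auto simp: I_def)
  qed
  have "1 \<notin> q" using qK one_P K.one_in by blast
  moreover have prime: "x \<in> q \<or> y \<in> q" if xy: "x \<in> R" "y \<in> R" "x * y \<in> q" for x y
  proof (rule ccontr)
    assume "\<not> (x \<in> q \<or> y \<in> q)"
    then obtain a r b w where a: "a \<in> q" "r \<in> R" "a + r * x \<in> T" and b: "b \<in> q" "w \<in> R" "b + w * y \<in> T"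
      using max xy by metis
    have "(a + r * x) * (b + w * y) = (b + w * y) * a + (r * x) * b + (r * w) * (x * y)"
      by (simp add: algebra_simps)
    moreover have "(b + w * y) * a \<in> q" "(r * x) * b \<in> q" "(r * w) * (x * y) \<in> q"
      using q_id' a b xy R.mult_in T_O_K O_K_R by blast+
    ultimately have "(a + r * x) * (b + w * y) \<in> q" using q_id' by metis
    moreover have "(a + r * x) * (b + w * y) \<in> T" using a b by (intro T_mult)
    ultimately show False using qK by (auto simp: T_def O_K_K)
  qed
  ultimately have qp: "primeideal q (sub_ring R)" using q_id by (simp add: R.primeideal_sub_ring_iff)
  have "q \<inter> K = P"
  proof (rule prime_above_p_maximal)
    show "of_nat p \<in> q \<inter> K" using pq K.of_nat_in by blast
    show "q \<inter> K \<subseteq> P" by (fact qK)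
    show "x * y \<in> q \<inter> K" if "x \<in> O_K" "y \<in> q \<inter> K" for x y
      using that q_id' K.mult_in O_K_K O_K_R by blast
    show "x \<in> q \<inter> K \<or> y \<in> q \<inter> K" if "x \<in> O_K" "y \<in> O_K" "x * y \<in> q \<inter> K" for x y
      using that prime[of x y] O_K_K O_K_R by blast
  qed
  moreover have "q \<noteq> {0}" using pq p_nz by auto
  ultimately show ?thesis using qp by (auto simp: lies_over_def finite_place_def int_ring_L)
qed

end

section \<open>Maximal orders over a discrete valuation ring\<close>

text \<open>\<open>mat_span\<close> indexes its generators by one number, so the n^2 matrix units
  are enumerated as k = i n + j.\<close>

lemma sum_div_mod:
  fixes f :: "nat \<Rightarrow> nat \<Rightarrow> 'b::comm_monoid_add"
  shows "(\<Sum>k<m * n. f (k div n) (k mod n)) = (\<Sum>i<m. \<Sum>j<n. f i j)"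
proof (cases "n = 0")
  case False
  have "(\<Sum>k<m * n. f (k div n) (k mod n)) = (\<Sum>i<m. \<Sum>k=i * n..<i * n + n. f (k div n) (k mod n))"
    by (rule sum.nat_group[symmetric])
  also have "\<dots> = (\<Sum>i<m. \<Sum>j<n. f i j)"
  proof (rule sum.cong)
    fix i
    have "(\<Sum>k=0 + i * n..<n + i * n. f (k div n) (k mod n)) = (\<Sum>j=0..<n. f ((j + i * n) div n) ((j + i * n) mod n))"
      by (rule sum.shift_bounds_nat_ivl)
    also have "\<dots> = (\<Sum>j<n. f i j)"
      using False by (intro sum.cong) auto
    finally show "(\<Sum>k=i * n..<i * n + n. f (k div n) (k mod n)) = (\<Sum>j<n. f i j)"
      by (simp add: add.commute)
  qed simp
  finally show ?thesis .
qed simp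

context valued_field
begin

lemma powi_val_ring: "\<pi> \<noteq> 0 \<Longrightarrow> v \<pi> = 1 \<Longrightarrow> - c \<le> v x \<Longrightarrow> \<pi> powi c * x \<in> val_ring v"
  by (cases "x = 0") (auto simp: val_ring_def v_mult v_powi)

lemma common_denominator:
  assumes \<pi>: "\<pi> \<noteq> 0" "v \<pi> = 1" and "finite I"
  shows "\<exists>m::nat. \<forall>i\<in>I. \<pi> ^ m * f i \<in> val_ring v"
  using assms(3)
proof induction
  case (insert i I)
  then obtain m where m: "\<forall>i\<in>I. \<pi> ^ m * f i \<in> val_ring v" by blast
  define j where "j = nat \<bar>v (f i)\<bar>"
  have \<pi>_in: "\<pi> ^ k \<in> val_ring v" for k using \<pi> by (auto simp: val_ring_def v_power)
  have "\<pi> ^ j * f i \<in> val_ring v"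
    using powi_val_ring[OF \<pi>, of "int j" "f i"] unfolding power_int_of_nat by (simp add: j_def)
  then have 1: "\<pi> ^ m * (\<pi> ^ j * f i) \<in> val_ring v" by (rule val_ring_mult[OF \<pi>_in])
  have 2: "\<pi> ^ j * (\<pi> ^ m * f i') \<in> val_ring v" if "i' \<in> I" for i'
    using val_ring_mult[OF \<pi>_in bspec[OF m that]] .
  have "\<forall>i'\<in>insert i I. \<pi> ^ (m + j) * f i' \<in> val_ring v"
    using 1 2 by (auto simp: power_add mult_ac)
  then show ?case by blast
qed simp

text \<open>The set is the ring of integral matrices, conjugated by G. In a larger order, an element
  with a non-integral entry x is turned by matrix units into x times a diagonal unit; all powers of
  it stay in the order, but their entries are unbounded, against finite generation.\<close>

lemma maximal_order_conj:
  assumes \<pi>: "\<pi> \<noteq> 0" "v \<pi> = 1"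
    and G: "G \<in> carrier_mat n n" and H: "H \<in> carrier_mat n n"
    and GH: "G * H = 1\<^sub>m n" and HG: "H * G = 1\<^sub>m n"
  shows "maximal_order v n {X\<in>carrier_mat n n. \<forall>i<n. \<forall>j<n. (H * X * G) $$ (i, j) \<in> val_ring v}"
    (is "maximal_order v n ?D")
proof -
  let ?O = "val_ring v"
  \<comment> \<open>The matrix unit at (k div n, k mod n), conjugated by G.\<close>
  define B where "B k = mat n n (\<lambda>(r, s). G $$ (r, k div n) * H $$ (k mod n, s))" for k
  have B: "B k \<in> carrier_mat n n" for k by (simp add: B_def)
  have conj: "G * (H * X * G) * H = X" if X: "X \<in> carrier_mat n n" for X
  proof -
    have "G * (H * X * G) * H = (G * H) * X * (G * H)"
      using X G H by (simp add: assoc_mult_mat[of _ n n _ n _ n])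
    then show ?thesis using X by (simp add: GH)
  qed
  have conj': "H * (G * Y * H) * G = Y" if Y: "Y \<in> carrier_mat n n" for Y
  proof -
    have "H * (G * Y * H) * G = (H * G) * Y * (H * G)"
      using Y G H by (simp add: assoc_mult_mat[of _ n n _ n _ n])
    then show ?thesis using Y by (simp add: HG)
  qed
  have comb: "mat n n (\<lambda>(r, s). \<Sum>k<n * n. c k * B k $$ (r, s)) = G * mat n n (\<lambda>(i, j). c (i * n + j)) * H"
    for c
  proof (rule eq_matI)
    fix r s assume "r < dim_row (G * mat n n (\<lambda>(i, j). c (i * n + j)) * H)"
      "s < dim_col (G * mat n n (\<lambda>(i, j). c (i * n + j)) * H)"
    then have rs: "r < n" "s < n" using G H by auto
    have "(\<Sum>k<n * n. c k * B k $$ (r, s)) = (\<Sum>k<n * n. c (k div n * n + k mod n) * (G $$ (r, k div n) * H $$ (k mod n, s)))"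
      using rs by (simp add: B_def)
    also have "\<dots> = (\<Sum>i<n. \<Sum>j<n. c (i * n + j) * (G $$ (r, i) * H $$ (j, s)))"
      by (rule sum_div_mod)
    also have "\<dots> = (\<Sum>j<n. \<Sum>i<n. c (i * n + j) * (G $$ (r, i) * H $$ (j, s)))"
      by (rule sum.swap)
    also have "\<dots> = (G * mat n n (\<lambda>(i, j). c (i * n + j)) * H) $$ (r, s)"
      using rs G H by (auto simp: scalar_prod_def atLeast0LessThan sum_distrib_left sum_distrib_right mult_ac intro!: sum.cong)
    finally show "mat n n (\<lambda>(r, s). \<Sum>k<n * n. c k * B k $$ (r, s)) $$ (r, s)
        = (G * mat n n (\<lambda>(i, j). c (i * n + j)) * H) $$ (r, s)"
      using rs by simp
  qed (use G H in auto)
  have span: "mat_span U n (n * n) B = {X\<in>carrier_mat n n. \<forall>i<n. \<forall>j<n. (H * X * G) $$ (i, j) \<in> U}" for U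
  proof (intro equalityI subsetI)
    fix X assume "X \<in> mat_span U n (n * n) B"
    then obtain c where c: "\<forall>k<n * n. c k \<in> U" "X = G * mat n n (\<lambda>(i, j). c (i * n + j)) * H"
      unfolding mat_span_def comb by blast
    have "H * X * G = mat n n (\<lambda>(i, j). c (i * n + j))"
      unfolding c(2) by (rule conj') simp
    moreover have "i * n + j < n * n" if "i < n" "j < n" for i j
    proof -
      have "i * n + j < Suc i * n" using that by simp
      also have "\<dots> \<le> n * n" using that by (intro mult_le_mono1) simp
      finally show ?thesis .
    qed
    ultimately have "\<forall>i<n. \<forall>j<n. (H * X * G) $$ (i, j) \<in> U"
      using c(1) by (simp del: index_mult_mat)
    moreover have "X \<in> carrier_mat n n" unfolding c(2) using G H by (intro mult_carrier_mat[of _ n n]) auto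
    ultimately show "X \<in> {X\<in>carrier_mat n n. \<forall>i<n. \<forall>j<n. (H * X * G) $$ (i, j) \<in> U}"
      by blast
  next
    fix X assume X: "X \<in> {X\<in>carrier_mat n n. \<forall>i<n. \<forall>j<n. (H * X * G) $$ (i, j) \<in> U}"
    define c where "c k = (H * X * G) $$ (k div n, k mod n)" for k
    have "mat n n (\<lambda>(i, j). c (i * n + j)) = H * X * G"
      using X G H by (intro eq_matI) (auto simp: c_def)
    then have "X = mat n n (\<lambda>(r, s). \<Sum>k<n * n. c k * B k $$ (r, s))"
      unfolding comb using conj X by simp
    moreover have "\<forall>k<n * n. c k \<in> U"
    proof (intro allI impI)
      fix k assume "k < n * n"
      then have "k div n < n" "k mod n < n"
        by (auto simp: less_mult_imp_div_less) (metis gr_implies_not0 mod_less_divisor mult_0 neq0_conv)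
      then show "c k \<in> U" using X by (simp add: c_def)
    qed
    ultimately show "X \<in> mat_span U n (n * n) B" unfolding mat_span_def by blast
  qed
  have D_mult: "X * Y \<in> ?D" if "X \<in> ?D" "Y \<in> ?D" for X Y
  proof -
    have XY: "X \<in> carrier_mat n n" "Y \<in> carrier_mat n n" using that by auto
    have "H * (X * Y) * G = H * X * (G * H) * Y * G"
      using XY H G by (simp add: GH assoc_mult_mat[of _ n n _ n _ n])
    also have "\<dots> = (H * X * G) * (H * Y * G)"
      using XY H G by (simp add: assoc_mult_mat[of _ n n _ n _ n])
    finally have eq: "H * (X * Y) * G = (H * X * G) * (H * Y * G)" .
    have "(H * (X * Y) * G) $$ (i, j) \<in> ?O" if ij: "i < n" "j < n" for i j
    proof -
      have "(H * (X * Y) * G) $$ (i, j) = (\<Sum>k<n. (H * X * G) $$ (i, k) * (H * Y * G) $$ (k, j))"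
        unfolding eq using ij XY G H by (simp add: scalar_prod_def atLeast0LessThan)
      also have "\<dots> \<in> ?O"
        using \<open>X \<in> ?D\<close> \<open>Y \<in> ?D\<close> ij by (intro val_ring_sum val_ring_mult) auto
      finally show ?thesis .
    qed
    then show ?thesis using XY by simp
  qed
  have order: "is_order v n ?D"
    unfolding is_order_def
  proof (intro conjI ballI)
    show "\<exists>m B. (\<forall>i<m. B i \<in> carrier_mat n n) \<and> ?D = mat_span ?O n m B \<and> mat_span UNIV n m B = carrier_mat n n"
      using B span[of ?O] span[of UNIV] by (intro exI[of _ "n * n"] exI[of _ B]) auto
    have "H * 1\<^sub>m n * G = 1\<^sub>m n" using H by (simp add: HG)
    then show "1\<^sub>m n \<in> ?D" by (simp add: val_ring_0 val_ring_1)
  qed (rule D_mult)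
  moreover have "D' = ?D" if D': "is_order v n D'" "?D \<subseteq> D'" for D'
  proof (intro equalityI D')
    obtain m C where C: "\<And>k. k < m \<Longrightarrow> C k \<in> carrier_mat n n" "D' = mat_span ?O n m C"
      using D'(1) unfolding is_order_def by blast
    have D'_carrier: "D' \<subseteq> carrier_mat n n" unfolding C(2) mat_span_def by auto
    show "D' \<subseteq> ?D"
    proof
      fix X assume X: "X \<in> D'"
      show "X \<in> ?D"
      proof (rule ccontr)
        assume "X \<notin> ?D"
        then obtain i j where ij: "i < n" "j < n" "(H * X * G) $$ (i, j) \<notin> ?O"
          using X D'_carrier by auto
        define x where "x = (H * X * G) $$ (i, j)"
        have x: "x \<noteq> 0" "v x \<le> -1" using ij(3) by (auto simp: x_def val_ring_def)
        define e where "e a b = mat n n (\<lambda>(r, s). if r = a \<and> s = b then 1 else 0 :: 'f)" for a b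
        have e: "e a b \<in> carrier_mat n n" for a b by (simp add: e_def)
        have unit: "G * e a b * H \<in> D'" for a b
        proof -
          have "H * (G * e a b * H) * G = e a b" by (rule conj'[OF e])
          moreover have "\<forall>i<n. \<forall>j<n. e a b $$ (i, j) \<in> ?O" by (simp add: e_def val_ring_0 val_ring_1)
          moreover have "G * e a b * H \<in> carrier_mat n n"
            using G H e by (intro mult_carrier_mat[of _ n n]) auto
          ultimately have "G * e a b * H \<in> ?D" by (simp del: index_mult_mat)
          then show ?thesis using D' by blast
        qed
        have mulD': "Y * Z \<in> D'" if "Y \<in> D'" "Z \<in> D'" for Y Z
          using D'(1) that unfolding is_order_def by blast
        define Y where "Y k = G * (x ^ k \<cdot>\<^sub>m e i i) * H" for k
        have "Y 1 = (G * e i i * H) * X * (G * e j i * H)"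
        proof -
          have XC: "X \<in> carrier_mat n n" using X D'_carrier by auto
          have "e i i * (H * X * G) * e j i = x \<cdot>\<^sub>m e i i"
          proof (rule eq_matI)
            fix r s assume "r < dim_row (x \<cdot>\<^sub>m e i i)" "s < dim_col (x \<cdot>\<^sub>m e i i)"
            then have rs: "r < n" "s < n" by (auto simp: e_def)
            have 1: "(e i i * (H * X * G)) $$ (r, t) = (if r = i then (H * X * G) $$ (i, t) else 0)" if "t < n" for t
            proof -
              have "(e i i * (H * X * G)) $$ (r, t) = (\<Sum>u<n. e i i $$ (r, u) * (H * X * G) $$ (u, t))"
                using rs that e H G XC by (simp add: scalar_prod_def atLeast0LessThan e_def)
              also have "\<dots> = (\<Sum>u<n. if u = i then (if r = i then (H * X * G) $$ (i, t) else 0) else 0)"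
                using rs by (intro sum.cong) (auto simp: e_def)
              also have "\<dots> = (if r = i then (H * X * G) $$ (i, t) else 0)" using ij by simp
              finally show ?thesis .
            qed
            have "(e i i * (H * X * G) * e j i) $$ (r, s) = (\<Sum>t<n. (e i i * (H * X * G)) $$ (r, t) * e j i $$ (t, s))"
              using rs e H G XC by (simp add: scalar_prod_def atLeast0LessThan e_def)
            also have "\<dots> = (\<Sum>t<n. if t = j then (if r = i \<and> s = i then x else 0) else 0)"
              using rs 1 by (intro sum.cong) (auto simp: e_def x_def)
            also have "\<dots> = (x \<cdot>\<^sub>m e i i) $$ (r, s)" using rs ij by (simp add: e_def)
            finally show "(e i i * (H * X * G) * e j i) $$ (r, s) = (x \<cdot>\<^sub>m e i i) $$ (r, s)" .
          qed (auto simp: e_def)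
          then have "Y 1 = G * (e i i * (H * X * G) * e j i) * H" by (simp add: Y_def)
          also have "\<dots> = (G * e i i * H) * X * (G * e j i * H)"
            using G H e[of i i] e[of j i] XC by (simp add: assoc_mult_mat[of _ n n _ n _ n])
          finally show ?thesis .
        qed
        then have Y1: "Y 1 \<in> D'" using unit X mulD' by simp
        have Y_Suc: "Y (Suc k) = Y k * Y 1" for k
        proof -
          have idem: "e i i * e i i = e i i"
          proof (rule eq_matI)
            fix r s assume "r < dim_row (e i i)" "s < dim_col (e i i)"
            then have rs: "r < n" "s < n" by (auto simp: e_def)
            have "(e i i * e i i) $$ (r, s) = (\<Sum>t<n. e i i $$ (r, t) * e i i $$ (t, s))"
              using rs by (simp add: scalar_prod_def atLeast0LessThan e_def)
            also have "\<dots> = (\<Sum>t<n. if t = i then (if r = i \<and> s = i then 1 else 0) else 0)"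
              using rs by (intro sum.cong) (auto simp: e_def)
            also have "\<dots> = e i i $$ (r, s)" using rs ij by (simp add: e_def)
            finally show "(e i i * e i i) $$ (r, s) = e i i $$ (r, s)" .
          qed (auto simp: e_def)
          have smult_smult: "a \<cdot>\<^sub>m (b \<cdot>\<^sub>m e i i) = (b * a) \<cdot>\<^sub>m e i i" for a b
            by (intro eq_matI) (auto simp: mult_ac)
          have "Y k * Y 1 = G * ((x ^ k \<cdot>\<^sub>m e i i) * (H * G) * (x \<cdot>\<^sub>m e i i)) * H"
            using G H smult_carrier_mat[OF e, of "x ^ k" i i] smult_carrier_mat[OF e, of x i i]
            unfolding Y_def by (simp add: assoc_mult_mat[of _ n n _ n _ n])
          also have "(x ^ k \<cdot>\<^sub>m e i i) * (H * G) * (x \<cdot>\<^sub>m e i i) = x ^ Suc k \<cdot>\<^sub>m e i i"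
            using e[of i i] smult_carrier_mat[OF e, of x i i] smult_carrier_mat[OF e, of "x ^ k" i i] unfolding HG
            by (simp add: mult_smult_assoc_mat[of _ n n _ n] mult_smult_distrib[of _ n n _ n] idem smult_smult mult.commute[of x])
          finally show ?thesis by (simp add: Y_def)
        qed
        have Y: "Y k \<in> D'" for k
        proof (induction k)
          case 0
          have "1 \<cdot>\<^sub>m e i i = e i i" by (rule eq_matI) auto
          then show ?case using unit by (simp add: Y_def)
        next
          case (Suc k)
          then show ?case unfolding Y_Suc using Y1 by (rule mulD')
        qed
        \<comment> \<open>One power of \<pi> clears the diagonal entry (i, i) of all generators,
          hence of all elements of D'.\<close>
        obtain q where q: "\<forall>k\<in>{..<m}. \<pi> ^ q * (H * C k * G) $$ (i, i) \<in> ?O"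
          using common_denominator[OF \<pi> finite_lessThan, of m "\<lambda>k. (H * C k * G) $$ (i, i)"] by blast
        have bound: "\<pi> ^ q * (H * Z * G) $$ (i, i) \<in> ?O" if "Z \<in> D'" for Z
        proof -
          obtain c where c: "\<forall>k<m. c k \<in> ?O" "Z = mat n n (\<lambda>(r, s). \<Sum>k<m. c k * C k $$ (r, s))"
            using \<open>Z \<in> D'\<close> unfolding C(2) mat_span_def by blast
          have "(H * Z * G) $$ (i, i) = (\<Sum>s<n. \<Sum>r<n. H $$ (i, r) * Z $$ (r, s) * G $$ (s, i))"
            using ij H G c(2) by (simp add: scalar_prod_def atLeast0LessThan sum_distrib_right)
          also have "\<dots> = (\<Sum>s<n. \<Sum>r<n. \<Sum>k<m. c k * (H $$ (i, r) * C k $$ (r, s) * G $$ (s, i)))"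
            by (intro sum.cong) (auto simp: c(2) sum_distrib_left sum_distrib_right mult_ac)
          also have "\<dots> = (\<Sum>s<n. \<Sum>k<m. \<Sum>r<n. c k * (H $$ (i, r) * C k $$ (r, s) * G $$ (s, i)))"
            by (rule sum.cong) (auto intro: sum.swap)
          also have "\<dots> = (\<Sum>k<m. \<Sum>s<n. \<Sum>r<n. c k * (H $$ (i, r) * C k $$ (r, s) * G $$ (s, i)))"
            by (rule sum.swap)
          also have "\<dots> = (\<Sum>k<m. c k * (H * C k * G) $$ (i, i))"
          proof (rule sum.cong)
            fix k assume "k \<in> {..<m}"
            then have "C k \<in> carrier_mat n n" using C by simp
            then show "(\<Sum>s<n. \<Sum>r<n. c k * (H $$ (i, r) * C k $$ (r, s) * G $$ (s, i))) = c k * (H * C k * G) $$ (i, i)"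
              using ij H G by (subst sum.swap)
                (simp add: scalar_prod_def atLeast0LessThan sum_distrib_right sum_distrib_left mult.assoc)
          qed simp
          finally have "\<pi> ^ q * (H * Z * G) $$ (i, i) = (\<Sum>k<m. c k * (\<pi> ^ q * (H * C k * G) $$ (i, i)))"
            by (simp add: sum_distrib_left mult_ac)
          also have "\<dots> \<in> ?O"
          proof (rule val_ring_sum)
            fix k assume "k \<in> {..<m}"
            then show "c k * (\<pi> ^ q * (H * C k * G) $$ (i, i)) \<in> ?O"
              using c(1) q by (intro val_ring_mult[of "c k"]) auto
          qed
          finally show ?thesis .
        qed
        \<comment> \<open>The exponent exceeds q by one: since v x <= -1, the product of \<pi>^q and
          x^(q+1) has negative value.\<close>
        have "H * Y (Suc q) * G = x ^ Suc q \<cdot>\<^sub>m e i i" unfolding Y_def by (rule conj') (simp add: e)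
        then have "(H * Y (Suc q) * G) $$ (i, i) = x ^ Suc q" using ij by (simp add: e_def)
        with bound[OF Y[of "Suc q"]] have "\<pi> ^ q * x ^ Suc q \<in> ?O" by simp
        then have "0 \<le> v (\<pi> ^ q * x ^ Suc q)" using \<pi> x by (simp add: val_ring_def)
        also have "v (\<pi> ^ q * x ^ Suc q) = int q + int (Suc q) * v x"
          using \<pi> x v_mult[of "\<pi> ^ q" "x ^ Suc q"] v_power[of \<pi> q] v_power[of x "Suc q"] by simp
        also have "\<dots> \<le> int q + int (Suc q) * (-1)" using x(2) by (intro add_left_mono mult_left_mono) auto
        finally show False by simp
      qed
    qed
  qed
  ultimately show ?thesis unfolding maximal_order_def by blast
qed

end

section \<open>Lattices\<close>

context valued_field
begin

definition O_module :: "nat \<Rightarrow> 'f vec set \<Rightarrow> bool" where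
  "O_module n X \<longleftrightarrow> X \<subseteq> carrier_vec n \<and> 0\<^sub>v n \<in> X \<and> (\<forall>x\<in>X. \<forall>y\<in>X. x + y \<in> X) \<and>
    (\<forall>c\<in>val_ring v. \<forall>x\<in>X. c \<cdot>\<^sub>v x \<in> X)"

lemma O_module_comb:
  fixes c :: "nat \<Rightarrow> 'f"
  assumes X: "O_module n X" and "\<And>i. i < m \<Longrightarrow> c i \<in> val_ring v" "\<And>i. i < m \<Longrightarrow> b i \<in> X"
  shows "vec n (\<lambda>r. \<Sum>i<m. c i * b i $ r) \<in> X"
  using assms(2,3)
proof (induction m)
  case 0
  have "vec n (\<lambda>r. 0 :: 'f) = 0\<^sub>v n" by auto
  moreover have "0\<^sub>v n \<in> X" using X by (simp add: O_module_def)
  ultimately show ?case by simp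
next
  case (Suc m)
  have b: "b m \<in> carrier_vec n" using X Suc.prems by (auto simp: O_module_def)
  have "vec n (\<lambda>r. \<Sum>i<Suc m. c i * b i $ r) = vec n (\<lambda>r. \<Sum>i<m. c i * b i $ r) + c m \<cdot>\<^sub>v b m"
    using b by (intro eq_vecI) auto
  also have "\<dots> \<in> X" using X Suc unfolding O_module_def by simp
  finally show ?case .
qed

lemma O_module_minus: "O_module n X \<Longrightarrow> x \<in> X \<Longrightarrow> y \<in> X \<Longrightarrow> x - y \<in> X"
proof -
  assume X: "O_module n X" "x \<in> X" "y \<in> X"
  then have c: "x \<in> carrier_vec n" "y \<in> carrier_vec n" by (auto simp: O_module_def)
  have "x - y = x + (- 1) \<cdot>\<^sub>v y" using c by (intro eq_vecI) auto
  also have "\<dots> \<in> X"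
    using X val_ring_minus[OF val_ring_1] unfolding O_module_def by blast
  finally show ?thesis .
qed

lemma O_module_vec_span:
  "(\<And>i. i < m \<Longrightarrow> b i \<in> carrier_vec n) \<Longrightarrow> O_module n (vec_span (val_ring v) n m b)"
  unfolding O_module_def
proof (intro conjI ballI)
  show "vec_span (val_ring v) n m b \<subseteq> carrier_vec n" by (auto simp: vec_span_def)
  show "0\<^sub>v n \<in> vec_span (val_ring v) n m b"
    unfolding vec_span_def using val_ring_0 by (intro CollectI exI[of _ "\<lambda>_. 0"]) auto
  fix y assume "y \<in> vec_span (val_ring v) n m b"
  then obtain d where d: "y = vec n (\<lambda>r. \<Sum>i<m. d i * b i $ r)" "\<forall>i<m. d i \<in> val_ring v"
    by (auto simp: vec_span_def)
  show "x + y \<in> vec_span (val_ring v) n m b" if x: "x \<in> vec_span (val_ring v) n m b" for x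
  proof -
    obtain c where c: "x = vec n (\<lambda>r. \<Sum>i<m. c i * b i $ r)" "\<forall>i<m. c i \<in> val_ring v"
      using x by (auto simp: vec_span_def)
    have "x + y = vec n (\<lambda>r. \<Sum>i<m. (c i + d i) * b i $ r)"
      unfolding c(1) d(1) by (intro eq_vecI) (auto simp: sum.distrib distrib_right)
    then show ?thesis unfolding vec_span_def using c(2) d(2) val_ring_add
      by (intro CollectI exI[of _ "\<lambda>i. c i + d i"]) auto
  qed
  show "c \<cdot>\<^sub>v y \<in> vec_span (val_ring v) n m b" if c: "c \<in> val_ring v" for c
  proof -
    have "c \<cdot>\<^sub>v y = vec n (\<lambda>r. \<Sum>i<m. (c * d i) * b i $ r)"
      unfolding d(1) by (intro eq_vecI) (auto simp: sum_distrib_left mult.assoc)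
    then show ?thesis unfolding vec_span_def using c d(2) val_ring_mult
      by (intro CollectI exI[of _ "\<lambda>i. c * d i"]) auto
  qed
qed

lemma full_lattice_O_module: "full_lattice v n X \<Longrightarrow> O_module n X"
  unfolding full_lattice_def using O_module_vec_span by blast

text \<open>The generators span the whole space, and a power of \<pi> makes the finitely many
  coefficients of y integral.\<close>

lemma full_lattice_absorbs:
  assumes \<pi>: "\<pi> \<noteq> 0" "v \<pi> = 1" and X: "full_lattice v n X" and y: "y \<in> carrier_vec n"
  shows "\<exists>m::nat. \<pi> ^ m \<cdot>\<^sub>v y \<in> X"
proof -
  obtain m b where b: "\<forall>i<m. b i \<in> carrier_vec n" "X = vec_span (val_ring v) n m b"
    "vec_span UNIV n m b = carrier_vec n" using X by (auto simp: full_lattice_def)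
  obtain c where c: "y = vec n (\<lambda>r. \<Sum>i<m. c i * b i $ r)"
    using y unfolding b(3)[symmetric] by (auto simp: vec_span_def)
  obtain q where q: "\<forall>i\<in>{..<m}. \<pi> ^ q * c i \<in> val_ring v"
    using common_denominator[OF \<pi> finite_lessThan, of m c] by blast
  have "\<pi> ^ q \<cdot>\<^sub>v y = vec n (\<lambda>r. \<Sum>i<m. (\<pi> ^ q * c i) * b i $ r)"
    unfolding c by (intro eq_vecI) (auto simp: sum_distrib_left mult.assoc)
  then have "\<pi> ^ q \<cdot>\<^sub>v y \<in> X" unfolding b(2) vec_span_def using q
    by (intro CollectI exI[of _ "\<lambda>i. \<pi> ^ q * c i"]) auto
  then show ?thesis by blast
qed

text \<open>A linear functional is bounded on a lattice by its values on the finitely many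
  generators. This will bound a stable lattice from above.\<close>

lemma full_lattice_bounded:
  fixes k :: nat
  assumes \<pi>: "\<pi> \<noteq> 0" "v \<pi> = 1" and X: "full_lattice v n X"
  shows "\<exists>q::nat. \<forall>y\<in>X. \<forall>i<k. \<pi> ^ q * (\<Sum>j<n. h i j * y $ j) \<in> val_ring v"
proof -
  obtain m b where b: "\<forall>i<m. b i \<in> carrier_vec n" "X = vec_span (val_ring v) n m b"
    using X by (auto simp: full_lattice_def)
  define g where "g t i = (\<Sum>j<n. h i j * b t $ j)" for t i
  have "finite ({..<m} \<times> {..<k})" by simp
  from common_denominator[OF \<pi> this, of "\<lambda>(t, i). g t i"] obtain q where
    q: "\<forall>(t, i)\<in>{..<m} \<times> {..<k}. \<pi> ^ q * g t i \<in> val_ring v" by auto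
  have "\<pi> ^ q * (\<Sum>j<n. h i j * y $ j) \<in> val_ring v" if y: "y \<in> X" and i: "i < k" for y i
  proof -
    obtain c where c: "y = vec n (\<lambda>r. \<Sum>t<m. c t * b t $ r)" "\<forall>t<m. c t \<in> val_ring v"
      using y unfolding b(2) by (auto simp: vec_span_def)
    have "(\<Sum>j<n. h i j * y $ j) = (\<Sum>j<n. \<Sum>t<m. c t * (h i j * b t $ j))"
      unfolding c by (intro sum.cong) (auto simp: sum_distrib_left mult_ac)
    also have "\<dots> = (\<Sum>t<m. \<Sum>j<n. c t * (h i j * b t $ j))" by (rule sum.swap)
    also have "\<dots> = (\<Sum>t<m. c t * g t i)" by (simp add: g_def sum_distrib_left)
    finally have "\<pi> ^ q * (\<Sum>j<n. h i j * y $ j) = (\<Sum>t<m. c t * (\<pi> ^ q * g t i))"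
      by (simp add: sum_distrib_left mult_ac)
    also have "\<dots> \<in> val_ring v"
    proof (rule val_ring_sum)
      fix t assume "t \<in> {..<m}"
      then show "c t * (\<pi> ^ q * g t i) \<in> val_ring v"
        using c(2) q i by (intro val_ring_mult[of "c t"]) auto
    qed
    finally show ?thesis .
  qed
  then show ?thesis by blast
qed

end

context galois_order
begin

definition K_basis :: "nat \<Rightarrow> (nat \<Rightarrow> complex) \<Rightarrow> bool" where
  "K_basis n X \<longleftrightarrow> (\<forall>i<n. X i \<in> L) \<and>
    (\<forall>x\<in>L. \<exists>c. (\<forall>i<n. c i \<in> K) \<and> x = (\<Sum>i<n. c i * X i)) \<and>
    (\<forall>c. (\<forall>i<n. c i \<in> K) \<longrightarrow> (\<Sum>i<n. c i * X i) = 0 \<longrightarrow> (\<forall>i<n. c i = 0))"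

definition coord :: "nat \<Rightarrow> (nat \<Rightarrow> complex) \<Rightarrow> complex \<Rightarrow> nat \<Rightarrow> complex" where
  "coord n X x = (SOME c. (\<forall>i<n. c i \<in> K) \<and> x = (\<Sum>i<n. c i * X i))"

lemma K_basis_L: "K_basis n X \<Longrightarrow> i < n \<Longrightarrow> X i \<in> L"
  by (simp add: K_basis_def)

lemma K_basis_indep:
  "K_basis n X \<Longrightarrow> (\<And>i. i < n \<Longrightarrow> c i \<in> K) \<Longrightarrow> (\<Sum>i<n. c i * X i) = 0 \<Longrightarrow> i < n \<Longrightarrow> c i = 0"
  unfolding K_basis_def by blast

lemma coord:
  assumes "K_basis n X" "x \<in> L"
  shows "i < n \<Longrightarrow> coord n X x i \<in> K" and "x = (\<Sum>i<n. coord n X x i * X i)"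
proof -
  have "\<exists>c. (\<forall>i<n. c i \<in> K) \<and> x = (\<Sum>i<n. c i * X i)" using assms by (auto simp: K_basis_def)
  from someI_ex[OF this] show "i < n \<Longrightarrow> coord n X x i \<in> K" "x = (\<Sum>i<n. coord n X x i * X i)"
    unfolding coord_def by blast+
qed

lemma coord_unique:
  assumes X: "K_basis n X" and c: "\<And>i. i < n \<Longrightarrow> c i \<in> K" and x: "x = (\<Sum>i<n. c i * X i)" and i: "i < n"
  shows "coord n X x i = c i"
proof -
  have xL: "x \<in> L" unfolding x using c X K_L by (auto intro!: L.sum_in L.mult_in simp: K_basis_def)
  have "(\<Sum>i<n. (coord n X x i - c i) * X i) = 0"
    using coord(2)[OF X xL] x by (simp add: left_diff_distrib sum_subtractf)
  then have "coord n X x i - c i = 0"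
    using coord(1)[OF X xL] c i by (intro K_basis_indep[OF X, of "\<lambda>i. coord n X x i - c i"]) (auto intro: K.diff_in)
  then show ?thesis by simp
qed

lemma coord_add: "K_basis n X \<Longrightarrow> x \<in> L \<Longrightarrow> y \<in> L \<Longrightarrow> i < n \<Longrightarrow>
    coord n X (x + y) i = coord n X x i + coord n X y i"
proof (rule coord_unique)
  assume *: "K_basis n X" "x \<in> L" "y \<in> L"
  show "x + y = (\<Sum>i<n. (coord n X x i + coord n X y i) * X i)"
    using coord(2)[OF *(1,2)] coord(2)[OF *(1,3)] by (simp add: distrib_right sum.distrib)
qed (auto intro: K.add_in coord)

lemma coord_smult: "K_basis n X \<Longrightarrow> x \<in> L \<Longrightarrow> c \<in> K \<Longrightarrow> i < n \<Longrightarrow> coord n X (c * x) i = c * coord n X x i"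
proof (rule coord_unique)
  assume *: "K_basis n X" "x \<in> L"
  have "(\<Sum>i<n. (c * coord n X x i) * X i) = c * (\<Sum>i<n. coord n X x i * X i)"
    by (simp add: sum_distrib_left mult.assoc)
  also have "\<dots> = c * x" by (simp only: coord(2)[OF *, symmetric])
  finally show "c * x = (\<Sum>i<n. (c * coord n X x i) * X i)" by simp
qed (auto intro: K.mult_in coord)

lemma coord_sum:
  assumes X: "K_basis n X" and f: "\<And>j. j \<in> I \<Longrightarrow> f j \<in> L" and i: "i < n"
  shows "coord n X (sum f I) i = (\<Sum>j\<in>I. coord n X (f j) i)"
proof -
  have z: "coord n X 0 i = 0"
    using coord_smult[OF X L.zero_in K.zero_in i] by simp
  show ?thesis using f
    by (induction I rule: infinite_finite_induct) (auto simp: z i coord_add[OF X] L.sum_in)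
qed

lemma coord_basis: "K_basis n X \<Longrightarrow> i < n \<Longrightarrow> j < n \<Longrightarrow> coord n X (X j) i = (if i = j then 1 else 0)"
proof (rule coord_unique)
  assume j: "j < n"
  have "(\<Sum>i<n. (if i = j then 1 else 0) * X i) = (\<Sum>i<n. if i = j then X i else 0)"
    by (rule sum.cong) auto
  then show "X j = (\<Sum>i<n. (if i = j then 1 else 0) * X i)" using j by simp
qed (auto intro: K.one_in K.zero_in)

end

section \<open>Stable lattices\<close>

text \<open>In the K-basis E of L, the matrices A and B describe multiplication by z and the map s,
  so coordinates identify L with K^n. Because 1, ..., z^(n-1) generate R over \<open>O_K\<close>,
  every \<open>J c\<close> has the explicit basis l^c z^i.\<close>

locale stable_lattices = frobenius_completion +
  fixes n :: nat and z :: complex and E :: "nat \<Rightarrow> complex" and A B :: "complex mat"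
  assumes z_R: "z \<in> R"
    and R_gen: "x \<in> R \<Longrightarrow> \<exists>c. (\<forall>i<n. c i \<in> O_K) \<and> x = (\<Sum>i<n. c i * z ^ i)"
    and z_basis: "K_basis n (\<lambda>i. z ^ i)"
    and E_basis: "K_basis n E"
    and A: "A \<in> carrier_mat n n" and A_K: "i < n \<Longrightarrow> j < n \<Longrightarrow> A $$ (i, j) \<in> K"
    and B: "B \<in> carrier_mat n n" and B_K: "i < n \<Longrightarrow> j < n \<Longrightarrow> B $$ (i, j) \<in> K"
    and A_E: "j < n \<Longrightarrow> z * E j = (\<Sum>i<n. A $$ (i, j) * E i)"
    and B_E: "j < n \<Longrightarrow> s (E j) = (\<Sum>i<n. B $$ (i, j) * E i)"
begin

definition \<Psi> where "\<Psi> x = vec n (\<lambda>j. \<iota> (coord n E x j))"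

definition b where "b c i = l powi c * z ^ i"

text \<open>The i-th coordinate with respect to \<open>b c\<close>, extended linearly from K^n to
  the completion through its values on E.\<close>

definition h where "h c y i = (\<Sum>j<n. \<iota> (coord n (b c) (E j) i) * y $ j)"

text \<open>The lattice spanned by the image of \<open>J c\<close>, described by integrality of
  coordinates.\<close>

definition Lam where "Lam c = {y\<in>carrier_vec n. \<forall>i<n. h c y i \<in> val_ring v}"

lemma z_L: "z ^ i \<in> L" using z_R R_in_L L.power_in by blast

lemma E_L: "j < n \<Longrightarrow> E j \<in> L" using E_basis K_basis_L by blast

lemma b_basis: "K_basis n (b c)"
  unfolding K_basis_def
proof (intro conjI allI impI ballI)
  show "b c i \<in> L" for i unfolding b_def by (intro L.mult_in l_powi_L z_L)
  have eq: "(\<Sum>i<n. f i * b c i) = l powi c * (\<Sum>i<n. f i * z ^ i)" for f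
    by (simp add: b_def sum_distrib_left mult_ac)
  show "\<exists>f. (\<forall>i<n. f i \<in> K) \<and> x = (\<Sum>i<n. f i * b c i)" if x: "x \<in> L" for x
  proof -
    have y: "l powi (- c) * x \<in> L" by (intro L.mult_in l_powi_L x)
    have "(\<Sum>i<n. coord n (\<lambda>i. z ^ i) (l powi (- c) * x) i * b c i) = l powi c * (l powi (- c) * x)"
      unfolding eq using coord(2)[OF z_basis y] by simp
    also have "\<dots> = x" using l_nz by (simp add: power_int_minus)
    finally show ?thesis using coord(1)[OF z_basis y] by metis
  qed
  show "f i = 0" if f: "\<forall>i<n. f i \<in> K" "(\<Sum>i<n. f i * b c i) = 0" and i: "i < n" for f i
    using f(2) l_nz f(1) i unfolding eq by (intro K_basis_indep[OF z_basis, of f]) auto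
qed

lemma b_J: "i < n \<Longrightarrow> b c i \<in> J c"
  unfolding b_def J_iff using z_R by (blast intro: R_R_P R.power_in)

lemma b_L: "i < n \<Longrightarrow> b c i \<in> L"
  using b_basis K_basis_L by blast

lemma Psi_carrier: "\<Psi> x \<in> carrier_vec n" by (simp add: \<Psi>_def)

lemma Psi_add: "x \<in> L \<Longrightarrow> y \<in> L \<Longrightarrow> \<Psi> (x + y) = \<Psi> x + \<Psi> y"
  by (intro eq_vecI) (auto simp: \<Psi>_def coord_add[OF E_basis] iota_add coord(1)[OF E_basis])

lemma Psi_smult: "x \<in> L \<Longrightarrow> c \<in> K \<Longrightarrow> \<Psi> (c * x) = \<iota> c \<cdot>\<^sub>v \<Psi> x"
  by (intro eq_vecI) (auto simp: \<Psi>_def coord_smult[OF E_basis] iota_mult coord(1)[OF E_basis])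

lemma Psi_z: assumes x: "x \<in> L" shows "map_mat \<iota> A *\<^sub>v \<Psi> x = \<Psi> (z * x)"
proof (rule eq_vecI)
  fix i assume "i < dim_vec (\<Psi> (z * x))"
  then have i: "i < n" by (simp add: \<Psi>_def)
  have "z * x = z * (\<Sum>j<n. coord n E x j * E j)"
    by (rule arg_cong[OF coord(2)[OF E_basis x]])
  also have "\<dots> = (\<Sum>j<n. coord n E x j * (z * E j))"
    by (simp add: sum_distrib_left mult_ac)
  also have "\<dots> = (\<Sum>j<n. \<Sum>i<n. coord n E x j * A $$ (i, j) * E i)"
    by (intro sum.cong) (auto simp: A_E sum_distrib_left mult_ac)
  also have "\<dots> = (\<Sum>i<n. (\<Sum>j<n. coord n E x j * A $$ (i, j)) * E i)"
    by (subst sum.swap) (simp add: sum_distrib_right)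
  finally have "coord n E (z * x) i = (\<Sum>j<n. coord n E x j * A $$ (i, j))"
    using coord(1)[OF E_basis x] A_K i by (intro coord_unique[OF E_basis]) (auto intro!: K.sum_in K.mult_in)
  then have "\<iota> (coord n E (z * x) i) = (\<Sum>j<n. \<iota> (coord n E x j * A $$ (i, j)))"
    using coord(1)[OF E_basis x] A_K i by (simp only:) (intro iota_sum K.mult_in, auto)
  also have "\<dots> = (\<Sum>j<n. \<iota> (A $$ (i, j)) * \<iota> (coord n E x j))"
    using coord(1)[OF E_basis x] A_K i by (intro sum.cong) (auto simp: iota_mult)
  finally show "(map_mat \<iota> A *\<^sub>v \<Psi> x) $ i = \<Psi> (z * x) $ i"
    using i A by (simp add: \<Psi>_def scalar_prod_def atLeast0LessThan)
qed (use A in \<open>simp add: \<Psi>_def\<close>)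

lemma Psi_s: assumes x: "x \<in> L" shows "map_mat \<iota> B *\<^sub>v \<Psi> x = \<Psi> (s x)"
proof (rule eq_vecI)
  fix i assume "i < dim_vec (\<Psi> (s x))"
  then have i: "i < n" by (simp add: \<Psi>_def)
  have "s x = s (\<Sum>j<n. coord n E x j * E j)"
    using coord(2)[OF E_basis x] by simp
  also have "\<dots> = (\<Sum>j<n. s (coord n E x j * E j))"
    using coord(1)[OF E_basis x] E_L K_L by (intro s_sum L.mult_in) auto
  also have "\<dots> = (\<Sum>j<n. coord n E x j * s (E j))"
  proof (rule sum.cong)
    fix j assume "j \<in> {..<n}"
    then have j: "j < n" by simp
    have c: "coord n E x j \<in> K" by (rule coord(1)[OF E_basis x j])
    have "s (coord n E x j) = coord n E x j" using c by (simp add: K_def)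
    then show "s (coord n E x j * E j) = coord n E x j * s (E j)"
      using s_mult[OF K_L[OF c] E_L[OF j]] by simp
  qed simp
  also have "\<dots> = (\<Sum>j<n. \<Sum>i<n. coord n E x j * B $$ (i, j) * E i)"
    by (intro sum.cong) (auto simp: B_E sum_distrib_left mult_ac)
  also have "\<dots> = (\<Sum>i<n. (\<Sum>j<n. coord n E x j * B $$ (i, j)) * E i)"
    by (subst sum.swap) (simp add: sum_distrib_right)
  finally have "coord n E (s x) i = (\<Sum>j<n. coord n E x j * B $$ (i, j))"
    using coord(1)[OF E_basis x] B_K i by (intro coord_unique[OF E_basis]) (auto intro!: K.sum_in K.mult_in)
  then have "\<iota> (coord n E (s x) i) = (\<Sum>j<n. \<iota> (coord n E x j * B $$ (i, j)))"
    using coord(1)[OF E_basis x] B_K i by (simp only:) (intro iota_sum K.mult_in, auto)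
  also have "\<dots> = (\<Sum>j<n. \<iota> (B $$ (i, j)) * \<iota> (coord n E x j))"
    using coord(1)[OF E_basis x] B_K i by (intro sum.cong) (auto simp: iota_mult)
  finally show "(map_mat \<iota> B *\<^sub>v \<Psi> x) $ i = \<Psi> (s x) $ i"
    using i B by (simp add: \<Psi>_def scalar_prod_def atLeast0LessThan)
qed (use B in \<open>simp add: \<Psi>_def\<close>)

lemma h_add: "x \<in> carrier_vec n \<Longrightarrow> y \<in> carrier_vec n \<Longrightarrow> h c (x + y) i = h c x i + h c y i"
  by (simp add: h_def distrib_left sum.distrib)

lemma h_smult: "y \<in> carrier_vec n \<Longrightarrow> h c (a \<cdot>\<^sub>v y) i = a * h c y i"
  by (simp add: h_def sum_distrib_left mult.left_commute)

lemma h_Psi: "x \<in> L \<Longrightarrow> i < n \<Longrightarrow> h c (\<Psi> x) i = \<iota> (coord n (b c) x i)"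
proof -
  assume x: "x \<in> L" and i: "i < n"
  have "coord n (b c) x i = coord n (b c) (\<Sum>j<n. coord n E x j * E j) i"
    using coord(2)[OF E_basis x] by simp
  also have "\<dots> = (\<Sum>j<n. coord n (b c) (coord n E x j * E j) i)"
    using coord(1)[OF E_basis x] E_L K_L i by (intro coord_sum[OF b_basis] L.mult_in) auto
  also have "\<dots> = (\<Sum>j<n. coord n E x j * coord n (b c) (E j) i)"
    using coord(1)[OF E_basis x] E_L i by (intro sum.cong) (auto simp: coord_smult[OF b_basis])
  finally have "\<iota> (coord n (b c) x i) = \<iota> (\<Sum>j<n. coord n E x j * coord n (b c) (E j) i)"
    by simp
  also have "\<dots> = (\<Sum>j<n. \<iota> (coord n E x j * coord n (b c) (E j) i))"
    using coord(1)[OF E_basis x] coord(1)[OF b_basis E_L] i by (intro iota_sum K.mult_in) auto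
  also have "\<dots> = (\<Sum>j<n. \<iota> (coord n (b c) (E j) i) * \<iota> (coord n E x j))"
    using coord(1)[OF E_basis x] coord(1)[OF b_basis E_L] i
    by (intro sum.cong) (auto simp: iota_mult)
  finally show ?thesis by (simp add: h_def \<Psi>_def)
qed

text \<open>The base changes between E and \<open>b c\<close> are inverse to each other over K, and
  \<iota> carries this identity over to the completion.\<close>

lemma h_expand: "y \<in> carrier_vec n \<Longrightarrow> y = vec n (\<lambda>r. \<Sum>i<n. h c y i * \<Psi> (b c i) $ r)"
proof (rule eq_vecI)
  fix r assume "r < dim_vec (vec n (\<lambda>r. \<Sum>i<n. h c y i * \<Psi> (b c i) $ r))"
  then have r: "r < n" by simp
  have 1: "(\<Sum>i<n. \<iota> (coord n (b c) (E m) i) * \<iota> (coord n E (b c i) r)) = (if m = r then 1 else 0)"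
    if m: "m < n" for m
  proof -
    have cK: "coord n (b c) (E m) i \<in> K" "coord n E (b c i) r \<in> K" if "i < n" for i
      using that m r coord(1)[OF b_basis E_L] coord(1)[OF E_basis b_L] by auto
    have "(if r = m then 1 else 0) = coord n E (E m) r"
      using r m by (simp add: coord_basis[OF E_basis])
    also have "\<dots> = coord n E (\<Sum>i<n. coord n (b c) (E m) i * b c i) r"
      using coord(2)[OF b_basis E_L[OF m]] by simp
    also have "\<dots> = (\<Sum>i<n. coord n E (coord n (b c) (E m) i * b c i) r)"
      using cK b_L K_L r by (intro coord_sum[OF E_basis] L.mult_in) auto
    also have "\<dots> = (\<Sum>i<n. coord n (b c) (E m) i * coord n E (b c i) r)"
      using cK b_L r by (intro sum.cong) (auto simp: coord_smult[OF E_basis])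
    finally have "\<iota> (if r = m then 1 else 0) = \<iota> (\<Sum>i<n. coord n (b c) (E m) i * coord n E (b c i) r)"
      by simp
    also have "\<dots> = (\<Sum>i<n. \<iota> (coord n (b c) (E m) i * coord n E (b c i) r))"
      using cK by (intro iota_sum K.mult_in) auto
    also have "\<dots> = (\<Sum>i<n. \<iota> (coord n (b c) (E m) i) * \<iota> (coord n E (b c i) r))"
      using cK by (intro sum.cong) (auto simp: iota_mult)
    finally show ?thesis by (auto simp: iota_one iota_zero split: if_splits)
  qed
  have "(\<Sum>i<n. h c y i * \<Psi> (b c i) $ r)
      = (\<Sum>i<n. \<Sum>m<n. y $ m * (\<iota> (coord n (b c) (E m) i) * \<iota> (coord n E (b c i) r)))"
    using r by (simp add: h_def \<Psi>_def sum_distrib_right sum_distrib_left mult_ac)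
  also have "\<dots> = (\<Sum>m<n. y $ m * (\<Sum>i<n. \<iota> (coord n (b c) (E m) i) * \<iota> (coord n E (b c i) r)))"
    by (subst sum.swap) (simp add: sum_distrib_left)
  also have "\<dots> = (\<Sum>m<n. if m = r then y $ m else 0)"
    using 1 by (intro sum.cong) auto
  also have "\<dots> = y $ r" using r by simp
  finally show "y $ r = vec n (\<lambda>r. \<Sum>i<n. h c y i * \<Psi> (b c i) $ r) $ r" using r by simp
qed simp

lemma h_comb:
  "i < n \<Longrightarrow> h c (vec n (\<lambda>r. \<Sum>j<n. f j * \<Psi> (b c j) $ r)) i = f i"
proof -
  assume i: "i < n"
  have "h c (vec n (\<lambda>r. \<Sum>j<n. f j * \<Psi> (b c j) $ r)) i = (\<Sum>m<n. \<Sum>j<n. f j * (\<iota> (coord n (b c) (E m) i) * \<Psi> (b c j) $ m))"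
    by (simp add: h_def sum_distrib_left mult_ac)
  also have "\<dots> = (\<Sum>j<n. f j * h c (\<Psi> (b c j)) i)"
    by (subst sum.swap) (simp add: h_def sum_distrib_left)
  also have "\<dots> = (\<Sum>j<n. if j = i then f j else 0)"
    using i by (intro sum.cong) (auto simp: h_Psi b_L coord_basis[OF b_basis] iota_one iota_zero)
  also have "\<dots> = f i" using i by simp
  finally show ?thesis .
qed

lemma Lam_O_module: "O_module n (Lam c)"
  unfolding O_module_def
proof (intro conjI ballI)
  have "h c (0\<^sub>v n) i = 0" for i by (simp add: h_def)
  then show "0\<^sub>v n \<in> Lam c" by (simp add: Lam_def val_ring_0)
qed (auto simp: Lam_def h_add h_smult intro: val_ring_add val_ring_mult)

text \<open>A module condition on \<open>Lam c\<close> need only be tested on n generators.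
  Stability under A and B, monotonicity and the effect of scaling are all obtained in this
  way.\<close>

lemma Lam_minimal:
  assumes X: "O_module n X" and b: "\<And>i. i < n \<Longrightarrow> \<Psi> (b c i) \<in> X"
  shows "Lam c \<subseteq> X"
proof
  fix y assume y: "y \<in> Lam c"
  then have "vec n (\<lambda>r. \<Sum>i<n. h c y i * \<Psi> (b c i) $ r) \<in> X"
    by (intro O_module_comb[OF X] b) (auto simp: Lam_def)
  then show "y \<in> X" using h_expand[of y c] y by (simp add: Lam_def)
qed

text \<open>The coordinates of x with respect to \<open>b c\<close> lie in K, where integrality in
  the completion means membership in \<open>R_P\<close>; and the elements of \<open>J c\<close> are
  the combinations of the l^c z^i with such coefficients.\<close>

lemma Psi_Lam: "x \<in> L \<Longrightarrow> \<Psi> x \<in> Lam c \<longleftrightarrow> x \<in> J c"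
proof
  assume x: "x \<in> L"
  have cK: "coord n (b c) x i \<in> K" if "i < n" for i using coord(1)[OF b_basis x that] .
  have eq: "\<Psi> x \<in> Lam c \<longleftrightarrow> (\<forall>i<n. coord n (b c) x i \<in> R_P)"
    using cK by (simp add: Lam_def Psi_carrier h_Psi x R_P_val_ring)
  { assume "\<Psi> x \<in> Lam c"
    then have "(\<Sum>i<n. coord n (b c) x i * z ^ i) \<in> R_P"
      unfolding eq using z_R by (intro R_P.sum_in R_P.mult_in R_R_P[OF R.power_in]) auto
    moreover have "x = l powi c * (\<Sum>i<n. coord n (b c) x i * z ^ i)"
      using coord(2)[OF b_basis x, of c] by (simp add: b_def sum_distrib_left mult_ac)
    ultimately show "x \<in> J c" unfolding J_iff by blast }
  assume "x \<in> J c"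
  then obtain r where r: "r \<in> R_P" "x = l powi c * r" by (auto simp: J_iff)
  obtain t where t: "t \<in> T" "t * r \<in> R" using r by (auto simp: R_P_def)
  obtain f where f: "\<forall>i<n. f i \<in> O_K" "t * r = (\<Sum>i<n. f i * z ^ i)" using R_gen t(2) by blast
  have "r = inverse t * (t * r)" using T_nz[OF t(1)] by simp
  also have "\<dots> = (\<Sum>i<n. (inverse t * f i) * z ^ i)"
    unfolding f(2) by (simp add: sum_distrib_left mult.assoc)
  finally have "x = (\<Sum>i<n. (inverse t * f i) * b c i)"
    unfolding r(2) by (simp add: b_def sum_distrib_left mult_ac)
  then have "coord n (b c) x i = inverse t * f i" if "i < n" for i
    using that f(1) t(1) by (intro coord_unique[OF b_basis]) (auto intro: K.mult_in K_inverse O_K_K T_O_K)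
  moreover have "inverse t * f i \<in> R_P" if "i < n" for i
    using f(1) that by (intro R_P.mult_in[OF inverse_T[OF t(1)]] R_R_P O_K_R) auto
  ultimately show "\<Psi> x \<in> Lam c" unfolding eq by simp
qed

lemma Lam_full_lattice: "full_lattice v n (Lam c)"
  unfolding full_lattice_def
proof (intro exI conjI allI impI)
  show "\<Psi> (b c i) \<in> carrier_vec n" for i by (rule Psi_carrier)
  show "Lam c = vec_span (val_ring v) n n (\<lambda>i. \<Psi> (b c i))"
  proof
    show "Lam c \<subseteq> vec_span (val_ring v) n n (\<lambda>i. \<Psi> (b c i))"
      using h_expand unfolding vec_span_def Lam_def by blast
    show "vec_span (val_ring v) n n (\<lambda>i. \<Psi> (b c i)) \<subseteq> Lam c"
      by (auto simp: vec_span_def Lam_def h_comb)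
  qed
  show "vec_span UNIV n n (\<lambda>i. \<Psi> (b c i)) = carrier_vec n"
    using h_expand unfolding vec_span_def by (auto; blast)
qed

lemma O_module_vimage_mat:
  assumes X: "O_module n X" and C: "C \<in> carrier_mat n n"
  shows "O_module n {y\<in>carrier_vec n. C *\<^sub>v y \<in> X}"
proof -
  have "C *\<^sub>v 0\<^sub>v n = 0\<^sub>v n" using C by auto
  then show ?thesis using X C
    unfolding O_module_def by (auto simp: mult_add_distrib_mat_vec[of _ n n] mult_mat_vec[of _ n n])
qed

lemma Lam_A: "y \<in> Lam c \<Longrightarrow> map_mat \<iota> A *\<^sub>v y \<in> Lam c"
proof -
  have "Lam c \<subseteq> {y\<in>carrier_vec n. map_mat \<iota> A *\<^sub>v y \<in> Lam c}"
  proof (rule Lam_minimal)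
    show "O_module n {y\<in>carrier_vec n. map_mat \<iota> A *\<^sub>v y \<in> Lam c}"
      using A by (intro O_module_vimage_mat Lam_O_module) simp
    show "\<Psi> (b c i) \<in> {y\<in>carrier_vec n. map_mat \<iota> A *\<^sub>v y \<in> Lam c}" if "i < n" for i
      using J_smult[OF R_R_P[OF z_R] b_J[OF that]] b_L[OF that] z_R
      by (auto simp: Psi_carrier Psi_z Psi_Lam L.mult_in R_in_L)
  qed
  then show "y \<in> Lam c \<Longrightarrow> map_mat \<iota> A *\<^sub>v y \<in> Lam c" by blast
qed

lemma Lam_B: "y \<in> Lam c \<Longrightarrow> map_mat \<iota> B *\<^sub>v y \<in> Lam c"
proof -
  have "Lam c \<subseteq> {y\<in>carrier_vec n. map_mat \<iota> B *\<^sub>v y \<in> Lam c}"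
  proof (rule Lam_minimal)
    show "O_module n {y\<in>carrier_vec n. map_mat \<iota> B *\<^sub>v y \<in> Lam c}"
      using B by (intro O_module_vimage_mat Lam_O_module) simp
    show "\<Psi> (b c i) \<in> {y\<in>carrier_vec n. map_mat \<iota> B *\<^sub>v y \<in> Lam c}" if "i < n" for i
      using s_J[OF b_J[OF that]] b_L[OF that]
      by (auto simp: Psi_carrier Psi_s Psi_Lam s_L)
  qed
  then show "y \<in> Lam c \<Longrightarrow> map_mat \<iota> B *\<^sub>v y \<in> Lam c" by blast
qed

text \<open>The preimage M of X in L is an \<open>R_P\<close>-module stable under s, hence some
  \<open>J c\<close>. Nothing is lost by passing to L: by density every vector of X differs from
  some \<open>\<Psi> x\<close> by an element of \<open>Lam c\<close>, which is contained in
  X.\<close>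

lemma stable_lattice_eq_Lam:
  assumes X: "full_lattice v n X"
    and XA: "\<And>y. y \<in> X \<Longrightarrow> map_mat \<iota> A *\<^sub>v y \<in> X" and XB: "\<And>y. y \<in> X \<Longrightarrow> map_mat \<iota> B *\<^sub>v y \<in> X"
  shows "\<exists>c. X = Lam c"
proof -
  have Xm: "O_module n X" using full_lattice_O_module[OF X] .
  then have X': "X \<subseteq> carrier_vec n" "0\<^sub>v n \<in> X" "\<And>x y. x \<in> X \<Longrightarrow> y \<in> X \<Longrightarrow> x + y \<in> X"
    "\<And>c x. c \<in> val_ring v \<Longrightarrow> x \<in> X \<Longrightarrow> c \<cdot>\<^sub>v x \<in> X" by (auto simp: O_module_def)
  define M where "M = {x\<in>L. \<Psi> x \<in> X}"
  have M_add: "x + y \<in> M" if "x \<in> M" "y \<in> M" for x y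
    using that X'(3) by (auto simp: M_def Psi_add L.add_in)
  have M_K: "c * x \<in> M" if "c \<in> K" "c \<in> R_P" "x \<in> M" for c x
    using that X'(4)[of "\<iota> c" "\<Psi> x"] R_P_val_ring[of c] K_L by (auto simp: M_def Psi_smult L.mult_in)
  have M_0: "0 \<in> M"
  proof -
    have "\<Psi> (0 * 0) = 0 \<cdot>\<^sub>v \<Psi> 0" using Psi_smult[OF L.zero_in K.zero_in] by (simp only: iota_zero)
    also have "\<dots> = 0\<^sub>v n" by (intro eq_vecI) (auto simp: \<Psi>_def)
    finally show ?thesis using X'(2) by (simp add: M_def L.zero_in)
  qed
  have M_z: "z ^ i * x \<in> M" if "x \<in> M" for x i
    using that
  proof (induction i)
    case (Suc i)
    then have "z * (z ^ i * x) \<in> M"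
      using XA[of "\<Psi> (z ^ i * x)"] z_R R_in_L by (auto simp: M_def Psi_z L.mult_in)
    then show ?case by (simp add: mult.assoc)
  qed simp
  have M_mult: "r * x \<in> M" if r: "r \<in> R_P" and x: "x \<in> M" for r x
  proof -
    obtain t where t: "t \<in> T" "t * r \<in> R" using r by (auto simp: R_P_def)
    obtain f where f: "\<forall>i<n. f i \<in> O_K" "t * r = (\<Sum>i<n. f i * z ^ i)" using R_gen t(2) by blast
    have "r = inverse t * (t * r)" using T_nz[OF t(1)] by simp
    then have eq: "r * x = (\<Sum>i<n. (inverse t * f i) * (z ^ i * x))"
      unfolding f(2) by (simp add: sum_distrib_left sum_distrib_right mult_ac)
    have "(\<Sum>i\<in>I. (inverse t * f i) * (z ^ i * x)) \<in> M" if "I \<subseteq> {..<n}" for I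
      using finite_subset[OF that finite_lessThan] that
    proof induction
      case (insert i I)
      then have fi: "f i \<in> O_K" using f(1) by auto
      have "(inverse t * f i) * (z ^ i * x) \<in> M"
        using t fi by (intro M_K M_z[OF x] K.mult_in K_inverse R_P.mult_in inverse_T R_R_P)
          (auto intro: O_K_K T_O_K O_K_R)
      then show ?case using insert by (simp add: M_add)
    qed (simp add: M_0)
    then show ?thesis unfolding eq by blast
  qed
  have M_s: "s x \<in> M" if "x \<in> M" for x
    using that XB[of "\<Psi> x"] by (auto simp: M_def Psi_s s_L)
  obtain q where q: "q \<in> K" "q \<noteq> 0" "v (\<iota> q) = 1" using ex_unif_K by blast
  have \<pi>: "\<iota> q \<noteq> 0" "v (\<iota> q) = 1" using q iota_nz by auto
  have iq: "\<iota> (q ^ m) = \<iota> q ^ m" for m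
    using iota_powi[OF q(1), of "int m"] by simp
  \<comment> \<open>This produces a nonzero element of M, as \<open>stable_module_eq_J\<close>
    requires; the exponent m' below then confines M to some \<open>J c0\<close>.\<close>
  obtain m where m: "\<iota> q ^ m \<cdot>\<^sub>v \<Psi> 1 \<in> X"
    using full_lattice_absorbs[OF \<pi> X Psi_carrier] by blast
  have qm: "q ^ m \<in> K" "q ^ m \<noteq> 0" using q K.power_in by auto
  have "\<Psi> (q ^ m * 1) \<in> X" using m Psi_smult[OF L.one_in qm(1)] by (simp only: iq)
  then have 1: "q ^ m \<in> M" using K_L[OF qm(1)] by (simp add: M_def)
  obtain m' where m': "\<forall>y\<in>X. \<forall>i<n. \<iota> q ^ m' * h 0 y i \<in> val_ring v"
    using full_lattice_bounded[OF \<pi> X, of n "\<lambda>i j. \<iota> (coord n (b 0) (E j) i)"] unfolding h_def by blast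
  have qm': "q ^ m' \<in> K" "q ^ m' \<noteq> 0" using q K.power_in by auto
  obtain c0 where c0: "inverse (q ^ m') \<in> J c0"
    using J_bounds(1)[OF K_L[OF K_inverse[OF qm'(1)]]] by blast
  have "M \<subseteq> J c0"
  proof
    fix x assume x: "x \<in> M"
    then have xL: "x \<in> L" by (simp add: M_def)
    have "\<iota> q ^ m' \<cdot>\<^sub>v \<Psi> x \<in> Lam 0"
      using m' x by (auto simp: Lam_def Psi_carrier h_smult M_def)
    then have "\<Psi> (q ^ m' * x) \<in> Lam 0" using Psi_smult[OF xL qm'(1)] by (simp only: iq)
    then have "q ^ m' * x \<in> J 0" using Psi_Lam L.mult_in[OF K_L[OF qm'(1)] xL] by blast
    from J_mult[OF c0 this] have "inverse (q ^ m') * (q ^ m' * x) \<in> J c0" by simp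
    also have "inverse (q ^ m') * (q ^ m' * x) = x" using qm'(2) by (simp flip: mult.assoc)
    finally show "x \<in> J c0" .
  qed
  from stable_module_eq_J[OF M_add M_mult M_s this 1 qm(2)] obtain c where c: "M = J c" by blast
  have "Lam c \<subseteq> X"
  proof (rule Lam_minimal[OF Xm])
    fix i assume "i < n"
    then have "b c i \<in> M" unfolding c by (rule b_J)
    then show "\<Psi> (b c i) \<in> X" by (simp add: M_def)
  qed
  moreover have "X \<subseteq> Lam c"
  proof
    fix y assume y: "y \<in> X"
    then have yc: "y \<in> carrier_vec n" using X' by blast
    \<comment> \<open>Precision 0 suffices: the error then has integral coordinates and so lies in
      \<open>Lam c\<close>.\<close>
    have "\<exists>a\<in>K. h c y i - \<iota> a \<in> val_ring v" for i
      using dense[of 0 "h c y i"] by (auto simp: val_close_def val_ring_def)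
    then obtain a where a: "\<And>i. a i \<in> K" "\<And>i. h c y i - \<iota> (a i) \<in> val_ring v" by metis
    define x where "x = (\<Sum>i<n. a i * b c i)"
    have xL: "x \<in> L" unfolding x_def using a b_L K_L by (intro L.sum_in L.mult_in) auto
    have hx: "h c (\<Psi> x) i = \<iota> (a i)" if "i < n" for i
      using that a by (simp add: h_Psi xL coord_unique[OF b_basis _ x_def])
    define w where "w = y + (- 1) \<cdot>\<^sub>v \<Psi> x"
    have "w \<in> Lam c" using a(2) yc hx
      by (auto simp: w_def Lam_def h_add h_smult Psi_carrier)
    then have "w \<in> X" using \<open>Lam c \<subseteq> X\<close> by blast
    have "\<Psi> x = y - w" unfolding w_def using yc Psi_carrier[of x] by (intro eq_vecI) auto
    then have "\<Psi> x \<in> X" using O_module_minus[OF Xm y \<open>w \<in> X\<close>] by simp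
    then have "x \<in> J c" using xL c by (auto simp: M_def)
    then have "\<Psi> x \<in> Lam c" using Psi_Lam[OF xL] by simp
    moreover have "y = w + \<Psi> x" unfolding w_def using yc Psi_carrier[of x] by (intro eq_vecI) auto
    ultimately show "y \<in> Lam c" using Lam_O_module \<open>w \<in> Lam c\<close> by (auto simp: O_module_def)
  qed
  ultimately show ?thesis by blast
qed

end

section \<open>The simplex of stable lattices\<close>

lemma mat_mult_unit_vec:
  fixes X :: "'a::semiring_1 mat"
  shows "X \<in> carrier_mat n n \<Longrightarrow> i < n \<Longrightarrow> j < n \<Longrightarrow> (X *\<^sub>v unit_vec n j) $ i = X $$ (i, j)"
  by simp

lemma mat_eq_mult_vecI:
  fixes X Y :: "'a::semiring_1 mat"
  assumes "X \<in> carrier_mat n n" "Y \<in> carrier_mat n n"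
    "\<And>y. y \<in> carrier_vec n \<Longrightarrow> X *\<^sub>v y = Y *\<^sub>v y"
  shows "X = Y"
proof (rule eq_matI)
  fix i j assume "i < dim_row Y" "j < dim_col Y"
  then have ij: "i < n" "j < n" using assms by auto
  have "(X *\<^sub>v unit_vec n j) $ i = (Y *\<^sub>v unit_vec n j) $ i" using assms(3) by simp
  then show "X $$ (i, j) = Y $$ (i, j)" using assms(1,2) ij by simp
qed (use assms in auto)

lemma scale_scale: "scale a (scale b X) = scale (a * b) X"
  by (auto simp: scale_def image_image smult_smult_assoc)

lemma scale_1: "scale 1 X = X"
  by (simp add: scale_def)

lemma homothety_class_eq_iff:
  "homothety_class X = homothety_class Y \<longleftrightarrow> (\<exists>a. a \<noteq> 0 \<and> Y = scale a X)"
proof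
  assume *: "homothety_class X = homothety_class Y"
  have "Y \<in> homothety_class Y" unfolding homothety_class_def
    by (intro CollectI exI[of _ 1]) (simp add: scale_1)
  then have "Y \<in> homothety_class X" using * by simp
  then show "\<exists>a. a \<noteq> 0 \<and> Y = scale a X" unfolding homothety_class_def by blast
next
  assume "\<exists>a. a \<noteq> 0 \<and> Y = scale a X"
  then obtain a where a: "a \<noteq> 0" "Y = scale a X" by blast
  have X: "X = scale (inverse a) Y" unfolding a(2) scale_scale using a(1) by (simp add: scale_1)
  show "homothety_class X = homothety_class Y"
  proof (intro equalityI subsetI)
    fix Z assume "Z \<in> homothety_class X"
    then obtain c where "c \<noteq> 0" "Z = scale c X" by (auto simp: homothety_class_def)
    then have "Z = scale (c * inverse a) Y" "c * inverse a \<noteq> 0"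
      using a(1) by (simp_all add: X scale_scale)
    then show "Z \<in> homothety_class Y" unfolding homothety_class_def by blast
  next
    fix Z assume "Z \<in> homothety_class Y"
    then obtain c where "c \<noteq> 0" "Z = scale c Y" by (auto simp: homothety_class_def)
    then have "Z = scale (c * a) X" "c * a \<noteq> 0" using a by (simp_all add: scale_scale)
    then show "Z \<in> homothety_class X" unfolding homothety_class_def by blast
  qed
qed

context stable_lattices
begin

text \<open>A scalar of the completion is a unit times the image of some a in K of the same value.
  The unit preserves the lattice, and \<open>J_scale\<close> gives the shift by a.\<close>

lemma scale_Lam: "x \<noteq> 0 \<Longrightarrow> scale x (Lam c) = Lam (c + e * v x)"
proof -
  have sub: "x \<cdot>\<^sub>v y \<in> Lam (c + e * v x)" if x: "x \<noteq> 0" and y: "y \<in> Lam c" for x y c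
  proof -
    obtain q where q: "q \<in> K" "q \<noteq> 0" "v (\<iota> q) = 1" using ex_unif_K by blast
    define a where "a = q powi (v x)"
    have a: "a \<in> K" "a \<noteq> 0" using q by (auto simp: a_def K_powi)
    have va: "v (\<iota> a) = v x" using q iota_nz[OF q(1,2)] by (simp add: a_def iota_powi v_powi)
    define u where "u = x * inverse (\<iota> a)"
    have ia: "\<iota> a \<noteq> 0" by (rule iota_nz[OF a])
    have "v u = 0" using x ia va by (simp add: u_def v_mult v_inverse)
    then have uO: "u \<in> val_ring v" by (simp add: val_ring_def)
    have xu: "x = u * \<iota> a" using ia by (simp add: u_def)
    have X: "O_module n (Lam (c + e * v x))" by (rule Lam_O_module)
    have "Lam c \<subseteq> {y\<in>carrier_vec n. x \<cdot>\<^sub>v y \<in> Lam (c + e * v x)}"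
    proof (rule Lam_minimal)
      show "O_module n {y\<in>carrier_vec n. x \<cdot>\<^sub>v y \<in> Lam (c + e * v x)}"
        unfolding O_module_def
      proof (intro conjI ballI)
        have "x \<cdot>\<^sub>v 0\<^sub>v n = 0\<^sub>v n" by auto
        then show "0\<^sub>v n \<in> {y\<in>carrier_vec n. x \<cdot>\<^sub>v y \<in> Lam (c + e * v x)}"
          using X by (simp add: O_module_def)
      next
        fix y w assume "y \<in> {y\<in>carrier_vec n. x \<cdot>\<^sub>v y \<in> Lam (c + e * v x)}"
          "w \<in> {y\<in>carrier_vec n. x \<cdot>\<^sub>v y \<in> Lam (c + e * v x)}"
        then show "y + w \<in> {y\<in>carrier_vec n. x \<cdot>\<^sub>v y \<in> Lam (c + e * v x)}"
          using X by (auto simp: O_module_def smult_add_distrib_vec[of _ n])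
      next
        fix d y assume d: "d \<in> val_ring v" and y: "y \<in> {y\<in>carrier_vec n. x \<cdot>\<^sub>v y \<in> Lam (c + e * v x)}"
        have "x \<cdot>\<^sub>v (d \<cdot>\<^sub>v y) = d \<cdot>\<^sub>v (x \<cdot>\<^sub>v y)" by (simp add: smult_smult_assoc mult.commute)
        then show "d \<cdot>\<^sub>v y \<in> {y\<in>carrier_vec n. x \<cdot>\<^sub>v y \<in> Lam (c + e * v x)}"
          using X d y by (auto simp: O_module_def)
      qed auto
      fix i assume i: "i < n"
      have "a * b c i \<in> J (c + e * v x)"
        using J_scale[OF a b_L[OF i], of c c] b_J[OF i, of c] by (simp add: va)
      then have "\<Psi> (a * b c i) \<in> Lam (c + e * v x)"
        using Psi_Lam[of "a * b c i"] J_L by blast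
      then have "u \<cdot>\<^sub>v \<Psi> (a * b c i) \<in> Lam (c + e * v x)"
        using X uO by (simp add: O_module_def)
      moreover have "x \<cdot>\<^sub>v \<Psi> (b c i) = u \<cdot>\<^sub>v \<Psi> (a * b c i)"
        unfolding Psi_smult[OF b_L[OF i] a(1)] xu by (simp add: smult_smult_assoc)
      ultimately show "\<Psi> (b c i) \<in> {y\<in>carrier_vec n. x \<cdot>\<^sub>v y \<in> Lam (c + e * v x)}"
        by (simp add: Psi_carrier)
    qed
    then show ?thesis using y by blast
  qed
  assume x: "x \<noteq> 0"
  show ?thesis
  proof
    show "scale x (Lam c) \<subseteq> Lam (c + e * v x)" using sub[OF x] by (auto simp: scale_def)
    show "Lam (c + e * v x) \<subseteq> scale x (Lam c)"
    proof
      fix y assume y: "y \<in> Lam (c + e * v x)"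
      have "inverse x \<cdot>\<^sub>v y \<in> Lam (c + e * v x + e * v (inverse x))"
        using x by (intro sub y) simp
      then have "inverse x \<cdot>\<^sub>v y \<in> Lam c" using x by (simp add: v_inverse)
      moreover have "y = x \<cdot>\<^sub>v (inverse x \<cdot>\<^sub>v y)" using x by (simp add: smult_smult_assoc)
      ultimately show "y \<in> scale x (Lam c)" unfolding scale_def by blast
    qed
  qed
qed

lemma Lam_inject: "Lam c = Lam c' \<longleftrightarrow> c = c'"
proof
  assume "Lam c = Lam c'"
  then have "x \<in> J c \<longleftrightarrow> x \<in> J c'" for x using Psi_Lam J_L by metis
  then show "c = c'" using J_inject by blast
qed simp

lemma Lam_antimono: "c \<le> c' \<Longrightarrow> Lam c' \<subseteq> Lam c"
proof (rule Lam_minimal[OF Lam_O_module])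
  fix i assume "c \<le> c'" "i < n"
  then have "b c' i \<in> J c" using b_J J_antimono by blast
  then show "\<Psi> (b c' i) \<in> Lam c" using Psi_Lam J_L by blast
qed

lemma homothety_class_Lam_eq_iff:
  "homothety_class (Lam c) = homothety_class (Lam c') \<longleftrightarrow> e dvd c' - c"
proof -
  obtain q where q: "q \<in> K" "q \<noteq> 0" "v (\<iota> q) = 1" using ex_unif_K by blast
  have "homothety_class (Lam c) = homothety_class (Lam c') \<longleftrightarrow> (\<exists>a. a \<noteq> 0 \<and> c' = c + e * v a)"
    unfolding homothety_class_eq_iff using scale_Lam Lam_inject by metis
  also have "\<dots> \<longleftrightarrow> e dvd c' - c"
  proof
    assume "e dvd c' - c"
    then obtain m where m: "c' - c = e * m" ..
    have "v (\<iota> q powi m) = m" "\<iota> q powi m \<noteq> 0" using q iota_nz[OF q(1,2)] by (auto simp: v_powi)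
    then show "\<exists>a. a \<noteq> 0 \<and> c' = c + e * v a"
      using m by (intro exI[of _ "\<iota> q powi m"]) auto
  qed auto
  finally show ?thesis .
qed

text \<open>In the basis \<open>\<Psi> (b c i)\<close> the endomorphisms of the lattice are the
  integral matrices. G is this base change and H its inverse, in the form that
  \<open>maximal_order_conj\<close> takes.\<close>

lemma maximal_order_Lam: "maximal_order v n (lattice_End n (Lam c))"
proof -
  obtain q where q: "q \<in> K" "q \<noteq> 0" "v (\<iota> q) = 1" using ex_unif_K by blast
  have \<pi>: "\<iota> q \<noteq> 0" "v (\<iota> q) = 1" using q iota_nz by auto
  define G where "G = mat n n (\<lambda>(r, i). \<Psi> (b c i) $ r)"
  define H where "H = mat n n (\<lambda>(i, j). \<iota> (coord n (b c) (E j) i))"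
  have G: "G \<in> carrier_mat n n" and H: "H \<in> carrier_mat n n" by (auto simp: G_def H_def)
  have Hv: "(H *\<^sub>v y) $ i = h c y i" if "i < n" "y \<in> carrier_vec n" for y i
    using that by (simp add: H_def h_def scalar_prod_def atLeast0LessThan)
  have Gv: "G *\<^sub>v y = vec n (\<lambda>r. \<Sum>i<n. y $ i * \<Psi> (b c i) $ r)" if "y \<in> carrier_vec n" for y
    using that by (intro eq_vecI) (auto simp: G_def scalar_prod_def atLeast0LessThan mult.commute)
  have GHv: "G *\<^sub>v (H *\<^sub>v y) = y" if y: "y \<in> carrier_vec n" for y
  proof -
    have "G *\<^sub>v (H *\<^sub>v y) = vec n (\<lambda>r. \<Sum>i<n. (H *\<^sub>v y) $ i * \<Psi> (b c i) $ r)"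
      using H y by (intro Gv) auto
    also have "\<dots> = vec n (\<lambda>r. \<Sum>i<n. h c y i * \<Psi> (b c i) $ r)"
      using y by (intro eq_vecI) (auto simp: Hv simp del: index_mult_mat_vec)
    finally have "G *\<^sub>v (H *\<^sub>v y) = vec n (\<lambda>r. \<Sum>i<n. h c y i * \<Psi> (b c i) $ r)" .
    then show ?thesis using h_expand[OF y, of c] by simp
  qed
  have HGv: "H *\<^sub>v (G *\<^sub>v y) = y" if y: "y \<in> carrier_vec n" for y
  proof (rule eq_vecI)
    fix i assume "i < dim_vec y"
    then have i: "i < n" using y by simp
    have "(H *\<^sub>v (G *\<^sub>v y)) $ i = h c (G *\<^sub>v y) i" using G y i by (intro Hv) auto
    then show "(H *\<^sub>v (G *\<^sub>v y)) $ i = y $ i" using i by (simp add: Gv[OF y] h_comb)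
  qed (use H y in simp)
  have GH: "G * H = 1\<^sub>m n"
    using G H GHv by (intro mat_eq_mult_vecI) (auto simp: assoc_mult_mat_vec[of _ n n _ n])
  have HG: "H * G = 1\<^sub>m n"
    using G H HGv by (intro mat_eq_mult_vecI) (auto simp: assoc_mult_mat_vec[of _ n n _ n])
  have Lam: "y \<in> Lam c \<longleftrightarrow> y \<in> carrier_vec n \<and> (\<forall>i<n. (H *\<^sub>v y) $ i \<in> val_ring v)" for y
    by (auto simp: Lam_def Hv)
  have Gu: "G *\<^sub>v unit_vec n j \<in> Lam c" if "j < n" for j
    unfolding Lam using that G by (auto simp: HGv val_ring_0 val_ring_1)
  have "lattice_End n (Lam c) = {X\<in>carrier_mat n n. \<forall>i<n. \<forall>j<n. (H * X * G) $$ (i, j) \<in> val_ring v}"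
  proof (intro equalityI subsetI)
    fix X assume X: "X \<in> lattice_End n (Lam c)"
    then have XC: "X \<in> carrier_mat n n" by (simp add: lattice_End_def)
    have "(H * X * G) $$ (i, j) \<in> val_ring v" if ij: "i < n" "j < n" for i j
    proof -
      have "X *\<^sub>v (G *\<^sub>v unit_vec n j) \<in> Lam c" using X Gu[OF ij(2)] by (simp add: lattice_End_def)
      then have "(H *\<^sub>v (X *\<^sub>v (G *\<^sub>v unit_vec n j))) $ i \<in> val_ring v" using ij by (simp add: Lam)
      also have "H *\<^sub>v (X *\<^sub>v (G *\<^sub>v unit_vec n j)) = (H * X * G) *\<^sub>v unit_vec n j"
        using H XC G by (simp add: assoc_mult_mat_vec[of _ n n _ n])
      also have "\<dots> $ i = (H * X * G) $$ (i, j)"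
        using ij H G XC by (intro mat_mult_unit_vec mult_carrier_mat[of _ n n])
      finally show ?thesis .
    qed
    then show "X \<in> {X\<in>carrier_mat n n. \<forall>i<n. \<forall>j<n. (H * X * G) $$ (i, j) \<in> val_ring v}"
      using XC by blast
  next
    fix X assume X: "X \<in> {X\<in>carrier_mat n n. \<forall>i<n. \<forall>j<n. (H * X * G) $$ (i, j) \<in> val_ring v}"
    then have XC: "X \<in> carrier_mat n n" by blast
    have "X *\<^sub>v y \<in> Lam c" if y: "y \<in> Lam c" for y
    proof -
      have yC: "y \<in> carrier_vec n" using y by (simp add: Lam)
      have "H *\<^sub>v (X *\<^sub>v y) = (H * X * G) *\<^sub>v (H *\<^sub>v y)"
        using H XC G yC GHv[OF yC] by (simp add: assoc_mult_mat_vec[of _ n n _ n])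
      moreover have "((H * X * G) *\<^sub>v (H *\<^sub>v y)) $ i \<in> val_ring v" if i: "i < n" for i
      proof -
        have "((H * X * G) *\<^sub>v (H *\<^sub>v y)) $ i = (\<Sum>j<n. (H * X * G) $$ (i, j) * (H *\<^sub>v y) $ j)"
          using i H G XC yC by (simp add: scalar_prod_def atLeast0LessThan del: index_mult_mat(1))
        also have "\<dots> \<in> val_ring v"
        proof (rule val_ring_sum)
          fix j assume "j \<in> {..<n}"
          then show "(H * X * G) $$ (i, j) * (H *\<^sub>v y) $ j \<in> val_ring v"
            using X i y by (intro val_ring_mult) (auto simp: Lam)
        qed
        finally show ?thesis .
      qed
      ultimately show ?thesis using XC yC by (simp add: Lam)
    qed
    then show "X \<in> lattice_End n (Lam c)" using XC by (simp add: lattice_End_def)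
  qed
  then show ?thesis using maximal_order_conj[OF \<pi> G H GH HG] by simp
qed

text \<open>The stable lattices are the \<open>Lam c\<close>, and scaling moves c by multiples of
  \<open>e\<close>, so the residues modulo \<open>e\<close> count the vertices. The premise
  \<open>gen\<close> carries the fact that the matrices in X come from a group generated by two
  elements.\<close>

theorem stable_simplex:
  assumes \<pi>: "uniformizer v \<pi>"
    and X: "X \<subseteq> carrier_mat n n" "map_mat \<iota> A \<in> X" "map_mat \<iota> B \<in> X"
    and gen: "\<And>Y M y. Y \<subseteq> carrier_vec n \<Longrightarrow> (\<And>y. y \<in> Y \<Longrightarrow> map_mat \<iota> A *\<^sub>v y \<in> Y) \<Longrightarrow>
      (\<And>y. y \<in> Y \<Longrightarrow> map_mat \<iota> B *\<^sub>v y \<in> Y) \<Longrightarrow> M \<in> X \<Longrightarrow> y \<in> Y \<Longrightarrow> M *\<^sub>v y \<in> Y"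
  shows "bt_simplex v \<pi> n (vertices_containing v n X) \<and> card (vertices_containing v n X) = nat e"
proof -
  let ?S = "vertices_containing v n X"
  let ?c = "\<lambda>c. homothety_class (Lam c)"
  have \<pi>': "\<pi> \<noteq> 0" "v \<pi> = 1" using \<pi> by (auto simp: uniformizer_def)
  have S: "?S = range ?c"
  proof (intro equalityI subsetI)
    fix V assume "V \<in> ?S"
    then obtain D Y where Y: "full_lattice v n Y" "V = homothety_class Y" "X \<subseteq> lattice_End n Y"
      unfolding vertices_containing_def vertex_of_order_def by blast
    have "\<exists>c. Y = Lam c"
      using Y(3) X(2,3) by (intro stable_lattice_eq_Lam[OF Y(1)]) (auto simp: lattice_End_def)
    then show "V \<in> range ?c" using Y(2) by blast
  next
    fix V assume "V \<in> range ?c"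
    then obtain c where V: "V = ?c c" by blast
    have LC: "Lam c \<subseteq> carrier_vec n" by (auto simp: Lam_def)
    have "X \<subseteq> lattice_End n (Lam c)"
      using X(1) gen[OF LC Lam_A Lam_B] by (auto simp: lattice_End_def)
    moreover have "V \<in> bt_vertices v n" using V Lam_full_lattice by (auto simp: bt_vertices_def)
    moreover have "vertex_of_order v n V (lattice_End n (Lam c))"
      unfolding vertex_of_order_def using V Lam_full_lattice by blast
    ultimately show "V \<in> ?S" unfolding vertices_containing_def using maximal_order_Lam by blast
  qed
  have "range ?c \<subseteq> ?c ` {0..<e}"
  proof
    fix V assume "V \<in> range ?c"
    then obtain c where V: "V = ?c c" by blast
    have "e dvd c mod e - c" by (metis dvd_minus_mod dvd_minus_iff minus_diff_eq)
    then have "V = ?c (c mod e)" unfolding V homothety_class_Lam_eq_iff .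
    moreover have "c mod e \<in> {0..<e}" using e_pos by simp
    ultimately show "V \<in> ?c ` {0..<e}" by blast
  qed
  moreover have "?c ` {0..<e} \<subseteq> range ?c" by (rule image_mono) simp
  ultimately have S': "?S = ?c ` {0..<e}" unfolding S by (rule equalityI)
  have "inj_on ?c {0..<e}"
  proof (rule inj_onI)
    fix c c' assume c: "c \<in> {0..<e}" "c' \<in> {0..<e}" "?c c = ?c c'"
    then have "e dvd c' - c" by (simp add: homothety_class_Lam_eq_iff)
    then have "c' mod e = c mod e" by (simp add: mod_eq_dvd_iff)
    then show "c = c'" using c by simp
  qed
  then have card: "card ?S = nat e" unfolding S' by (simp add: card_image)
  \<comment> \<open>Reversing the index makes the chain increasing. Its last lattice is
    \<open>Lam 0\<close>, and \<pi> sends it to \<open>Lam e\<close>, which lies in the first one,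
    \<open>Lam (e - 1)\<close>.\<close>
  have "?S = (\<lambda>i. homothety_class (Lam (e - int i))) ` {1..nat e}"
  proof -
    have "{0..<e} = (\<lambda>i. e - int i) ` {1..nat e}"
    proof (intro equalityI subsetI)
      fix c assume "c \<in> {0..<e}"
      then have "c = e - int (nat (e - c))" "nat (e - c) \<in> {1..nat e}" by auto
      then show "c \<in> (\<lambda>i. e - int i) ` {1..nat e}" by blast
    qed auto
    then show ?thesis unfolding S' by (simp add: image_image)
  qed
  moreover have "scale \<pi> (Lam (e - int (nat e))) \<subseteq> Lam (e - int 1)"
    using e_pos \<pi>' by (simp add: scale_Lam Lam_antimono)
  moreover have "\<forall>i\<in>{1..<nat e}. Lam (e - int i) \<subseteq> Lam (e - int (i + 1))"
    by (auto intro!: Lam_antimono)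
  moreover have "1 \<le> nat e" using e_pos by simp
  ultimately have "bt_simplex v \<pi> n ?S"
    unfolding bt_simplex_def
    by (intro exI[of _ "nat e"] exI[of _ "\<lambda>i. Lam (e - int i)"] conjI ballI Lam_full_lattice) auto
  with card show ?thesis by blast
qed

end

section \<open>Cyclotomic fields over their cyclic fixed fields\<close>

context cyclic_galois
begin

sublocale G: integral_galois "zring z" "zfield z" \<sigma> N
proof
  show "zring z \<subseteq> zfield z" by (rule zring_zfield)
  show "inverse x \<in> zfield z" if "x \<in> zfield z" for x using that by (rule zfield_inverse)
  show "\<exists>n>0. of_nat n * x \<in> zring z" if "x \<in> zfield z" for x using that by (simp add: zfield_def)
  show "\<exists>y\<in>zring z. \<exists>n::int. n \<noteq> 0 \<and> x * y = of_int n" if "x \<in> zring z" "x \<noteq> 0" for x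
    using zring_dvd_int[OF M_pos root that] .
  show "\<sigma> 1 = 1" using gal_of_int[of 1] by simp
  show "zring z = {x\<in>zfield z. algebraic_int x}"
    using zring_zfield zring_algebraic_int[OF M_pos root] zring_integrally_closed
    by (auto simp: zfield_def)
qed (auto simp: gal_zfield gal_zring gal_add gal_mult gal_order N_pos
      intro: zr.one_in zr.add_in zr.mult_in zr.minus_in zf.one_in zf.add_in zf.mult_in zf.minus_in)

lemma ex_frobenius_order:
  assumes "prime p"
  shows "\<exists>l Q d. frobenius_order (zring z) (zfield z) \<sigma> N p l Q d"
proof -
  obtain f d Q where *: "d \<ge> 1" "Q \<ge> 2"
    "\<exists>r\<in>zring z. of_nat p = ip f z * r" "\<exists>r\<in>zring z. ip f z ^ d = of_nat p * r"
    "\<And>x. x \<in> zring z \<Longrightarrow> cgr (zring z) (ip f z) (x ^ Q) x"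
    "\<And>k. \<exists>r\<in>zring z. ip f (z ^ k) = ip f z * r"
    using radical_generator[OF assms] by metis
  have "frobenius_order (zring z) (zfield z) \<sigma> N p (ip f z) Q d"
    by unfold_locales (use * assms in \<open>auto simp: gal_ip zringI\<close>)
  then show ?thesis by blast
qed

lemma map_poly_gal_mult:
  assumes "\<And>i. coeff f i \<in> zfield z" "\<And>i. coeff g i \<in> zfield z"
  shows "map_poly \<sigma> (f * g) = map_poly \<sigma> f * map_poly \<sigma> g"
proof (rule poly_eqI)
  fix i
  have "\<sigma> (\<Sum>j\<le>i. coeff f j * coeff g (i - j)) = (\<Sum>j\<le>i. \<sigma> (coeff f j * coeff g (i - j)))"
    by (rule G.s_sum) (use assms in \<open>auto intro: zf.mult_in\<close>)
  then show "coeff (map_poly \<sigma> (f * g)) i = coeff (map_poly \<sigma> f * map_poly \<sigma> g) i"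
    using assms by (simp add: coeff_map_poly G.s_zero coeff_mult gal_mult)
qed

definition min_poly :: "complex poly" where
  "min_poly = (\<Prod>j<N. [:- (z ^ (k ^ j)), 1:])"

lemma pow_zring: "z ^ i \<in> zring z"
  by (intro zr.power_in self_in_zring)

lemma pow_zfield: "z ^ i \<in> zfield z"
  using zring_zfield pow_zring by blast

lemma z_zfield: "z \<in> zfield z"
  using pow_zfield[of 1] by simp

lemma coeff_mult_in:
  assumes "csubring S" "\<And>i. coeff f i \<in> S" "\<And>i. coeff g i \<in> S"
  shows "coeff (f * g) i \<in> S"
proof -
  interpret csubring S by fact
  show ?thesis unfolding coeff_mult by (intro sum_in mult_in assms)
qed

lemma linear_coeff_in: "coeff [:- (z ^ j), 1:] i \<in> zring z"
  by (auto simp: coeff_pCons split: nat.split intro: zr.minus_in pow_zring zr.one_in zr.zero_in)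

lemma prod_linear_coeff_in: "coeff (\<Prod>j\<in>I. [:- (z ^ f j), 1:]) i \<in> zring z"
proof (induction I arbitrary: i rule: infinite_finite_induct)
  case (insert j I)
  show ?case unfolding prod.insert[OF insert.hyps]
    by (intro coeff_mult_in csubring_zring linear_coeff_in insert.IH)
qed (auto simp: coeff_1 intro: zr.one_in zr.zero_in split: if_splits)

lemma map_poly_gal_prod:
  "map_poly \<sigma> (\<Prod>j\<in>I. [:- (z ^ f j), 1:]) = (\<Prod>j\<in>I. [:- \<sigma> (z ^ f j), 1:])"
proof (induction I rule: infinite_finite_induct)
  case (insert j I)
  have "map_poly \<sigma> (\<Prod>j\<in>insert j I. [:- (z ^ f j), 1:])
      = map_poly \<sigma> [:- (z ^ f j), 1:] * map_poly \<sigma> (\<Prod>j\<in>I. [:- (z ^ f j), 1:])"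
    unfolding prod.insert[OF insert.hyps]
    using zring_zfield linear_coeff_in prod_linear_coeff_in by (intro map_poly_gal_mult) blast+
  also have "map_poly \<sigma> [:- (z ^ f j), 1:] = [:- \<sigma> (z ^ f j), 1:]"
    by (simp add: Polynomial.map_poly_pCons G.s_zero G.s_one G.s_minus[OF pow_zfield])
  finally show ?case unfolding insert.IH prod.insert[OF insert.hyps] .
qed (simp_all add: map_poly_1 G.s_zero G.s_one)

text \<open>The automorphism permutes the linear factors cyclically. The two products agree after
  multiplication by X - z, which is then cancelled.\<close>

lemma min_poly_coeff: "coeff min_poly i \<in> G.O_K"
proof -
  have conj: "\<sigma> (z ^ (k ^ j)) = z ^ (k ^ Suc j)" for j
    by (simp add: gal_pow[OF z_zfield] gal_z flip: power_mult)
  have "map_poly \<sigma> min_poly = (\<Prod>j<N. [:- (z ^ (k ^ Suc j)), 1:])"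
    unfolding min_poly_def map_poly_gal_prod conj ..
  also have "\<dots> * [:- (z ^ (k ^ 0)), 1:] = (\<Prod>j<Suc N. [:- (z ^ (k ^ j)), 1:])"
    by (simp only: prod.lessThan_Suc_shift mult.commute)
  also have "\<dots> = min_poly * [:- (z ^ (k ^ N)), 1:]"
    by (simp add: min_poly_def)
  also have "z ^ (k ^ N) = z ^ (k ^ 0)"
    unfolding pow_eq_iff using k_N by simp
  finally have "map_poly \<sigma> min_poly * [:- (z ^ (k ^ 0)), 1:] = min_poly * [:- (z ^ (k ^ 0)), 1:]" .
  then have "map_poly \<sigma> min_poly = min_poly"
    by (subst (asm) mult_cancel_right) auto
  then have "\<sigma> (coeff min_poly i) = coeff min_poly i"
    by (metis G.s_zero coeff_map_poly)
  moreover have "coeff min_poly i \<in> zring z"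
    unfolding min_poly_def by (rule prod_linear_coeff_in)
  ultimately show ?thesis using zring_zfield by (auto simp: G.O_K_def G.K_def)
qed

lemma degree_min_poly: "degree min_poly = N"
  unfolding min_poly_def by (subst degree_prod_eq_sum_degree) auto

lemma lead_coeff_min_poly: "coeff min_poly N = 1"
  using lead_coeff_prod[of "\<lambda>j. [:- (z ^ (k ^ j)), 1:]" "{..<N}"] degree_min_poly
  by (simp add: min_poly_def)

lemma poly_min_poly: "poly min_poly z = 0"
  unfolding min_poly_def poly_prod using N_pos by (intro prod_zero bexI[of _ 0]) auto

lemma z_pow_N: "z ^ N = (\<Sum>i<N. - coeff min_poly i * z ^ i)"
proof -
  have "0 = (\<Sum>i\<le>N. coeff min_poly i * z ^ i)"
    using poly_min_poly by (simp add: poly_altdef degree_min_poly)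
  also have "{..N} = insert N {..<N}" by auto
  finally have "z ^ N + (\<Sum>i<N. coeff min_poly i * z ^ i) = 0" by (simp add: lead_coeff_min_poly)
  then show ?thesis by (simp add: sum_negf add_eq_0_iff2)
qed

text \<open>Horner's rule, in which the overflowing power z^N is reduced by a monic relation with
  coefficients in \<open>O_K\<close>.\<close>

lemma zring_generators:
  assumes "x \<in> zring z"
  shows "\<exists>c. (\<forall>i<N. c i \<in> G.O_K) \<and> x = (\<Sum>i<N. c i * z ^ i)"
proof -
  obtain f where f: "x = ip f z" using assms by (auto simp: zring_def)
  obtain N' where N': "N = Suc N'" using N_pos by (cases N) auto
  show ?thesis unfolding f
  proof (induction f)
    case 0
    show ?case by (intro exI[of _ "\<lambda>_. 0"]) (auto intro: G.O_K.zero_in)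
  next
    case (pCons a f)
    then obtain c where c: "\<forall>i<N. c i \<in> G.O_K" "ip f z = (\<Sum>i<N. c i * z ^ i)" by blast
    \<comment> \<open>The coefficients move up by one place; the top one, c N', meets z^N and is
      redistributed through the coefficients of \<open>min_poly\<close>.\<close>
    define c' where "c' i = (if i = 0 then of_int a else c (i - 1)) - c N' * coeff min_poly i" for i
    have "z * ip f z = (\<Sum>i<N. c i * z ^ Suc i)"
      unfolding c(2) by (simp add: sum_distrib_left mult_ac)
    also have "\<dots> = (\<Sum>i<N'. c i * z ^ Suc i) + c N' * z ^ N"
      by (simp add: N')
    also have "\<dots> = (\<Sum>i<N'. c i * z ^ Suc i) - (\<Sum>i<N. c N' * coeff min_poly i * z ^ i)"
      unfolding z_pow_N by (simp add: sum_distrib_left sum_negf mult.assoc)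
    finally have "of_int a + z * ip f z =
        (of_int a * z ^ 0 + (\<Sum>i<N'. c i * z ^ Suc i)) - (\<Sum>i<N. c N' * coeff min_poly i * z ^ i)"
      by simp
    also have "of_int a * z ^ 0 + (\<Sum>i<N'. c i * z ^ Suc i) = (\<Sum>i<N. (if i = 0 then of_int a else c (i - 1)) * z ^ i)"
      unfolding N' sum.lessThan_Suc_shift by simp
    also have "\<dots> - (\<Sum>i<N. c N' * coeff min_poly i * z ^ i) = (\<Sum>i<N. c' i * z ^ i)"
      by (simp add: c'_def left_diff_distrib sum_subtractf)
    finally have "ip (pCons a f) z = (\<Sum>i<N. c' i * z ^ i)" by (simp add: ip_pCons)
    moreover have "c' i \<in> G.O_K" if "i < N" for i
      using c(1) that N' unfolding c'_def
      by (intro G.O_K.diff_in G.O_K.mult_in min_poly_coeff) (auto intro: G.O_K.of_int_in)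
    ultimately show ?case by blast
  qed
qed

text \<open>For independence: a relation over the fixed field holds at all N conjugates of z, which
  are distinct, while the corresponding polynomial has degree below N.\<close>

lemma z_basis: "G.K_basis N (\<lambda>i. z ^ i)"
  unfolding G.K_basis_def
proof (intro conjI allI impI ballI)
  show "z ^ i \<in> zfield z" for i using zring_zfield pow_zring by blast
  show "\<exists>c. (\<forall>i<N. c i \<in> G.K) \<and> x = (\<Sum>i<N. c i * z ^ i)" if x: "x \<in> zfield z" for x
  proof -
    obtain n where n: "n > 0" "of_nat n * x \<in> zring z" using x by (auto simp: zfield_def)
    obtain c where c: "\<forall>i<N. c i \<in> G.O_K" "of_nat n * x = (\<Sum>i<N. c i * z ^ i)"
      using zring_generators[OF n(2)] by blast
    have "x = (of_nat n * x) / of_nat n" using n(1) by simp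
    also have "\<dots> = (\<Sum>i<N. (c i / of_nat n) * z ^ i)" unfolding c(2) by (simp add: sum_divide_distrib)
    finally show ?thesis using c(1)
      by (intro exI[of _ "\<lambda>i. c i / of_nat n"]) (auto intro: G.K_divide G.K.of_nat_in G.O_K_K)
  qed
  fix c i
  assume c: "\<forall>i<N. c i \<in> G.K" "(\<Sum>i<N. c i * z ^ i) = 0" and i: "i < N"
  define g where "g = (\<Sum>i<N. monom (c i) i)"
  have conj: "(\<sigma> ^^ j) (\<Sum>i<N. c i * z ^ i) = (\<Sum>i<N. c i * (z ^ (k ^ j)) ^ i)" for j
  proof (induction j)
    case (Suc j)
    have "(\<sigma> ^^ Suc j) (\<Sum>i<N. c i * z ^ i) = \<sigma> (\<Sum>i<N. c i * (z ^ (k ^ j)) ^ i)"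
      using Suc by simp
    also have "\<dots> = (\<Sum>i<N. \<sigma> (c i * (z ^ (k ^ j)) ^ i))"
      using c(1) by (intro G.s_sum zf.mult_in zf.power_in[OF pow_zfield]) (auto dest: G.K_L)
    also have "\<dots> = (\<Sum>i<N. c i * (z ^ (k ^ Suc j)) ^ i)"
    proof (rule sum.cong)
      fix i assume "i \<in> {..<N}"
      then have ci: "c i \<in> zfield z" "\<sigma> (c i) = c i" using c(1) by (auto simp: G.K_def)
      have "\<sigma> ((z ^ (k ^ j)) ^ i) = (z ^ (k ^ Suc j)) ^ i"
        by (simp add: gal_pow[OF z_zfield] gal_z mult_ac flip: power_mult)
      moreover have "(z ^ (k ^ j)) ^ i \<in> zfield z" by (rule zf.power_in[OF pow_zfield])
      ultimately show "\<sigma> (c i * (z ^ (k ^ j)) ^ i) = c i * (z ^ (k ^ Suc j)) ^ i"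
        using gal_mult ci by metis
    qed simp
    finally show ?case .
  qed simp
  have zero: "(\<sigma> ^^ j) 0 = 0" for j by (induction j) (auto simp: G.s_zero)
  have roots: "poly g (z ^ (k ^ j)) = 0" for j
    using conj[of j] zero unfolding c(2) by (simp add: g_def poly_sum Polynomial.poly_monom)
  have "g = 0"
  proof (rule ccontr)
    assume g: "g \<noteq> 0"
    have "degree g < N" unfolding g_def using N_pos
      by (intro degree_sum_less) (auto intro: le_less_trans[OF degree_monom_le])
    moreover have "inj_on (\<lambda>j. z ^ (k ^ j)) {..<N}" using conj_inj by (auto intro: inj_onI)
    then have "N = card ((\<lambda>j. z ^ (k ^ j)) ` {..<N})" by (simp add: card_image)
    also have "\<dots> \<le> card {x. poly g x = 0}"
      using roots poly_roots_finite[OF g] by (intro card_mono) auto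
    also have "\<dots> \<le> degree g" by (rule card_poly_roots_bound[OF g])
    ultimately show False by simp
  qed
  have "c i = coeff g i" using i by (simp add: g_def coeff_sum if_distrib cong: if_cong)
  then show "c i = 0" using \<open>g = 0\<close> by simp
qed

end

section \<open>The metacyclic group\<close>

definition metacyclic_relators :: "nat \<Rightarrow> nat \<Rightarrow> int \<Rightarrow> gen word set" where
  "metacyclic_relators N M k =
    {word_pow Gen_a (int M), word_pow Gen_b (int N),
     word_pow Gen_b 1 @ word_pow Gen_a 1 @ word_pow Gen_b (-1) @ word_pow Gen_a (-k)}"

lemma metacyclic_eq: "metacyclic N M k = presented_group (metacyclic_relators N M k)"
  by (simp add: metacyclic_def metacyclic_relators_def)

abbreviation "gen_class N M k g \<equiv> word_class (metacyclic_relators N M k) [(g, True)]"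

lemma metacyclic_carrier: "carrier (metacyclic N M k) = range (word_class (metacyclic_relators N M k))"
  by (simp add: metacyclic_eq presented_group_def)

lemma metacyclic_one: "\<one>\<^bsub>metacyclic N M k\<^esub> = word_class (metacyclic_relators N M k) []"
  by (simp add: metacyclic_eq presented_group_def)

lemma metacyclic_mult:
  "word_class (metacyclic_relators N M k) u \<otimes>\<^bsub>metacyclic N M k\<^esub> word_class (metacyclic_relators N M k) w
    = word_class (metacyclic_relators N M k) (u @ w)"
  by (simp add: metacyclic_eq presented_group_mult)

text \<open>Both generators have finite order, so inverse letters can be replaced by positive
  powers; \<open>metacyclic_induct\<close> then needs no case for inverses.\<close>

lemma inverse_letter:
  assumes "word_eq R (replicate m (g, True)) []" "m \<ge> 1"
  shows "word_eq R [(g, False)] (replicate (m - 1) (g, True))"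
proof -
  have "word_eq R ([(g, False)] @ []) ([(g, False)] @ replicate m (g, True))"
    using assms(1) by (intro word_eq.append word_eq.refl) (rule word_eq.sym)
  moreover have "replicate m (g, True) = (g, True) # replicate (m - 1) (g, True)"
    using assms(2) by (cases m) auto
  moreover have "word_eq R ([(g, False), (g, True)] @ replicate (m - 1) (g, True)) ([] @ replicate (m - 1) (g, True))"
    using word_eq.cancel[of R g False] by (intro word_eq.append word_eq.refl) simp
  ultimately show ?thesis using word_eq.trans by fastforce
qed

lemma metacyclic_relations:
  "word_eq (metacyclic_relators N M k) (replicate M (Gen_a, True)) []"
  "word_eq (metacyclic_relators N M k) (replicate N (Gen_b, True)) []"
  "word_eq (metacyclic_relators N M k)
    ([(Gen_b, True)] @ [(Gen_a, True)] @ [(Gen_b, False)] @ word_pow Gen_a (-k)) []"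
proof -
  let ?R = "metacyclic_relators N M k"
  have "word_pow Gen_a (int M) \<in> ?R" "word_pow Gen_b (int N) \<in> ?R"
    "word_pow Gen_b 1 @ word_pow Gen_a 1 @ word_pow Gen_b (-1) @ word_pow Gen_a (-k) \<in> ?R"
    by (auto simp: metacyclic_relators_def)
  from this[THEN word_eq.relator]
  show "word_eq ?R (replicate M (Gen_a, True)) []" "word_eq ?R (replicate N (Gen_b, True)) []"
    "word_eq ?R ([(Gen_b, True)] @ [(Gen_a, True)] @ [(Gen_b, False)] @ word_pow Gen_a (-k)) []"
    by (simp_all add: word_pow_def)
qed

lemma metacyclic_induct:
  assumes h: "h \<in> carrier (metacyclic N M k)" and NM: "N \<ge> 1" "M \<ge> 1"
    and one: "Inv \<one>\<^bsub>metacyclic N M k\<^esub>"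
    and ab: "Inv (gen_class N M k Gen_a)" "Inv (gen_class N M k Gen_b)"
    and mult: "\<And>x y. x \<in> carrier (metacyclic N M k) \<Longrightarrow> y \<in> carrier (metacyclic N M k) \<Longrightarrow>
      Inv x \<Longrightarrow> Inv y \<Longrightarrow> Inv (x \<otimes>\<^bsub>metacyclic N M k\<^esub> y)"
  shows "Inv h"
proof -
  let ?R = "metacyclic_relators N M k"
  have append: "Inv (word_class ?R (u @ w))" if "Inv (word_class ?R u)" "Inv (word_class ?R w)" for u w
    using mult[OF _ _ that] by (simp add: metacyclic_mult metacyclic_carrier)
  have nil: "Inv (word_class ?R [])" using one by (simp add: metacyclic_one)
  have pos: "Inv (word_class ?R [(g, True)])" for g using ab by (cases g) auto
  have rep: "Inv (word_class ?R (replicate i (g, True)))" for i g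
  proof (induction i)
    case (Suc i)
    then show ?case using append[OF pos Suc, of g] by simp
  qed (simp add: nil)
  have neg: "Inv (word_class ?R [(g, False)])" for g
  proof -
    obtain m where "m \<ge> 1" "word_eq ?R (replicate m (g, True)) []"
      using metacyclic_relations(1,2) NM by (cases g) blast+
    then have "word_class ?R [(g, False)] = word_class ?R (replicate (m - 1) (g, True))"
      unfolding word_class_eq_iff by (intro inverse_letter)
    then show ?thesis using rep by simp
  qed
  have "Inv (word_class ?R u)" for u
  proof (induction u)
    case (Cons x u)
    obtain g s where "x = (g, s)" by fastforce
    then have "Inv (word_class ?R [x])" using pos neg by (cases s) auto
    from append[OF this Cons] show ?case by simp
  qed (rule nil)
  then show ?thesis using h by (auto simp: metacyclic_carrier)
qed

text \<open>The affine maps \<open>x \<mapsto> \<alpha> x + \<beta>\<close> modulo \<open>M\<close>, with \<open>a\<close> acting as \<open>x + 1\<close> and \<open>b\<close> as \<open>k x\<close>,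
  show that \<open>a\<close> has order \<open>M\<close>.\<close>

fun affine :: "int \<Rightarrow> int \<Rightarrow> gen word \<Rightarrow> int \<times> int" where
  "affine k k' [] = (1, 0)"
| "affine k k' ((Gen_a, s) # u) = (fst (affine k k' u), snd (affine k k' u) + (if s then 1 else -1))"
| "affine k k' ((Gen_b, s) # u) = ((if s then k else k') * fst (affine k k' u), (if s then k else k') * snd (affine k k' u))"

lemma affine_append:
  "affine k k' (u @ w) = (fst (affine k k' u) * fst (affine k k' w),
    fst (affine k k' u) * snd (affine k k' w) + snd (affine k k' u))"
  by (induction k k' u rule: affine.induct) (auto simp: algebra_simps)

lemma affine_replicate_a: "affine k k' (replicate i (Gen_a, s)) = (1, if s then int i else - int i)"
  by (induction i) auto

lemma affine_replicate_b: "affine k k' (replicate i (Gen_b, True)) = (k ^ i, 0)"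
  by (induction i) auto

text \<open>The affine map of a word is an invariant of the group element modulo M. The number k' is
  an inverse of k modulo M and stands for the inverse letter of b.\<close>

lemma affine_word_eq:
  assumes k: "[k * k' = 1] (mod int M)" "[k ^ N = 1] (mod int M)"
    and u: "word_eq (metacyclic_relators N M k) u w"
  shows "[fst (affine k k' u) = fst (affine k k' w)] (mod int M)
    \<and> [snd (affine k k' u) = snd (affine k k' w)] (mod int M)"
  using u
proof (induction rule: word_eq.induct)
  case (append u u' w w')
  then show ?case by (auto simp: affine_append intro!: cong_mult cong_add)
next
  case (cancel g s)
  have "[k' * k = 1] (mod int M)" using k(1) by (simp add: mult.commute)
  then show ?case using k(1) by (cases g; cases s) auto
next
  case (relator u)
  then consider "u = word_pow Gen_a (int M)" | "u = word_pow Gen_b (int N)"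
    | "u = word_pow Gen_b 1 @ word_pow Gen_a 1 @ word_pow Gen_b (-1) @ word_pow Gen_a (-k)"
    by (auto simp: metacyclic_relators_def)
  then show ?case
  proof cases
    case 1
    then show ?thesis by (simp add: word_pow_def affine_replicate_a cong_def)
  next
    case 2
    then show ?thesis using k by (simp add: word_pow_def affine_replicate_b)
  next
    case 3
    have pow: "affine k k' (word_pow Gen_a (-k)) = (1, -k)"
      by (simp add: word_pow_def affine_replicate_a)
    have eq: "affine k k' u = (k * k', k * k' * (-k) + k)"
      unfolding 3 by (simp add: affine_append pow) (simp add: word_pow_def algebra_simps)
    have "[k * k' * (-k) + k = 1 * (-k) + k] (mod int M)"
      by (intro cong_add cong_mult k cong_refl)
    then show ?thesis unfolding eq using k(1) by simp
  qed
qed (auto intro: cong_sym cong_trans)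

lemma metacyclic_order_a:
  assumes "coprime k (int M)" "[k ^ N = 1] (mod int M)"
    and "word_eq (metacyclic_relators N M k) (replicate d (Gen_a, True)) []"
  shows "M dvd d"
proof -
  obtain k' where "[k * k' = 1] (mod int M)" using cong_solve_coprime_int assms(1) by blast
  from affine_word_eq[OF this assms(2,3)] have "[int d = 0] (mod int M)"
    by (simp add: affine_replicate_a)
  then show ?thesis by (simp add: cong_0_iff)
qed

section \<open>Faithful irreducible representations of the metacyclic group\<close>

lemma subfield_closed:
  fixes K :: "complex set"
  assumes "subfield K class_ring"
  shows "csubring K" and "x \<in> K \<Longrightarrow> inverse x \<in> K"
proof -
  note r = subringE[OF subfieldE(1)[OF assms]]
  show "csubring K"
    using r by unfold_locales (auto simp: class_ring_simps)
  show "inverse x \<in> K" if x: "x \<in> K"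
  proof (cases "x = 0")
    case False
    have "Units (class_ring \<lparr>carrier := K\<rparr>) = K - {0}"
      using subfield.subfield_Units[OF assms] by simp
    then have "x \<in> Units (class_ring \<lparr>carrier := K\<rparr>)" using x False by blast
    then obtain y where "y \<in> K" "x * y = 1" by (auto simp: Units_def)
    then show ?thesis using inverse_unique by metis
  qed (use x in simp)
qed

lemma inv_class_ring: "(x::complex) \<noteq> 0 \<Longrightarrow> inv\<^bsub>class_ring\<^esub> x = inverse x"
  unfolding m_inv_def by (rule the_equality) (auto simp: inverse_unique)

lemma GL_mult: "X \<otimes>\<^bsub>GL E n\<^esub> Y = X * Y"
  by (simp add: GL_def units_of_def matrices_def ring_mat_def)

lemma GL_carrierD:
  assumes "X \<in> carrier (GL E n)"
  shows "X \<in> carrier_mat n n" and "i < n \<Longrightarrow> j < n \<Longrightarrow> X $$ (i, j) \<in> E"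
    and "\<exists>Y\<in>carrier_mat n n. Y * X = 1\<^sub>m n"
proof -
  have X: "X \<in> Units (matrices E n)" using assms by (simp add: GL_def units_of_def)
  then have 1: "X \<in> carrier_mat n n" "elements_mat X \<subseteq> E"
    by (auto simp: Units_def matrices_def ring_mat_def)
  show "X \<in> carrier_mat n n" by (fact 1)
  show "i < n \<Longrightarrow> j < n \<Longrightarrow> X $$ (i, j) \<in> E" using 1 by (meson elements_matI subsetD)
  show "\<exists>Y\<in>carrier_mat n n. Y * X = 1\<^sub>m n"
    using X by (auto simp: Units_def matrices_def ring_mat_def)
qed

lemma pow_mat_mult_vec:
  assumes "X \<in> carrier_mat n n" "x \<in> carrier_vec n"
  shows "X ^\<^sub>m i *\<^sub>v x = (((*\<^sub>v) X) ^^ i) x"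
  using assms(2)
proof (induction i arbitrary: x)
  case 0
  then show ?case using assms(1) by simp
next
  case (Suc i)
  have "X ^\<^sub>m Suc i *\<^sub>v x = X ^\<^sub>m i *\<^sub>v (X *\<^sub>v x)"
    using assms(1) Suc.prems by (simp add: assoc_mult_mat_vec[of _ n n _ n])
  also have "\<dots> = (((*\<^sub>v) X) ^^ i) (X *\<^sub>v x)"
    by (rule Suc.IH[OF mult_mat_vec_carrier[OF assms(1) Suc.prems]])
  finally show ?case by (simp add: funpow_swap1)
qed

lemma replicate_relation:
  assumes "word_eq R (replicate m (g, True)) []"
  shows "word_eq R (replicate (m * q) (g, True)) []"
proof (induction q)
  case (Suc q)
  have "word_eq R (replicate m (g, True) @ replicate (m * q) (g, True)) ([] @ [])"
    by (intro word_eq.append assms Suc)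
  then show ?case by (simp add: replicate_add)
qed (simp add: word_eq.refl)

text \<open>Each inverse letter becomes M - 1 positive ones, and the total exponent is then a
  multiple of M. This exchanges the integer k in the defining relation for a natural number.\<close>

lemma word_pow_neg_cancel:
  assumes M: "M \<ge> 1" and rel: "word_eq R (replicate M (g, True)) []" and k: "[int k' = k] (mod int M)"
  shows "word_eq R (word_pow g (- k) @ replicate k' (g, True)) []"
proof -
  obtain m where m: "word_eq R (word_pow g (- k)) (replicate m (g, True))" "[int m = - k] (mod int M)"
  proof (cases "k \<le> 0")
    case True
    then show ?thesis by (intro that[of "nat (- k)"]) (auto simp: word_pow_def word_eq.refl)
  next
    case False
    have rep: "word_eq R (replicate i (g, False)) (replicate ((M - 1) * i) (g, True))" for i
    proof (induction i)
      case (Suc i)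
      have "word_eq R ([(g, False)] @ replicate i (g, False)) (replicate (M - 1) (g, True) @ replicate ((M - 1) * i) (g, True))"
        by (intro word_eq.append Suc inverse_letter rel M)
      then show ?case by (simp add: replicate_add)
    qed (simp add: word_eq.refl)
    have "[int ((M - 1) * nat k) = (int M - 1) * k] (mod int M)"
      using False M by (simp add: of_nat_diff)
    also have "[(int M - 1) * k = (0 - 1) * k] (mod int M)"
      by (intro cong_mult cong_diff cong_refl) (simp add: cong_def)
    finally have "[int ((M - 1) * nat k) = - k] (mod int M)" by simp
    then show ?thesis using rep[of "nat k"] False
      by (intro that[of "(M - 1) * nat k"]) (auto simp: word_pow_def)
  qed
  have "[int m + int k' = - k + k] (mod int M)" by (intro cong_add m k)
  then have "int M dvd int (m + k')" by (simp add: cong_0_iff)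
  then have "M dvd m + k'" by (simp only: of_nat_dvd_iff)
  then obtain q where q: "m + k' = M * q" ..
  have "word_eq R (word_pow g (- k) @ replicate k' (g, True)) (replicate m (g, True) @ replicate k' (g, True))"
    by (intro word_eq.append m word_eq.refl)
  also have "replicate m (g, True) @ replicate k' (g, True) = replicate (M * q) (g, True)"
    by (simp add: q flip: replicate_add)
  finally show ?thesis using replicate_relation[OF rel] word_eq.trans by blast
qed

section \<open>The matrices of a and b, their relations, and irreducibility in coordinates\<close>

locale metacyclic_rep =
  fixes N M n :: nat and k :: int and \<phi> :: "gen word set \<Rightarrow> complex mat" and K :: "complex set"
  assumes N_pos: "N \<ge> 1" and M_pos: "M \<ge> 1" and k_coprime: "Rings.coprime k (int M)"
    and k_ord: "ord (int M) k = N"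
    and K_field: "number_field K"
    and hom: "\<phi> \<in> hom (metacyclic N M k) (GL K n)"
    and inj: "inj_on \<phi> (carrier (metacyclic N M k))"
    and irred: "absolutely_irreducible K n (metacyclic N M k) \<phi>"
    and fod: "is_the_field_of_definition K n (metacyclic N M k) \<phi>"
begin

abbreviation "H \<equiv> metacyclic N M k"
abbreviation "cls \<equiv> word_class (metacyclic_relators N M k)"

text \<open>A natural representative of k modulo M; the summand M makes it positive even when M =
  1.\<close>

definition k' where "k' = nat (k mod int M) + M"
definition A where "A = \<phi> (gen_class N M k Gen_a)"
definition B where "B = \<phi> (gen_class N M k Gen_b)"

lemma k'_cong: "[int k' = k] (mod int M)"
  using M_pos by (simp add: k'_def cong_def)

lemma k'_pos: "k' > 0" using M_pos by (simp add: k'_def)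

lemma k'_coprime: "Rings.coprime k' M"
proof -
  have "Rings.coprime (int k') (int M)"
    using k_coprime k'_cong by (metis cong_imp_coprime cong_sym)
  then show ?thesis by simp
qed

lemma K_subfield: "subfield K class_ring" using K_field by (simp add: number_field_def)

lemma cls_carrier: "cls u \<in> carrier H"
  by (simp add: metacyclic_carrier)

lemma phi_GL: "h \<in> carrier H \<Longrightarrow> \<phi> h \<in> carrier (GL K n)"
  using hom by (auto simp: hom_def)

lemma phi_carrier: "h \<in> carrier H \<Longrightarrow> \<phi> h \<in> carrier_mat n n"
  using phi_GL GL_carrierD(1) by blast

lemma phi_K: "h \<in> carrier H \<Longrightarrow> i < n \<Longrightarrow> j < n \<Longrightarrow> \<phi> h $$ (i, j) \<in> K"
  using phi_GL GL_carrierD(2) by blast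

lemma phi_mult: "x \<in> carrier H \<Longrightarrow> y \<in> carrier H \<Longrightarrow> \<phi> (x \<otimes>\<^bsub>H\<^esub> y) = \<phi> x * \<phi> y"
  using hom_mult[OF hom] by (simp add: GL_mult)

lemma phi_append: "\<phi> (cls (u @ w)) = \<phi> (cls u) * \<phi> (cls w)"
  using phi_mult[OF cls_carrier cls_carrier, of u w] by (simp add: metacyclic_mult)

text \<open>An invertible idempotent matrix is the identity.\<close>

lemma phi_Nil: "\<phi> (cls []) = 1\<^sub>m n"
proof -
  let ?I = "\<phi> (cls [])"
  have I: "?I \<in> carrier_mat n n" by (rule phi_carrier[OF cls_carrier])
  obtain Y where Y: "Y \<in> carrier_mat n n" "Y * ?I = 1\<^sub>m n"
    using GL_carrierD(3)[OF phi_GL[OF cls_carrier]] by blast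
  have "?I = (Y * ?I) * ?I" using Y(2) I by simp
  also have "\<dots> = Y * (?I * ?I)" by (rule assoc_mult_mat[OF Y(1) I I])
  also have "?I * ?I = ?I" using phi_append[of "[]" "[]"] by simp
  finally show ?thesis unfolding Y(2) .
qed

lemma A_carrier: "A \<in> carrier_mat n n" and B_carrier: "B \<in> carrier_mat n n"
  by (auto simp: A_def B_def intro: phi_carrier cls_carrier)

lemma phi_cong: "word_eq (metacyclic_relators N M k) u w \<Longrightarrow> \<phi> (cls u) = \<phi> (cls w)"
  by (simp flip: word_class_eq_iff)

lemma phi_replicate: "\<phi> (cls (replicate i (g, True))) = \<phi> (gen_class N M k g) ^\<^sub>m i"
proof (induction i)
  case 0
  show ?case using phi_carrier[OF cls_carrier, of "[(g, True)]"] by (simp add: phi_Nil)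
next
  case (Suc i)
  have "replicate (Suc i) (g, True) = replicate i (g, True) @ [(g, True)]"
    by (simp add: replicate_append_same)
  then show ?case using Suc phi_append by (simp del: replicate_Suc)
qed

lemma A_M: "A ^\<^sub>m M = 1\<^sub>m n" and B_N: "B ^\<^sub>m N = 1\<^sub>m n"
  unfolding A_def B_def phi_replicate[symmetric]
  using phi_cong[OF metacyclic_relations(1)] phi_cong[OF metacyclic_relations(2)] phi_Nil by auto

lemma B_A: "B * A = A ^\<^sub>m k' * B"
proof -
  let ?B' = "\<phi> (cls [(Gen_b, False)])" and ?E = "\<phi> (cls (word_pow Gen_a (- k)))"
  have c: "?B' \<in> carrier_mat n n" "?E \<in> carrier_mat n n" "A ^\<^sub>m k' \<in> carrier_mat n n"
    using A_carrier by (auto intro: phi_carrier cls_carrier)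
  have 1: "B * (A * (?B' * ?E)) = 1\<^sub>m n"
    using phi_cong[OF metacyclic_relations(3)] unfolding phi_append phi_Nil A_def B_def .
  have "word_eq (metacyclic_relators N M k) [(Gen_b, False), (Gen_b, True)] []"
    using word_eq.cancel[of _ Gen_b False] by simp
  then have 2: "?B' * B = 1\<^sub>m n"
    using phi_append[of "[(Gen_b, False)]" "[(Gen_b, True)]"] phi_cong phi_Nil by (simp add: B_def)
  have 3: "?E * A ^\<^sub>m k' = 1\<^sub>m n"
    using phi_cong[OF word_pow_neg_cancel[OF M_pos metacyclic_relations(1) k'_cong]]
    unfolding phi_append phi_Nil phi_replicate A_def .
  \<comment> \<open>The identity is inserted as B^(-1) A^(-k) A^k' B; regrouping exposes the third
    relator.\<close>
  have "B * A = B * A * (?B' * ((?E * A ^\<^sub>m k') * B))"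
    using A_carrier B_carrier by (simp add: 2 3)
  also have "\<dots> = (B * (A * (?B' * ?E))) * (A ^\<^sub>m k' * B)"
  proof -
    note m = mult_carrier_mat[of _ n n _ n]
    have c4: "A ^\<^sub>m k' * B \<in> carrier_mat n n" "?B' * ?E \<in> carrier_mat n n" "A * (?B' * ?E) \<in> carrier_mat n n"
      using A_carrier B_carrier c by (auto intro!: m)
    have "B * A * (?B' * ((?E * A ^\<^sub>m k') * B)) = B * A * (?B' * (?E * (A ^\<^sub>m k' * B)))"
      by (simp only: assoc_mult_mat[OF c(2,3) B_carrier])
    also have "\<dots> = B * A * ((?B' * ?E) * (A ^\<^sub>m k' * B))"
      by (simp only: assoc_mult_mat[OF c(1,2) c4(1)])
    also have "\<dots> = B * (A * ((?B' * ?E) * (A ^\<^sub>m k' * B)))"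
      by (rule assoc_mult_mat[OF B_carrier A_carrier m[OF c4(2,1)]])
    also have "\<dots> = B * ((A * (?B' * ?E)) * (A ^\<^sub>m k' * B))"
      by (simp only: assoc_mult_mat[OF A_carrier c4(2,1)])
    also have "\<dots> = (B * (A * (?B' * ?E))) * (A ^\<^sub>m k' * B)"
      by (simp only: assoc_mult_mat[OF B_carrier c4(3,1)])
    finally show ?thesis .
  qed
  finally show ?thesis using A_carrier B_carrier c by (simp add: 1)
qed

definition \<alpha> where "\<alpha> = (*\<^sub>v) A"
definition \<beta> where "\<beta> = (*\<^sub>v) B"

lemma alpha_carrier: "x \<in> carrier_vec n \<Longrightarrow> (\<alpha> ^^ i) x \<in> carrier_vec n"
  using A_carrier by (induction i) (auto simp: \<alpha>_def)

lemma beta_carrier: "x \<in> carrier_vec n \<Longrightarrow> (\<beta> ^^ i) x \<in> carrier_vec n"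
  using B_carrier by (induction i) (auto simp: \<beta>_def)

lemma alpha_M: "x \<in> carrier_vec n \<Longrightarrow> (\<alpha> ^^ M) x = x"
  using pow_mat_mult_vec[OF A_carrier, of x M] by (simp add: A_M \<alpha>_def)

lemma beta_N: "x \<in> carrier_vec n \<Longrightarrow> (\<beta> ^^ N) x = x"
  using pow_mat_mult_vec[OF B_carrier, of x N] by (simp add: B_N \<beta>_def)

lemma beta_alpha: "x \<in> carrier_vec n \<Longrightarrow> \<beta> (\<alpha> x) = (\<alpha> ^^ k') (\<beta> x)"
proof -
  assume x: "x \<in> carrier_vec n"
  have "\<beta> (\<alpha> x) = (B * A) *\<^sub>v x"
    using x A_carrier B_carrier by (simp add: \<alpha>_def \<beta>_def)
  also have "\<dots> = A ^\<^sub>m k' *\<^sub>v (B *\<^sub>v x)"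
    unfolding B_A using x A_carrier B_carrier by (simp add: assoc_mult_mat_vec[of _ n n _ n])
  also have "\<dots> = (\<alpha> ^^ k') (\<beta> x)"
    using x B_carrier pow_mat_mult_vec[OF A_carrier] by (simp add: \<alpha>_def \<beta>_def)
  finally show ?thesis .
qed

lemma beta_alpha_pow: "x \<in> carrier_vec n \<Longrightarrow> \<beta> ((\<alpha> ^^ i) x) = (\<alpha> ^^ (k' * i)) (\<beta> x)"
proof (induction i)
  case (Suc i)
  have "\<beta> ((\<alpha> ^^ Suc i) x) = (\<alpha> ^^ k') (\<beta> ((\<alpha> ^^ i) x))"
    using beta_alpha alpha_carrier Suc by simp
  then show ?case using Suc by (simp add: funpow_add)
qed simp

lemma beta_pow_alpha: "x \<in> carrier_vec n \<Longrightarrow> (\<beta> ^^ j) (\<alpha> x) = (\<alpha> ^^ (k' ^ j)) ((\<beta> ^^ j) x)"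
proof (induction j)
  case (Suc j)
  have "(\<beta> ^^ Suc j) (\<alpha> x) = \<beta> ((\<alpha> ^^ (k' ^ j)) ((\<beta> ^^ j) x))" using Suc by simp
  also have "\<dots> = (\<alpha> ^^ (k' * k' ^ j)) (\<beta> ((\<beta> ^^ j) x))"
    using Suc.prems by (intro beta_alpha_pow beta_carrier)
  finally show ?case by simp
qed simp

lemma phi_closed:
  assumes Y: "Y \<subseteq> carrier_vec n" "\<And>y. y \<in> Y \<Longrightarrow> \<alpha> y \<in> Y" "\<And>y. y \<in> Y \<Longrightarrow> \<beta> y \<in> Y"
    and h: "h \<in> carrier H" and y: "y \<in> Y"
  shows "\<phi> h *\<^sub>v y \<in> Y"
proof -
  have "\<forall>y\<in>Y. \<phi> h *\<^sub>v y \<in> Y"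
    using h N_pos M_pos
  proof (rule metacyclic_induct)
    show "\<forall>y\<in>Y. \<phi> \<one>\<^bsub>H\<^esub> *\<^sub>v y \<in> Y"
      using Y(1) by (auto simp: metacyclic_one phi_Nil)
    show "\<forall>y\<in>Y. \<phi> (gen_class N M k Gen_a) *\<^sub>v y \<in> Y" using Y(2) by (simp add: \<alpha>_def A_def)
    show "\<forall>y\<in>Y. \<phi> (gen_class N M k Gen_b) *\<^sub>v y \<in> Y" using Y(3) by (simp add: \<beta>_def B_def)
    fix g g' assume *: "g \<in> carrier H" "g' \<in> carrier H" "\<forall>y\<in>Y. \<phi> g *\<^sub>v y \<in> Y" "\<forall>y\<in>Y. \<phi> g' *\<^sub>v y \<in> Y"
    have "\<phi> (g \<otimes>\<^bsub>H\<^esub> g') *\<^sub>v y = \<phi> g *\<^sub>v (\<phi> g' *\<^sub>v y)" if "y \<in> Y" for y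
      unfolding phi_mult[OF *(1,2)]
      using phi_carrier[OF *(1)] phi_carrier[OF *(2)] that Y(1) by (intro assoc_mult_mat_vec) auto
    then show "\<forall>y\<in>Y. \<phi> (g \<otimes>\<^bsub>H\<^esub> g') *\<^sub>v y \<in> Y" using * by simp
  qed
  then show ?thesis using y by blast
qed

lemma irreducible:
  assumes E: "subfield E class_ring" "K \<subseteq> E"
    and W: "W \<subseteq> {x\<in>carrier_vec n. \<forall>i<n. x $ i \<in> E}" "0\<^sub>v n \<in> W"
      "\<And>x y. x \<in> W \<Longrightarrow> y \<in> W \<Longrightarrow> x + y \<in> W" "\<And>c x. c \<in> E \<Longrightarrow> x \<in> W \<Longrightarrow> c \<cdot>\<^sub>v x \<in> W"
      "\<And>x. x \<in> W \<Longrightarrow> \<alpha> x \<in> W" "\<And>x. x \<in> W \<Longrightarrow> \<beta> x \<in> W"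
  shows "W = {0\<^sub>v n} \<or> W = {x\<in>carrier_vec n. \<forall>i<n. x $ i \<in> E}"
proof -
  have eq: "{w \<in> carrier_vec n. set\<^sub>v w \<subseteq> E} = {x\<in>carrier_vec n. \<forall>i<n. x $ i \<in> E}"
    by (auto simp: vec_set_def)
  have "irreducible_over E n H \<phi>" using irred E by (simp add: absolutely_irreducible_def)
  moreover have "is_subspace E n W" unfolding is_subspace_def eq using W by blast
  moreover have "\<forall>h\<in>carrier H. \<forall>w\<in>W. \<phi> h *\<^sub>v w \<in> W"
    using phi_closed[of W] W by blast
  ultimately show ?thesis unfolding irreducible_over_def eq by blast
qed

lemma n_pos: "n > 0"
  using irred K_subfield by (auto simp: absolutely_irreducible_def irreducible_over_def)

lemma UNIV_subfield: "subfield (UNIV :: complex set) class_ring"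
  using field.carrier_is_subfield[OF class_field] by simp

text \<open>An eigenvector of the transpose: as a functional it turns the action of A into
  multiplication by a scalar.\<close>

lemma ex_left_eigenvector:
  "\<exists>w z. w \<in> carrier_vec n \<and> w \<noteq> 0\<^sub>v n \<and> (\<forall>x\<in>carrier_vec n. w \<bullet> \<alpha> x = z * (w \<bullet> x))"
proof -
  have At: "transpose_mat A \<in> carrier_mat n n" using A_carrier by simp
  obtain z where "z \<in> spectrum (transpose_mat A)"
    using spectrum_non_empty[OF At n_pos] by blast
  then obtain w where "eigenvector (transpose_mat A) w z"
    by (auto simp: spectrum_def eigenvalue_def)
  then have w: "w \<in> carrier_vec n" "w \<noteq> 0\<^sub>v n" "transpose_mat A *\<^sub>v w = z \<cdot>\<^sub>v w"
    using A_carrier by (auto simp: eigenvector_def)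
  have "w \<bullet> \<alpha> x = z * (w \<bullet> x)" if "x \<in> carrier_vec n" for x
    using transpose_vec_mult_scalar[OF A_carrier that w(1)] w that by (simp add: \<alpha>_def)
  then show ?thesis using w by blast
qed

end

section \<open>Eigenfunctionals of A, the character, and the fixed field\<close>

locale metacyclic_eigen = metacyclic_rep +
  fixes w :: "complex vec" and z :: complex
  assumes w_carrier: "w \<in> carrier_vec n" and w_nz: "w \<noteq> 0\<^sub>v n"
    and eigen: "x \<in> carrier_vec n \<Longrightarrow> w \<bullet> \<alpha> x = z * (w \<bullet> x)"
begin

text \<open>Composing the eigenfunctional with powers of B yields eigenfunctionals of A for the
  conjugate eigenvalues, see \<open>Th_alpha\<close>.\<close>

definition Th where "Th j x = w \<bullet> (\<beta> ^^ j) x"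

lemma beta_add: "x \<in> carrier_vec n \<Longrightarrow> y \<in> carrier_vec n \<Longrightarrow> (\<beta> ^^ j) (x + y) = (\<beta> ^^ j) x + (\<beta> ^^ j) y"
proof (induction j)
  case (Suc j)
  then show ?case using B_carrier beta_carrier[OF Suc.prems(1), of j] beta_carrier[OF Suc.prems(2), of j]
    by (simp add: \<beta>_def[symmetric]) (simp add: \<beta>_def mult_add_distrib_mat_vec[of _ n n])
qed simp

lemma beta_smult: "x \<in> carrier_vec n \<Longrightarrow> (\<beta> ^^ j) (c \<cdot>\<^sub>v x) = c \<cdot>\<^sub>v (\<beta> ^^ j) x"
proof (induction j)
  case (Suc j)
  then show ?case using B_carrier beta_carrier[OF Suc.prems(1), of j]
    by (simp add: \<beta>_def[symmetric]) (simp add: \<beta>_def mult_mat_vec[of _ n n])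
qed simp

lemma Th_add: "x \<in> carrier_vec n \<Longrightarrow> y \<in> carrier_vec n \<Longrightarrow> Th j (x + y) = Th j x + Th j y"
  unfolding Th_def using w_carrier beta_carrier by (simp add: beta_add scalar_prod_add_distrib[of _ n])

lemma Th_smult: "x \<in> carrier_vec n \<Longrightarrow> Th j (c \<cdot>\<^sub>v x) = c * Th j x"
  unfolding Th_def using w_carrier beta_carrier by (simp add: beta_smult scalar_prod_smult_distrib[of _ n])

lemma Th_zero: "Th j (0\<^sub>v n) = 0"
proof -
  have "0 \<cdot>\<^sub>v 0\<^sub>v n = (0\<^sub>v n :: complex vec)" by auto
  then show ?thesis using Th_smult[of "0\<^sub>v n" j 0] by simp
qed

lemma Th_sum:
  fixes m :: nat
  assumes "\<And>i. i < m \<Longrightarrow> b i \<in> carrier_vec n"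
  shows "Th j (vec n (\<lambda>r. \<Sum>i<m. c i * b i $ r)) = (\<Sum>i<m. c i * Th j (b i))"
  using assms
proof (induction m)
  case 0
  have "vec n (\<lambda>r. 0 :: complex) = 0\<^sub>v n" by auto
  then show ?case using Th_zero by simp
next
  case (Suc m)
  have b: "b m \<in> carrier_vec n" using Suc.prems by simp
  have "vec n (\<lambda>r. \<Sum>i<Suc m. c i * b i $ r) = vec n (\<lambda>r. \<Sum>i<m. c i * b i $ r) + c m \<cdot>\<^sub>v b m"
    using b by (intro eq_vecI) auto
  then show ?case using Suc b by (simp add: Th_add Th_smult)
qed

lemma Th_unit: "x \<in> carrier_vec n \<Longrightarrow> Th j x = (\<Sum>r<n. x $ r * Th j (unit_vec n r))"
proof -
  assume x: "x \<in> carrier_vec n"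
  have "x = vec n (\<lambda>r. \<Sum>i<n. x $ i * unit_vec n i $ r)"
    using x by (intro eq_vecI) (auto simp: unit_vec_def if_distrib cong: if_cong)
  then have "Th j x = Th j (vec n (\<lambda>r. \<Sum>i<n. x $ i * unit_vec n i $ r))" by simp
  also have "\<dots> = (\<Sum>r<n. x $ r * Th j (unit_vec n r))" by (rule Th_sum) simp
  finally show ?thesis .
qed

lemma Th_beta_pow: "Th j ((\<beta> ^^ i) x) = Th (j + i) x"
  by (simp add: Th_def funpow_add)

lemma Th_beta: "Th j (\<beta> x) = Th (Suc j) x"
  using Th_beta_pow[of j 1 x] by simp

lemma Th_N: "x \<in> carrier_vec n \<Longrightarrow> Th (j + N) x = Th j x"
  by (simp add: Th_def funpow_add beta_N)

lemma Th_mod: "x \<in> carrier_vec n \<Longrightarrow> Th (j mod N) x = Th j x"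
proof -
  assume x: "x \<in> carrier_vec n"
  have "Th (j mod N + N * q) x = Th (j mod N) x" for q
  proof (induction q)
    case (Suc q)
    then show ?case using Th_N[OF x, of "j mod N + N * q"] by (simp add: add_ac)
  qed simp
  from this[of "j div N"] show ?thesis by simp
qed

lemma eigen_pow: "x \<in> carrier_vec n \<Longrightarrow> w \<bullet> (\<alpha> ^^ i) x = z ^ i * (w \<bullet> x)"
  by (induction i) (auto simp: eigen alpha_carrier)

lemma Th_alpha: "x \<in> carrier_vec n \<Longrightarrow> Th j (\<alpha> x) = z ^ (k' ^ j) * Th j x"
  by (simp add: Th_def beta_pow_alpha eigen_pow beta_carrier)

lemma Th_alpha_pow: "x \<in> carrier_vec n \<Longrightarrow> Th j ((\<alpha> ^^ i) x) = (z ^ (k' ^ j)) ^ i * Th j x"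
  by (induction i) (auto simp: Th_alpha alpha_carrier)

lemma ex_Th_0: "\<exists>r<n. Th 0 (unit_vec n r) \<noteq> 0"
proof (rule ccontr)
  assume "\<not> ?thesis"
  then have "w $ r = 0" if "r < n" for r using that w_carrier by (auto simp: Th_def)
  then have "w = 0\<^sub>v n" using w_carrier by (intro eq_vecI) auto
  with w_nz show False by simp
qed

text \<open>The common kernel of all \<open>Th j\<close> is invariant over the complex numbers and
  is not everything, because w is nonzero; absolute irreducibility makes it zero.\<close>

lemma Th_eq_0:
  assumes x: "x \<in> carrier_vec n" and Th: "\<And>j. j < N \<Longrightarrow> Th j x = 0"
  shows "x = 0\<^sub>v n"
proof -
  define W where "W = {x\<in>carrier_vec n. \<forall>j. Th j x = 0}"
  have "W = {0\<^sub>v n} \<or> W = {x\<in>carrier_vec n. \<forall>i<n. x $ i \<in> UNIV}"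
    by (rule irreducible[OF UNIV_subfield])
      (auto simp: W_def Th_zero Th_add Th_smult Th_alpha Th_beta alpha_carrier[of _ 1, simplified] beta_carrier[of _ 1, simplified])
  moreover have "W \<noteq> {x\<in>carrier_vec n. \<forall>i<n. x $ i \<in> UNIV}" using ex_Th_0 by (auto simp: W_def)
  moreover have "Th j x = 0" for j
    using Th_mod[OF x, of j] Th[of "j mod N"] N_pos by simp
  then have "x \<in> W" using x by (simp add: W_def)
  ultimately show ?thesis by blast
qed

lemma k_powers: "[k' ^ N = 1] (mod M)" "0 < i \<Longrightarrow> i < N \<Longrightarrow> \<not> [k' ^ i = 1] (mod M)" "[k ^ N = 1] (mod int M)"
proof -
  have iff: "[k' ^ i = 1] (mod M) \<longleftrightarrow> [k ^ i = 1] (mod int M)" for i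
  proof -
    have "[k' ^ i = 1] (mod M) \<longleftrightarrow> [int k' ^ i = 1] (mod int M)"
      using cong_int_iff[of "k' ^ i" 1 M] by simp
    also have "\<dots> \<longleftrightarrow> [k ^ i = 1] (mod int M)"
      using cong_pow[OF k'_cong, of i] cong_trans cong_sym by blast
    finally show ?thesis .
  qed
  define P where "P d \<longleftrightarrow> d > 0 \<and> [k ^ d = 1] (mod int M)" for d
  have N: "N = (LEAST d. P d)"
    using k_ord k_coprime unfolding ord_def P_def by (simp add: coprime_commute)
  have "[k' ^ totient M = 1] (mod M)" using k'_coprime by (rule euler_theorem)
  then have "P (totient M)" using iff M_pos by (simp add: P_def)
  then have "P N" unfolding N by (rule LeastI)
  then show "[k ^ N = 1] (mod int M)" "[k' ^ N = 1] (mod M)" using iff by (auto simp: P_def)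
  show "\<not> [k' ^ i = 1] (mod M)" if "0 < i" "i < N"
  proof -
    have "\<not> P i" using that(2) unfolding N by (rule not_less_Least)
    then show ?thesis using iff[of i] that(1) by (simp add: P_def)
  qed
qed

lemma z_root: "z ^ M = 1"
proof -
  obtain r where r: "r < n" "Th 0 (unit_vec n r) \<noteq> 0" using ex_Th_0 by blast
  have "z ^ M * (w \<bullet> unit_vec n r) = w \<bullet> unit_vec n r"
    using eigen_pow[of "unit_vec n r" M] by (simp add: alpha_M)
  then show ?thesis using r by (simp add: Th_def)
qed

text \<open>If z^d = 1, the conjugate eigenvalues have d-th power 1 as well, so every
  \<open>Th j\<close> vanishes on A^d x - x, and A^d is the identity. Faithfulness moves this into
  the group, where the affine model shows that M divides d.\<close>

lemma z_primitive: "0 < d \<Longrightarrow> d < M \<Longrightarrow> z ^ d \<noteq> 1"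
proof
  assume d: "0 < d" "d < M" "z ^ d = 1"
  have "A ^\<^sub>m d *\<^sub>v x = 1\<^sub>m n *\<^sub>v x" if x: "x \<in> carrier_vec n" for x
  proof -
    define y where "y = (\<alpha> ^^ d) x + (-1) \<cdot>\<^sub>v x"
    have y: "y \<in> carrier_vec n" using x alpha_carrier by (simp add: y_def)
    have "Th j y = 0" for j
    proof -
      have "(z ^ (k' ^ j)) ^ d = (z ^ d) ^ (k' ^ j)" by (simp add: mult.commute flip: power_mult)
      then show ?thesis using x alpha_carrier d(3) by (simp add: y_def Th_add Th_smult Th_alpha_pow)
    qed
    then have "y = 0\<^sub>v n" by (intro Th_eq_0 y)
    have "(\<alpha> ^^ d) x = y + x" using x alpha_carrier[OF x, of d] by (intro eq_vecI) (auto simp: y_def)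
    then have "(\<alpha> ^^ d) x = x" using x \<open>y = 0\<^sub>v n\<close> by simp
    then show ?thesis using pow_mat_mult_vec[OF A_carrier x, of d] x by (simp add: \<alpha>_def)
  qed
  then have "A ^\<^sub>m d = 1\<^sub>m n" using A_carrier by (intro mat_eq_mult_vecI) auto
  then have "\<phi> (cls (replicate d (Gen_a, True))) = \<phi> (cls [])"
    by (simp add: phi_replicate phi_Nil flip: A_def)
  then have "cls (replicate d (Gen_a, True)) = cls []"
    using inj cls_carrier by (meson inj_onD)
  then have "M dvd d"
    using metacyclic_order_a[OF k_coprime k_powers(3)] by (simp add: word_class_eq_iff)
  then show False using d by (auto dest: dvd_imp_le)
qed

sublocale C: cyclic_galois z M k' N
  by unfold_locales (use M_pos N_pos z_root z_primitive k'_pos k'_coprime k_powers in auto)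

abbreviation "zc \<equiv> \<lambda>j. z ^ (k' ^ j)"

text \<open>A polynomial that vanishes at all conjugates of z except the one with index j0 isolates
  the coefficient c j0.\<close>

lemma vandermonde:
  assumes c: "\<And>i. (\<Sum>j<N. zc j ^ i * c j) = 0" and j: "j0 < N"
  shows "c j0 = (0::complex)"
proof -
  define g where "g = (\<Prod>j\<in>{..<N} - {j0}. [:- zc j, 1:])"
  have "(\<Sum>j<N. poly g (zc j) * c j) = (\<Sum>j<N. \<Sum>i\<le>degree g. coeff g i * (zc j ^ i * c j))"
    by (simp add: poly_altdef sum_distrib_right mult.assoc)
  also have "\<dots> = (\<Sum>i\<le>degree g. coeff g i * (\<Sum>j<N. zc j ^ i * c j))"
    by (subst sum.swap) (simp add: sum_distrib_left)
  also have "\<dots> = 0" using c by simp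
  finally have 0: "(\<Sum>j<N. poly g (zc j) * c j) = 0" .
  have "(\<Sum>j<N. poly g (zc j) * c j) = (\<Sum>j<N. if j = j0 then poly g (zc j0) * c j0 else 0)"
    by (rule sum.cong) (auto simp: g_def poly_prod)
  also have "\<dots> = poly g (zc j0) * c j0" using j by simp
  finally have "poly g (zc j0) * c j0 = 0" using 0 by simp
  moreover have "poly g (zc j0) \<noteq> 0"
    using C.conj_inj[of _ j0] j by (auto simp: g_def poly_prod)
  ultimately show ?thesis by simp
qed

text \<open>A polynomial in A that vanishes at all conjugates except z itself, applied to a vector
  on which \<open>Th 0\<close> is nonzero, leaves after scaling a vector dual to
  \<open>Th 0\<close>. Powers of B carry it to the other indices.\<close>

lemma ex_dual_basis:
  "\<exists>v. \<forall>j<N. v j \<in> carrier_vec n \<and> (\<forall>i<N. Th i (v j) = (if i = j then 1 else 0))"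
proof -
  obtain r where r: "r < n" "Th 0 (unit_vec n r) \<noteq> 0" using ex_Th_0 by blast
  define x :: "complex vec" where "x = unit_vec n r"
  have x: "x \<in> carrier_vec n" by (simp add: x_def)
  define g where "g = (\<Prod>j\<in>{..<N} - {0}. [:- zc j, 1:])"
  have g0: "poly g (zc 0) \<noteq> 0"
    using C.conj_inj[of 0] N_pos by (auto simp: g_def poly_prod)
  have gj: "poly g (zc j) = 0" if "0 < j" "j < N" for j
    using that by (auto simp: g_def poly_prod)
  define c where "c = poly g (zc 0) * Th 0 x"
  have c: "c \<noteq> 0" using g0 r by (simp add: c_def x_def)
  define y where "y = vec n (\<lambda>s. \<Sum>i<Suc (degree g). (coeff g i / c) * ((\<alpha> ^^ i) x) $ s)"
  have y: "y \<in> carrier_vec n" by (simp add: y_def)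
  have Thy: "Th j y = poly g (zc j) * Th j x / c" for j
  proof -
    have "Th j y = (\<Sum>i<Suc (degree g). (coeff g i / c) * Th j ((\<alpha> ^^ i) x))"
      unfolding y_def by (intro Th_sum alpha_carrier x)
    also have "\<dots> = (\<Sum>i\<le>degree g. coeff g i * zc j ^ i * Th j x / c)"
      unfolding lessThan_Suc_atMost by (intro sum.cong) (auto simp: Th_alpha_pow x)
    also have "\<dots> = poly g (zc j) * Th j x / c"
      by (simp add: poly_altdef sum_distrib_right sum_divide_distrib)
    finally show ?thesis .
  qed
  have Thy_mod: "Th j y = (if N dvd j then 1 else 0)" for j
  proof (cases "N dvd j")
    case True
    then have "Th j y = Th 0 y" using Th_mod[OF y, of j] by simp
    then show ?thesis using True c by (simp add: Thy c_def)
  next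
    case False
    then have "0 < j mod N" "j mod N < N" using N_pos by (auto simp: mod_greater_zero_iff_not_dvd)
    then have "Th (j mod N) y = 0" unfolding Thy using gj by simp
    then show ?thesis using False Th_mod[OF y, of j] by simp
  qed
  \<comment> \<open>The exponent N - j plays the role of -j, since the N-th iterate of \<beta> is
    the identity on vectors of length n.\<close>
  have "Th i ((\<beta> ^^ (N - j)) y) = (if i = j then 1 else 0)" if "i < N" "j < N" for i j
  proof -
    have "N dvd i + (N - j) \<longleftrightarrow> i = j"
    proof
      assume "N dvd i + (N - j)"
      then obtain q where q: "i + (N - j) = N * q" ..
      then have "0 < N * q" "N * q < N * 2" using that by linarith+
      then have "q = 1" by auto
      then show "i = j" using q that by simp
    qed (use that in simp)
    then show ?thesis by (simp add: Th_beta_pow Thy_mod)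
  qed
  then show ?thesis using y beta_carrier by (intro exI[of _ "\<lambda>j. (\<beta> ^^ (N - j)) y"]) blast
qed

definition dual where
  "dual = (SOME v. \<forall>j<N. v j \<in> carrier_vec n \<and> (\<forall>i<N. Th i (v j) = (if i = j then 1 else 0)))"

lemma dual: "j < N \<Longrightarrow> dual j \<in> carrier_vec n"
  "j < N \<Longrightarrow> i < N \<Longrightarrow> Th i (dual j) = (if i = j then 1 else 0)"
  using someI_ex[OF ex_dual_basis] unfolding dual_def by blast+

lemma dual_expand:
  assumes x: "x \<in> carrier_vec n"
  shows "x = vec n (\<lambda>r. \<Sum>j<N. Th j x * dual j $ r)" (is "x = ?y")
proof -
  have "Th i (x + (-1) \<cdot>\<^sub>v ?y) = 0" if i: "i < N" for i
  proof -
    have "Th i ?y = (\<Sum>j<N. Th j x * Th i (dual j))" by (intro Th_sum dual)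
    also have "\<dots> = (\<Sum>j<N. if i = j then Th j x else 0)" using i by (intro sum.cong) (auto simp: dual)
    also have "\<dots> = Th i x" using i by simp
    finally show ?thesis using x by (simp add: Th_add Th_smult)
  qed
  then have 0: "x + (-1) \<cdot>\<^sub>v ?y = 0\<^sub>v n" using x by (intro Th_eq_0) auto
  show ?thesis
  proof (rule eq_vecI)
    fix r assume "r < dim_vec ?y"
    then have r: "r < n" by simp
    have "(x + (-1) \<cdot>\<^sub>v ?y) $ r = 0" unfolding 0 using r by simp
    then show "x $ r = ?y $ r" using r x by simp
  qed (use x in simp)
qed

text \<open>Each unit vector is expanded in the vectors \<open>dual j\<close>, whose coordinate
  functionals are the \<open>Th j\<close>. Their number is not yet known to be n;
  \<open>n_eq_N\<close> deduces it by taking X to be the identity.\<close>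

lemma trace_eq:
  assumes X: "X \<in> carrier_mat n n"
  shows "(\<Sum>r<n. X $$ (r, r)) = (\<Sum>j<N. Th j (X *\<^sub>v dual j))"
proof -
  have 1: "X $$ (r, r) = (\<Sum>j<N. Th j (unit_vec n r) * (X *\<^sub>v dual j) $ r)" if r: "r < n" for r
  proof -
    have e: "unit_vec n r $ s = (\<Sum>j<N. Th j (unit_vec n r) * dual j $ s)" if "s < n" for s
      using arg_cong[OF dual_expand[of "unit_vec n r"], of "\<lambda>x. x $ s"] that by simp
    have "X $$ (r, r) = (\<Sum>s<n. X $$ (r, s) * unit_vec n r $ s)"
      using r by (simp add: unit_vec_def if_distrib cong: if_cong)
    also have "\<dots> = (\<Sum>s<n. \<Sum>j<N. Th j (unit_vec n r) * (X $$ (r, s) * dual j $ s))"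
      by (intro sum.cong) (auto simp: e sum_distrib_left mult_ac)
    also have "\<dots> = (\<Sum>j<N. \<Sum>s<n. Th j (unit_vec n r) * (X $$ (r, s) * dual j $ s))"
      by (rule sum.swap)
    also have "\<dots> = (\<Sum>j<N. Th j (unit_vec n r) * (X *\<^sub>v dual j) $ r)"
    proof (rule sum.cong)
      fix j assume "j \<in> {..<N}"
      then have "dual j \<in> carrier_vec n" by (simp add: dual)
      then show "(\<Sum>s<n. Th j (unit_vec n r) * (X $$ (r, s) * dual j $ s)) = Th j (unit_vec n r) * (X *\<^sub>v dual j) $ r"
        using X r by (simp add: scalar_prod_def atLeast0LessThan sum_distrib_left)
    qed simp
    finally show ?thesis .
  qed
  have "(\<Sum>r<n. X $$ (r, r)) = (\<Sum>r<n. \<Sum>j<N. Th j (unit_vec n r) * (X *\<^sub>v dual j) $ r)"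
    by (intro sum.cong) (auto simp: 1)
  also have "\<dots> = (\<Sum>j<N. \<Sum>r<n. (X *\<^sub>v dual j) $ r * Th j (unit_vec n r))"
    by (subst sum.swap) (simp add: mult.commute)
  also have "\<dots> = (\<Sum>j<N. Th j (X *\<^sub>v dual j))"
    using X by (intro sum.cong Th_unit[symmetric]) (auto simp: dual)
  finally show ?thesis .
qed

lemma n_eq_N: "n = N"
proof -
  have "of_nat n = (\<Sum>r<n. (1\<^sub>m n :: complex mat) $$ (r, r))" by simp
  also have "\<dots> = (\<Sum>j<N. Th j (1\<^sub>m n *\<^sub>v dual j))" by (rule trace_eq) simp
  also have "\<dots> = of_nat N" by (simp add: dual)
  finally show ?thesis by (simp only: of_nat_eq_iff)
qed

lemma beta_pow_alpha_pow:
  "x \<in> carrier_vec n \<Longrightarrow> (\<beta> ^^ j) ((\<alpha> ^^ i) x) = (\<alpha> ^^ (k' ^ j * i)) ((\<beta> ^^ j) x)"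
proof (induction i)
  case (Suc i)
  have "(\<beta> ^^ j) ((\<alpha> ^^ Suc i) x) = (\<alpha> ^^ (k' ^ j)) ((\<beta> ^^ j) ((\<alpha> ^^ i) x))"
    using Suc.prems by (simp add: beta_pow_alpha alpha_carrier)
  then show ?case using Suc by (simp add: funpow_add)
qed simp

lemma phi_normal_form:
  assumes h: "h \<in> carrier H"
  shows "\<exists>i j. \<forall>x\<in>carrier_vec n. \<phi> h *\<^sub>v x = (\<alpha> ^^ i) ((\<beta> ^^ j) x)"
  using h N_pos M_pos
proof (rule metacyclic_induct)
  show "\<exists>i j. \<forall>x\<in>carrier_vec n. \<phi> \<one>\<^bsub>H\<^esub> *\<^sub>v x = (\<alpha> ^^ i) ((\<beta> ^^ j) x)"
    by (intro exI[of _ 0]) (simp add: metacyclic_one phi_Nil)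
  show "\<exists>i j. \<forall>x\<in>carrier_vec n. \<phi> (gen_class N M k Gen_a) *\<^sub>v x = (\<alpha> ^^ i) ((\<beta> ^^ j) x)"
    by (intro exI[of _ 1] exI[of _ 0]) (simp add: \<alpha>_def A_def)
  show "\<exists>i j. \<forall>x\<in>carrier_vec n. \<phi> (gen_class N M k Gen_b) *\<^sub>v x = (\<alpha> ^^ i) ((\<beta> ^^ j) x)"
    by (intro exI[of _ 0] exI[of _ 1]) (simp add: \<beta>_def B_def)
  fix g g' assume g: "g \<in> carrier H" "g' \<in> carrier H"
    and "\<exists>i j. \<forall>x\<in>carrier_vec n. \<phi> g *\<^sub>v x = (\<alpha> ^^ i) ((\<beta> ^^ j) x)"
      "\<exists>i j. \<forall>x\<in>carrier_vec n. \<phi> g' *\<^sub>v x = (\<alpha> ^^ i) ((\<beta> ^^ j) x)"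
  then obtain i j i' j' where *: "\<And>x. x \<in> carrier_vec n \<Longrightarrow> \<phi> g *\<^sub>v x = (\<alpha> ^^ i) ((\<beta> ^^ j) x)"
    "\<And>x. x \<in> carrier_vec n \<Longrightarrow> \<phi> g' *\<^sub>v x = (\<alpha> ^^ i') ((\<beta> ^^ j') x)" by metis
  have "\<phi> (g \<otimes>\<^bsub>H\<^esub> g') *\<^sub>v x = (\<alpha> ^^ (i + k' ^ j * i')) ((\<beta> ^^ (j + j')) x)" if x: "x \<in> carrier_vec n" for x
  proof -
    have "\<phi> (g \<otimes>\<^bsub>H\<^esub> g') *\<^sub>v x = \<phi> g *\<^sub>v (\<phi> g' *\<^sub>v x)"
      unfolding phi_mult[OF g] using phi_carrier[OF g(1)] phi_carrier[OF g(2)] x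
      by (intro assoc_mult_mat_vec)
    also have "\<dots> = (\<alpha> ^^ i) ((\<beta> ^^ j) ((\<alpha> ^^ i') ((\<beta> ^^ j') x)))"
      using x by (simp add: * alpha_carrier beta_carrier)
    also have "\<dots> = (\<alpha> ^^ i) ((\<alpha> ^^ (k' ^ j * i')) ((\<beta> ^^ j) ((\<beta> ^^ j') x)))"
      using x by (simp add: beta_pow_alpha_pow beta_carrier)
    finally show ?thesis by (simp add: funpow_add)
  qed
  then show "\<exists>i j. \<forall>x\<in>carrier_vec n. \<phi> (g \<otimes>\<^bsub>H\<^esub> g') *\<^sub>v x = (\<alpha> ^^ i) ((\<beta> ^^ j) x)" by blast
qed

text \<open>Applying B b times moves the eigenlines of A by b places, so the diagonal is zero unless
  N divides b, and then it consists of the a-th powers of the conjugates of z.\<close>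

lemma character_eq:
  assumes h: "h \<in> carrier H" and ij: "\<And>x. x \<in> carrier_vec n \<Longrightarrow> \<phi> h *\<^sub>v x = (\<alpha> ^^ a) ((\<beta> ^^ b) x)"
  shows "character \<phi> h = (if N dvd b then \<Sum>j<N. zc j ^ a else 0)"
proof -
  have "character \<phi> h = (\<Sum>j<N. Th j (\<phi> h *\<^sub>v dual j))"
    using trace_eq[OF phi_carrier[OF h]] phi_carrier[OF h] by (simp add: character_def)
  also have "\<dots> = (\<Sum>j<N. if N dvd b then zc j ^ a else 0)"
  proof (rule sum.cong)
    fix j assume "j \<in> {..<N}"
    then have j: "j < N" by simp
    have v: "dual j \<in> carrier_vec n" by (rule dual(1)[OF j])
    have "Th j (\<phi> h *\<^sub>v dual j) = zc j ^ a * Th (j + b) (dual j)"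
      using v by (simp add: ij Th_alpha_pow beta_carrier Th_beta_pow)
    also have "Th (j + b) (dual j) = Th ((j + b) mod N) (dual j)" by (simp add: Th_mod[OF v])
    also have "\<dots> = (if (j + b) mod N = j then 1 else 0)" using j by (intro dual) auto
    also have "(j + b) mod N = j \<longleftrightarrow> N dvd b"
      using j by (metis add.right_neutral cong_add_lcancel_nat cong_def mod_0_imp_dvd mod_less mod_0 dvd_imp_mod_0)
    finally show "Th j (\<phi> h *\<^sub>v dual j) = (if N dvd b then zc j ^ a else 0)" by simp
  qed simp
  finally show ?thesis by simp
qed

lemma funpow_gal_pow: "(gal z k' ^^ j) (z ^ a) = zc j ^ a"
  using C.funpow_gal_eq[of 1 "z ^ a" "monom 1 a" j] by (simp add: ip_monom Polynomial.poly_monom)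

lemma power_sum_G_K: "(\<Sum>j<N. zc j ^ a) \<in> C.G.K"
  using C.G.sum_conj_K[OF C.pow_zfield, of a] by (simp add: funpow_gal_pow)

lemma K_subset: "K \<subseteq> C.G.K"
proof
  fix x assume "x \<in> K"
  then have "x \<in> generate_field class_ring (character \<phi> ` carrier H)"
    using fod by (simp add: is_the_field_of_definition_def character_field_def)
  then show "x \<in> C.G.K"
  proof (induction rule: generate_field.induct)
    case one
    then show ?case using C.G.K.one_in by (simp add: class_ring_simps)
  next
    case (incl y)
    then obtain h where h: "h \<in> carrier H" "y = character \<phi> h" by blast
    obtain i j where "\<forall>x\<in>carrier_vec n. \<phi> h *\<^sub>v x = (\<alpha> ^^ i) ((\<beta> ^^ j) x)"
      using phi_normal_form[OF h(1)] by blast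
    then have "y = (if N dvd j then \<Sum>t<N. zc t ^ i else 0)" unfolding h(2) by (intro character_eq h) blast
    then show ?case using power_sum_G_K C.G.K.zero_in by (auto split: if_splits)
  next
    case (a_inv y)
    then show ?case using C.G.K.minus_in by (simp add: class_ring_simps)
  next
    case (m_inv y)
    then have "inv\<^bsub>class_ring\<^esub> y = inverse y" by (intro inv_class_ring) simp
    then show ?case using C.G.K_inverse[OF m_inv.IH] by (simp only:)
  next
    case (eng_add y y')
    then show ?case using C.G.K.add_in by (simp add: class_ring_simps)
  next
    case (eng_mult y y')
    then show ?case using C.G.K.mult_in by (simp add: class_ring_simps)
  qed
qed

text \<open>A fixed element x with m x = f(z) satisfies N m x = the sum of f over the conjugates of
  z. This is an integer combination of power sums, which are the character values at powers of a.
  Conversely, every character value is such a power sum or 0.\<close>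

lemma K_eq: "C.G.K = K"
proof (intro equalityI K_subset subsetI)
  interpret K: csubring K using subfield_closed(1)[OF K_subfield] .
  fix x assume x: "x \<in> C.G.K"
  have ps: "(\<Sum>j<N. zc j ^ a) \<in> K" for a
  proof -
    have "\<phi> (cls (replicate a (Gen_a, True))) *\<^sub>v y = (\<alpha> ^^ a) ((\<beta> ^^ 0) y)" if "y \<in> carrier_vec n" for y
      using pow_mat_mult_vec[OF A_carrier that, of a] by (simp add: phi_replicate \<alpha>_def A_def)
    from character_eq[OF cls_carrier this]
    have "(\<Sum>j<N. zc j ^ a) = character \<phi> (cls (replicate a (Gen_a, True)))" by simp
    also have "\<dots> \<in> generate_field class_ring (character \<phi> ` carrier H)"
      by (intro generate_field.incl imageI cls_carrier)
    finally show ?thesis using fod by (simp add: is_the_field_of_definition_def character_field_def)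
  qed
  obtain m f where f: "m > 0" "of_nat m * x = ip f z" using C.zfieldE[OF C.G.K_L[OF x]] by metis
  have "(gal z k' ^^ j) x = x" for j using x by (induction j) (auto simp: C.G.K_def)
  then have "of_nat m * x = ip f (zc j)" for j using C.funpow_gal_eq[OF f, of j] by simp
  then have "(\<Sum>j<N. of_nat m * x) = (\<Sum>j<N. ip f (zc j))" by simp
  then have "of_nat N * of_nat m * x = (\<Sum>j<N. \<Sum>i\<le>degree f. of_int (coeff f i) * zc j ^ i)"
    by (simp add: poly_altdef coeff_map_poly degree_map_poly mult.assoc)
  also have "\<dots> = (\<Sum>i\<le>degree f. of_int (coeff f i) * (\<Sum>j<N. zc j ^ i))"
    by (subst sum.swap) (simp add: sum_distrib_left)
  also have "\<dots> \<in> K" by (intro K.sum_in K.mult_in K.of_int_in ps)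
  finally have "of_nat N * of_nat m * x \<in> K" .
  moreover have "inverse (of_nat N * of_nat m) \<in> K"
    by (intro subfield_closed(2)[OF K_subfield] K.mult_in K.of_nat_in)
  ultimately have "inverse (of_nat N * of_nat m) * (of_nat N * of_nat m * x) \<in> K" by (rule K.mult_in[rotated])
  then show "x \<in> K" using f(1) N_pos by (simp add: field_simps)
qed

section \<open>The K-rational vectors and their identification with L\<close>

definition KV where "KV = {x\<in>carrier_vec n. \<forall>i<n. x $ i \<in> K}"

sublocale K: csubring K using subfield_closed(1)[OF K_subfield] .

lemma KV_carrier: "x \<in> KV \<Longrightarrow> x \<in> carrier_vec n" by (simp add: KV_def)

lemma KV_add: "x \<in> KV \<Longrightarrow> y \<in> KV \<Longrightarrow> x + y \<in> KV"
  by (auto simp: KV_def K.add_in)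

lemma KV_smult: "c \<in> K \<Longrightarrow> x \<in> KV \<Longrightarrow> c \<cdot>\<^sub>v x \<in> KV"
  by (auto simp: KV_def K.mult_in)

lemma KV_mat: "X \<in> carrier_mat n n \<Longrightarrow> (\<And>i j. i < n \<Longrightarrow> j < n \<Longrightarrow> X $$ (i, j) \<in> K) \<Longrightarrow> x \<in> KV \<Longrightarrow> X *\<^sub>v x \<in> KV"
  by (auto simp: KV_def scalar_prod_def intro!: K.sum_in K.mult_in)

lemma A_K: "i < n \<Longrightarrow> j < n \<Longrightarrow> A $$ (i, j) \<in> K" and B_K: "i < n \<Longrightarrow> j < n \<Longrightarrow> B $$ (i, j) \<in> K"
  by (auto simp: A_def B_def intro: phi_K cls_carrier)

lemma KV_alpha: "x \<in> KV \<Longrightarrow> (\<alpha> ^^ i) x \<in> KV"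
  by (induction i) (auto simp: \<alpha>_def A_K intro!: KV_mat A_carrier)

lemma KV_beta: "x \<in> KV \<Longrightarrow> (\<beta> ^^ i) x \<in> KV"
  by (induction i) (auto simp: \<beta>_def B_K intro!: KV_mat B_carrier)

lemma KV_unit: "unit_vec n r \<in> KV"
  by (auto simp: KV_def unit_vec_def K.one_in K.zero_in)

lemma KV_sum: "(\<And>i. i < m \<Longrightarrow> c i \<in> K) \<Longrightarrow> (\<And>i. i < m \<Longrightarrow> b i \<in> KV) \<Longrightarrow>
    vec n (\<lambda>r. \<Sum>i<(m::nat). c i * b i $ r) \<in> KV"
  by (auto simp: KV_def intro!: K.sum_in K.mult_in)

text \<open>The sum over the B-orbit of a unit vector works unless the sum of all
  \<open>Th j\<close> vanishes identically. In that case, evaluating it at the vectors A^i x would,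
  by \<open>vandermonde\<close>, force \<open>Th 0\<close> to vanish.\<close>

lemma ex_invariant_vector: "\<exists>u\<in>KV. \<exists>t. t \<noteq> 0 \<and> (\<forall>j. Th j u = t)"
proof -
  have "\<exists>r<n. (\<Sum>j<N. Th j (unit_vec n r)) \<noteq> 0"
  proof (rule ccontr)
    assume "\<not> ?thesis"
    then have 0: "(\<Sum>j<N. Th j (unit_vec n r)) = 0" if "r < n" for r using that by blast
    have sum: "(\<Sum>j<N. Th j x) = 0" if x: "x \<in> carrier_vec n" for x
    proof -
      have "(\<Sum>j<N. Th j x) = (\<Sum>j<N. \<Sum>r<n. x $ r * Th j (unit_vec n r))"
        by (intro sum.cong Th_unit x) simp
      also have "\<dots> = (\<Sum>r<n. x $ r * (\<Sum>j<N. Th j (unit_vec n r)))"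
        by (subst sum.swap) (simp add: sum_distrib_left)
      also have "\<dots> = 0" using 0 by simp
      finally show ?thesis .
    qed
    obtain r where r: "r < n" "Th 0 (unit_vec n r) \<noteq> 0" using ex_Th_0 by blast
    have "(\<Sum>j<N. zc j ^ i * Th j (unit_vec n r)) = 0" for i
      using sum[OF alpha_carrier[of "unit_vec n r" i]] by (simp add: Th_alpha_pow)
    then have "Th 0 (unit_vec n r) = 0" using N_pos by (intro vandermonde[of "\<lambda>j. Th j (unit_vec n r)"]) auto
    with r show False by simp
  qed
  then obtain r where r: "r < n" "(\<Sum>j<N. Th j (unit_vec n r)) \<noteq> 0" by blast
  define x :: "complex vec" where "x = unit_vec n r"
  have x: "x \<in> carrier_vec n" by (simp add: x_def)
  define u where "u = vec n (\<lambda>s. \<Sum>j<N. 1 * ((\<beta> ^^ j) x) $ s)"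
  have "u \<in> KV" unfolding u_def x_def by (intro KV_sum K.one_in KV_beta KV_unit)
  moreover have "Th i u = (\<Sum>j<N. Th j x)" for i
  proof -
    have "Th i u = (\<Sum>j<N. Th (i + j) x)"
      unfolding u_def using Th_sum[of N "\<lambda>j. (\<beta> ^^ j) x" i "\<lambda>_. 1"] beta_carrier[OF x]
      by (simp add: Th_beta_pow)
    also have "\<dots> = (\<Sum>j<N. Th j x)"
    proof (induction i)
      case (Suc i)
      have "(\<Sum>j<N. Th (Suc i + j) x) + Th i x = (\<Sum>j<Suc N. Th (i + j) x)"
        by (subst sum.lessThan_Suc_shift) simp
      also have "\<dots> = (\<Sum>j<N. Th (i + j) x) + Th i x" by (simp add: Th_N[OF x])
      finally show ?case using Suc by simp
    qed simp
    finally show ?thesis .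
  qed
  ultimately show ?thesis using r(2) unfolding x_def by blast
qed

lemma funpow_gal_add:
  "x \<in> zfield z \<Longrightarrow> y \<in> zfield z \<Longrightarrow> (gal z k' ^^ j) (x + y) = (gal z k' ^^ j) x + (gal z k' ^^ j) y"
  by (induction j) (auto simp: C.gal_add C.G.funpow_L)

lemma funpow_gal_mult:
  "x \<in> zfield z \<Longrightarrow> y \<in> zfield z \<Longrightarrow> (gal z k' ^^ j) (x * y) = (gal z k' ^^ j) x * (gal z k' ^^ j) y"
  by (induction j) (auto simp: C.gal_mult C.G.funpow_L)

lemma funpow_gal_K: "x \<in> K \<Longrightarrow> (gal z k' ^^ j) x = x"
  unfolding K_eq[symmetric] by (induction j) (auto simp: C.G.K_def)

text \<open>Scaled so that a \<open>B\<close>-invariant vector of \<open>K\<^sup>n\<close> takes the value \<open>1\<close>, the left eigenvector \<open>w\<close>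
  identifies \<open>K\<^sup>n\<close> with the cyclotomic field.\<close>

lemma ex_basis:
  "\<exists>E. C.G.K_basis n E \<and> (\<forall>j<n. z * E j = (\<Sum>i<n. A $$ (i, j) * E i)) \<and>
    (\<forall>j<n. gal z k' (E j) = (\<Sum>i<n. B $$ (i, j) * E i))"
proof -
  obtain u t where u: "u \<in> KV" "t \<noteq> 0" "\<And>j. Th j u = t" using ex_invariant_vector by blast
  have uc: "u \<in> carrier_vec n" by (rule KV_carrier[OF u(1)])
  define T where "T j x = Th j x / t" for j x
  have T_add: "T j (x + y) = T j x + T j y" if "x \<in> carrier_vec n" "y \<in> carrier_vec n" for j x y
    using that by (simp add: T_def Th_add add_divide_distrib)
  have T_smult: "T j (c \<cdot>\<^sub>v x) = c * T j x" if "x \<in> carrier_vec n" for j c x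
    using that by (simp add: T_def Th_smult)
  have T_unit: "T j x = (\<Sum>r<n. x $ r * T j (unit_vec n r))" if "x \<in> carrier_vec n" for j x
    using Th_unit[OF that, of j] by (simp add: T_def sum_divide_distrib)
  have K_zf: "c \<in> zfield z" if "c \<in> K" for c using that K_eq C.G.K_L by blast
  \<comment> \<open>Vectors on which the functionals T j are the conjugates of T 0. They form a
    K-subspace stable under A and B that contains u, hence all of K^n; so T 0 maps K^n into L and
    turns B into the automorphism.\<close>
  define U where "U = {x\<in>KV. T 0 x \<in> zfield z \<and> (\<forall>j. T j x = (gal z k' ^^ j) (T 0 x))}"
  have KV_eq: "KV = {x\<in>carrier_vec n. \<forall>i<n. x $ i \<in> K}" by (rule KV_def)
  have zeroKV: "0\<^sub>v n \<in> KV" by (simp add: KV_def K.zero_in)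
  have gal0: "(gal z k' ^^ j) 0 = 0" for j by (rule funpow_gal_K[OF K.zero_in])
  have "U = {0\<^sub>v n} \<or> U = KV"
    unfolding KV_eq
  proof (rule irreducible[OF K_subfield])
    show "U \<subseteq> {x\<in>carrier_vec n. \<forall>i<n. x $ i \<in> K}" unfolding U_def KV_eq by blast
    show "0\<^sub>v n \<in> U" using zeroKV by (simp add: U_def T_def Th_zero zf.zero_in gal0)
    show "x + y \<in> U" if xy: "x \<in> U" "y \<in> U" for x y
    proof -
      have x: "x \<in> KV" "T 0 x \<in> zfield z" "\<And>j. T j x = (gal z k' ^^ j) (T 0 x)" using xy unfolding U_def by blast+
      have y: "y \<in> KV" "T 0 y \<in> zfield z" "\<And>j. T j y = (gal z k' ^^ j) (T 0 y)" using xy unfolding U_def by blast+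
      note T = T_add[OF KV_carrier[OF x(1)] KV_carrier[OF y(1)]]
      have "T j (x + y) = (gal z k' ^^ j) (T 0 (x + y))" for j
        unfolding T funpow_gal_add[OF x(2) y(2)] by (simp only: x(3)[of j] y(3)[of j])
      moreover have "T 0 (x + y) \<in> zfield z" unfolding T by (rule zf.add_in[OF x(2) y(2)])
      ultimately show ?thesis using KV_add[OF x(1) y(1)] unfolding U_def by blast
    qed
    show "c \<cdot>\<^sub>v x \<in> U" if cx: "c \<in> K" "x \<in> U" for c x
    proof -
      have x: "x \<in> KV" "T 0 x \<in> zfield z" "\<And>j. T j x = (gal z k' ^^ j) (T 0 x)" using cx unfolding U_def by blast+
      note T = T_smult[OF KV_carrier[OF x(1)]]
      have "T j (c \<cdot>\<^sub>v x) = (gal z k' ^^ j) (T 0 (c \<cdot>\<^sub>v x))" for j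
        unfolding T funpow_gal_mult[OF K_zf[OF cx(1)] x(2)] funpow_gal_K[OF cx(1)] by (simp only: x(3)[of j])
      moreover have "T 0 (c \<cdot>\<^sub>v x) \<in> zfield z" unfolding T by (rule zf.mult_in[OF K_zf[OF cx(1)] x(2)])
      ultimately show ?thesis using KV_smult[OF cx(1) x(1)] unfolding U_def by blast
    qed
    show "\<alpha> x \<in> U" if "x \<in> U" for x
    proof -
      have x: "x \<in> KV" "T 0 x \<in> zfield z" "\<And>j. T j x = (gal z k' ^^ j) (T 0 x)" using that unfolding U_def by blast+
      have T: "T j (\<alpha> x) = zc j * T j x" for j using KV_carrier[OF x(1)] by (simp add: T_def Th_alpha)
      have T0: "T 0 (\<alpha> x) = z * T 0 x" unfolding T by simp
      have "T j (\<alpha> x) = (gal z k' ^^ j) (T 0 (\<alpha> x))" for j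
      proof -
        have "T j (\<alpha> x) = zc j * (gal z k' ^^ j) (T 0 x)" unfolding T by (simp only: x(3)[of j])
        also have "\<dots> = (gal z k' ^^ j) (z * T 0 x)"
          by (simp only: funpow_gal_mult[OF C.z_zfield x(2)] C.funpow_gal_z)
        finally show ?thesis by (simp only: T0)
      qed
      moreover have "T 0 (\<alpha> x) \<in> zfield z" unfolding T0 by (rule zf.mult_in[OF C.z_zfield x(2)])
      moreover have "\<alpha> x \<in> KV" using KV_alpha[OF x(1), of 1] by simp
      ultimately show ?thesis unfolding U_def by blast
    qed
    show "\<beta> x \<in> U" if "x \<in> U" for x
    proof -
      have x: "x \<in> KV" "T 0 x \<in> zfield z" "\<And>j. T j x = (gal z k' ^^ j) (T 0 x)" using that unfolding U_def by blast+
      have T: "T j (\<beta> x) = T (Suc j) x" for j by (simp add: T_def Th_beta)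
      have "T j (\<beta> x) = (gal z k' ^^ j) (T 0 (\<beta> x))" for j
        unfolding T x(3)[of "Suc j"] x(3)[of "Suc 0"]
        by (simp only: funpow_Suc_right o_apply funpow_0)
      moreover have "T 0 (\<beta> x) \<in> zfield z" unfolding T x(3)[of "Suc 0"] using x(2) by (simp add: C.gal_zfield)
      moreover have "\<beta> x \<in> KV" using KV_beta[OF x(1), of 1] by simp
      ultimately show ?thesis unfolding U_def by blast
    qed
  qed simp
  moreover have "u \<in> U" using u funpow_gal_K[OF K.one_in] by (simp add: U_def T_def zf.one_in)
  moreover have "u \<noteq> 0\<^sub>v n" using u(2) u(3)[of 0] Th_zero[of 0] by auto
  ultimately have U: "U = KV" by blast
  have T_zf: "T 0 x \<in> zfield z" and T_gal: "T j x = (gal z k' ^^ j) (T 0 x)" if "x \<in> KV" for x j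
  proof -
    have "x \<in> U" using that by (simp only: U)
    then show "T 0 x \<in> zfield z" "T j x = (gal z k' ^^ j) (T 0 x)" unfolding U_def by blast+
  qed
  \<comment> \<open>The kernel of T 0 on K^n. It is stable under B because T 1 is the conjugate of T
    0, so irreducibility over K makes T 0 injective.\<close>
  define W where "W = {x\<in>KV. T 0 x = 0}"
  have "W = {0\<^sub>v n} \<or> W = KV"
    unfolding KV_eq
  proof (rule irreducible[OF K_subfield])
    show "W \<subseteq> {x\<in>carrier_vec n. \<forall>i<n. x $ i \<in> K}" unfolding W_def KV_eq by blast
    show "0\<^sub>v n \<in> W" using zeroKV by (simp add: W_def T_def Th_zero)
    show "x + y \<in> W" if "x \<in> W" "y \<in> W" for x y
      using that by (auto simp: W_def T_add KV_carrier KV_add)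
    show "c \<cdot>\<^sub>v x \<in> W" if "c \<in> K" "x \<in> W" for c x
      using that by (auto simp: W_def T_smult KV_carrier KV_smult)
    show "\<alpha> x \<in> W" if "x \<in> W" for x
      using that KV_alpha[of x 1] by (auto simp: W_def T_def Th_alpha KV_carrier)
    show "\<beta> x \<in> W" if "x \<in> W" for x
    proof -
      have x: "x \<in> KV" "T 0 x = 0" using that by (auto simp: W_def)
      have "T 0 (\<beta> x) = T 1 x" by (simp add: T_def Th_beta)
      also have "\<dots> = 0" using T_gal[OF x(1), of 1] x(2) gal0[of 1] by simp
      finally show ?thesis using KV_beta[OF x(1), of 1] by (simp add: W_def)
    qed
  qed simp
  moreover have "u \<notin> W" using u by (simp add: W_def T_def)
  ultimately have W: "W = {0\<^sub>v n}" using u(1) by blast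
  define E where "E r = T 0 (unit_vec n r)" for r
  have T_E: "T 0 x = (\<Sum>r<n. x $ r * E r)" if "x \<in> carrier_vec n" for x
    using T_unit[OF that, of 0] by (simp add: E_def)
  have "C.G.K_basis n E"
    unfolding C.G.K_basis_def K_eq
  proof (intro conjI allI impI ballI)
    show "E i \<in> zfield z" for i unfolding E_def by (intro T_zf KV_unit)
    show "\<exists>c. (\<forall>i<n. c i \<in> K) \<and> x = (\<Sum>i<n. c i * E i)" if x: "x \<in> zfield z" for x
    proof -
      define c where "c = C.G.coord N (\<lambda>i. z ^ i) x"
      have c: "\<And>i. i < N \<Longrightarrow> c i \<in> K" "x = (\<Sum>i<N. c i * z ^ i)"
        using C.G.coord[OF C.z_basis x] K_eq unfolding c_def by auto
      \<comment> \<open>A preimage of x: since T 0 u = 1, the vector A^i u is sent to z^i.\<close>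
      define y where "y = vec n (\<lambda>r. \<Sum>i<N. c i * ((\<alpha> ^^ i) u) $ r)"
      have y: "y \<in> KV" unfolding y_def by (intro KV_sum c KV_alpha u)
      have "Th 0 y = (\<Sum>i<N. c i * Th 0 ((\<alpha> ^^ i) u))"
        unfolding y_def by (intro Th_sum alpha_carrier uc)
      then have "T 0 y = x" using u(2) unfolding T_def c(2)
        by (simp add: Th_alpha_pow uc u(3) sum_divide_distrib)
      then show ?thesis using T_E[OF KV_carrier[OF y]] y by (auto simp: KV_def)
    qed
    fix c i assume c: "\<forall>i<n. c i \<in> K" "(\<Sum>i<n. c i * E i) = 0" and i: "i < n"
    define y where "y = vec n c"
    have y: "y \<in> KV" using c(1) by (simp add: y_def KV_def)
    have "T 0 y = 0" using T_E[OF KV_carrier[OF y]] c(2) by (simp add: y_def)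
    then have "y \<in> W" using y by (simp add: W_def)
    then have "y = 0\<^sub>v n" using W by simp
    then show "c i = 0" using i by (metis y_def index_vec index_zero_vec(1))
  qed
  moreover have "z * E j = (\<Sum>i<n. A $$ (i, j) * E i)" if j: "j < n" for j
  proof -
    have "z * E j = T 0 (\<alpha> (unit_vec n j))"
      using Th_alpha[of "unit_vec n j" 0] by (simp add: E_def T_def)
    also have "\<dots> = (\<Sum>i<n. (\<alpha> (unit_vec n j)) $ i * E i)"
      using alpha_carrier[of "unit_vec n j" 1] by (intro T_E) simp
    also have "\<dots> = (\<Sum>i<n. A $$ (i, j) * E i)"
      using j A_carrier by (intro sum.cong) (auto simp: \<alpha>_def mat_mult_unit_vec)
    finally show ?thesis .
  qed
  moreover have "gal z k' (E j) = (\<Sum>i<n. B $$ (i, j) * E i)" if j: "j < n" for j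
  proof -
    have "gal z k' (E j) = T 1 (unit_vec n j)"
      using T_gal[OF KV_unit, of 1 j] by (simp add: E_def)
    also have "\<dots> = T 0 (\<beta> (unit_vec n j))" by (simp add: T_def Th_beta)
    also have "\<dots> = (\<Sum>i<n. (\<beta> (unit_vec n j)) $ i * E i)"
      using beta_carrier[of "unit_vec n j" 1] by (intro T_E) simp
    also have "\<dots> = (\<Sum>i<n. B $$ (i, j) * E i)"
      using j B_carrier by (intro sum.cong) (auto simp: \<beta>_def mat_mult_unit_vec)
    finally show ?thesis .
  qed
  ultimately show ?thesis by blast
qed

lemma L_eq:
  assumes \<eta>: "\<eta> ^ M = 1" "\<forall>d. 0 < d \<and> d < M \<longrightarrow> \<eta> ^ d \<noteq> 1"
  shows "generate_field class_ring (insert \<eta> K) = zfield z"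
proof -
  let ?L = "generate_field class_ring (insert \<eta> K)"
  interpret eta: prim_root \<eta> M using \<eta> M_pos by unfold_locales auto
  have R: "zring \<eta> = zring z" by (rule C.zring_root_eq) (rule eta.prim_root_axioms)
  have sub: "subfield ?L class_ring" using field.generate_field_is_subfield[OF class_field] by simp
  interpret L: csubring ?L by (rule subfield_closed(1)[OF sub])
  show ?thesis
  proof (intro equalityI subsetI)
    fix x assume "x \<in> ?L"
    then show "x \<in> zfield z"
    proof (induction rule: generate_field.induct)
      case one
      then show ?case using zf.one_in by (simp add: class_ring_simps)
    next
      case (incl y)
      then show ?case using self_in_zring[of \<eta>] R zring_zfield K_subset C.G.K_L by blast
    next
      case (a_inv y)
      then show ?case using zf.minus_in by (simp add: class_ring_simps)
    next
      case (m_inv y)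
      then have "inv\<^bsub>class_ring\<^esub> y = inverse y" by (intro inv_class_ring) simp
      then show ?case using C.zfield_inverse[OF m_inv.IH] by (simp only:)
    next
      case (eng_add y y')
      then show ?case using zf.add_in by (simp add: class_ring_simps)
    next
      case (eng_mult y y')
      then show ?case using zf.mult_in by (simp add: class_ring_simps)
    qed
  next
    fix x assume "x \<in> zfield z"
    then obtain m where m: "m > 0" "of_nat m * x \<in> zring \<eta>" using R by (auto simp: zfield_def)
    have \<eta>L: "\<eta> \<in> ?L" by (intro generate_field.incl) simp
    have mx: "of_nat m * x \<in> ?L"
      using m(2) \<eta>L by (auto simp: zring_def coeff_map_poly intro!: L.poly_in L.of_int_in)
    have "inverse (of_nat m) * (of_nat m * x) \<in> ?L"
      by (rule L.mult_in[OF subfield_closed(2)[OF sub L.of_nat_in] mx])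
    also have "inverse (of_nat m) * (of_nat m * x) = x" using m(1) by (simp flip: mult.assoc)
    finally show "x \<in> ?L" .
  qed
qed

end

lemma (in galois_completion) map_mat_iota_mult:
  assumes X: "X \<in> carrier_mat n n" "\<And>i j. i < n \<Longrightarrow> j < n \<Longrightarrow> X $$ (i, j) \<in> K"
    and Y: "Y \<in> carrier_mat n n" "\<And>i j. i < n \<Longrightarrow> j < n \<Longrightarrow> Y $$ (i, j) \<in> K"
  shows "map_mat \<iota> (X * Y) = map_mat \<iota> X * map_mat \<iota> Y"
proof (rule eq_matI)
  fix i j assume "i < dim_row (map_mat \<iota> X * map_mat \<iota> Y)" "j < dim_col (map_mat \<iota> X * map_mat \<iota> Y)"
  then have ij: "i < n" "j < n" using X Y by auto
  have "\<iota> ((X * Y) $$ (i, j)) = \<iota> (\<Sum>r<n. X $$ (i, r) * Y $$ (r, j))"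
    using ij X(1) Y(1) by (simp add: scalar_prod_def atLeast0LessThan)
  also have "\<dots> = (\<Sum>r<n. \<iota> (X $$ (i, r) * Y $$ (r, j)))"
    using ij X(2) Y(2) by (intro iota_sum K.mult_in) auto
  also have "\<dots> = (\<Sum>r<n. \<iota> (X $$ (i, r)) * \<iota> (Y $$ (r, j)))"
    using ij X(2) Y(2) by (intro sum.cong) (auto simp: iota_mult)
  finally show "map_mat \<iota> (X * Y) $$ (i, j) = (map_mat \<iota> X * map_mat \<iota> Y) $$ (i, j)"
    using ij X(1) Y(1) by (simp add: scalar_prod_def atLeast0LessThan)
qed (use X Y in auto)

theorem theorem3:
  fixes N M n :: nat and k :: int
    and \<phi> :: "gen word set \<Rightarrow> complex mat"
    and K L p :: "complex set" and \<eta> :: complex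
    and \<iota> :: "complex \<Rightarrow> 'f::field" and v :: "'f \<Rightarrow> int" and \<pi> :: 'f
    and S :: "'f vec set set set"
  assumes "N \<ge> 1" and "M \<ge> 1" and "coprime k (int M)"
    and "ord (int M) k = N"
    and "number_field K"
    and "\<phi> \<in> hom (metacyclic N M k) (GL K n)"
    and "inj_on \<phi> (carrier (metacyclic N M k))"
    and "absolutely_irreducible K n (metacyclic N M k) \<phi>"
    and "is_the_field_of_definition K n (metacyclic N M k) \<phi>"
    and "\<eta> ^ M = 1" and "\<forall>d. 0 < d \<and> d < M \<longrightarrow> \<eta> ^ d \<noteq> 1"
    and "L = generate_field class_ring (insert \<eta> K)"
    and "finite_place K p"
    and "completion_at K p \<iota> v"
    and "uniformizer v \<pi>"
    and "S = vertices_containing v n ((\<lambda>h. map_mat \<iota> (\<phi> h)) ` carrier (metacyclic N M k))"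
  shows "bt_simplex v \<pi> n S
    \<and> (card S > 1 \<longleftrightarrow> ramified L K p)
    \<and> (ramified L K p \<longrightarrow> (\<forall>q. lies_over L q K p \<longrightarrow> card S = ramification_index L q p))"
proof -
  interpret rep: metacyclic_rep N M n k \<phi> K
    using assms(1-9) by unfold_locales
  obtain w z where w: "w \<in> carrier_vec n" "w \<noteq> 0\<^sub>v n"
    "\<forall>x\<in>carrier_vec n. w \<bullet> rep.\<alpha> x = z * (w \<bullet> x)"
    using rep.ex_left_eigenvector by blast
  interpret rep: metacyclic_eigen N M n k \<phi> K w z
    using w by unfold_locales auto
  have K: "K = rep.C.G.K" by (rule rep.K_eq[symmetric])
  have L: "L = zfield z" unfolding assms(12) by (rule rep.L_eq[OF assms(10,11)])
  obtain E where E: "rep.C.G.K_basis n E" "\<And>j. j < n \<Longrightarrow> z * E j = (\<Sum>i<n. rep.A $$ (i, j) * E i)"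
    "\<And>j. j < n \<Longrightarrow> gal z rep.k' (E j) = (\<Sum>i<n. rep.B $$ (i, j) * E i)"
    using rep.ex_basis by blast
  interpret comp: galois_completion "zring z" "zfield z" "gal z rep.k'" N p \<iota> v
    using assms(13-15) unfolding K
    by (intro galois_completion.intro rep.C.G.integral_galois_axioms galois_completion_axioms.intro) auto
  \<comment> \<open>The residue characteristic of the place, to which l, Q and d are
    attached.\<close>
  obtain p' where p': "prime p'" "of_nat p' \<in> comp.P'" using comp.residue_prime by blast
  obtain l Q d where fo: "frobenius_order (zring z) (zfield z) (gal z rep.k') N p' l Q d"
    using rep.C.ex_frobenius_order[OF p'(1)] by blast
  interpret fc: frobenius_completion "zring z" "zfield z" "gal z rep.k'" N p \<iota> v p' l Q d
    by (intro frobenius_completion.intro fo comp.galois_completion_axioms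
        frobenius_completion_axioms.intro p'(2))
  interpret sl: stable_lattices "zring z" "zfield z" "gal z rep.k'" N p \<iota> v p' l Q d n z E rep.A rep.B
  proof (unfold_locales, goal_cases)
    case 1 show ?case by (rule self_in_zring)
  next
    case (2 x) then show ?case using rep.C.zring_generators unfolding rep.n_eq_N by blast
  next
    case 3 show ?case unfolding rep.n_eq_N by (rule rep.C.z_basis)
  next
    case 4 show ?case by (rule E)
  next
    case 5 show ?case by (rule rep.A_carrier)
  next
    case (6 i j) then show ?case using rep.A_K K by simp
  next
    case 7 show ?case by (rule rep.B_carrier)
  next
    case (8 i j) then show ?case using rep.B_K K by simp
  next
    case (9 j) then show ?case by (rule E)
  next
    case (10 j) then show ?case by (rule E)
  qed
  let ?X = "(\<lambda>h. map_mat \<iota> (\<phi> h)) ` carrier rep.H"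
  have "bt_simplex v \<pi> n (vertices_containing v n ?X) \<and> card (vertices_containing v n ?X) = nat fc.e"
  proof (rule sl.stable_simplex[OF assms(15)])
    show "?X \<subseteq> carrier_mat n n" using rep.phi_carrier by auto
    show "map_mat \<iota> rep.A \<in> ?X" "map_mat \<iota> rep.B \<in> ?X"
      unfolding rep.A_def rep.B_def using rep.cls_carrier by blast+
    fix Y :: "'f vec set" and X y
    assume Y: "Y \<subseteq> carrier_vec n" "\<And>y. y \<in> Y \<Longrightarrow> map_mat \<iota> rep.A *\<^sub>v y \<in> Y"
      "\<And>y. y \<in> Y \<Longrightarrow> map_mat \<iota> rep.B *\<^sub>v y \<in> Y" and X: "X \<in> ?X" and y: "y \<in> Y"
    obtain h where h: "h \<in> carrier rep.H" "X = map_mat \<iota> (\<phi> h)" using X by blast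
    have "\<forall>y\<in>Y. map_mat \<iota> (\<phi> h) *\<^sub>v y \<in> Y"
      using h(1) rep.N_pos rep.M_pos
    proof (rule metacyclic_induct)
      have "map_mat \<iota> (1\<^sub>m n) = 1\<^sub>m n"
        by (intro eq_matI) (auto simp: comp.iota_one comp.iota_zero)
      then show "\<forall>y\<in>Y. map_mat \<iota> (\<phi> \<one>\<^bsub>rep.H\<^esub>) *\<^sub>v y \<in> Y"
        using Y(1) by (auto simp: metacyclic_one rep.phi_Nil)
      show "\<forall>y\<in>Y. map_mat \<iota> (\<phi> (gen_class N M k Gen_a)) *\<^sub>v y \<in> Y" using Y(2) by (simp add: rep.A_def)
      show "\<forall>y\<in>Y. map_mat \<iota> (\<phi> (gen_class N M k Gen_b)) *\<^sub>v y \<in> Y" using Y(3) by (simp add: rep.B_def)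
      fix g g' assume g: "g \<in> carrier rep.H" "g' \<in> carrier rep.H"
        "\<forall>y\<in>Y. map_mat \<iota> (\<phi> g) *\<^sub>v y \<in> Y" "\<forall>y\<in>Y. map_mat \<iota> (\<phi> g') *\<^sub>v y \<in> Y"
      have eq: "map_mat \<iota> (\<phi> (g \<otimes>\<^bsub>rep.H\<^esub> g')) = map_mat \<iota> (\<phi> g) * map_mat \<iota> (\<phi> g')"
        unfolding rep.phi_mult[OF g(1,2)]
        using g(1,2) rep.phi_K K by (intro comp.map_mat_iota_mult[where n = n] rep.phi_carrier) auto
      have "map_mat \<iota> (\<phi> (g \<otimes>\<^bsub>rep.H\<^esub> g')) *\<^sub>v y = map_mat \<iota> (\<phi> g) *\<^sub>v (map_mat \<iota> (\<phi> g') *\<^sub>v y)" if "y \<in> Y" for y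
        unfolding eq using rep.phi_carrier[OF g(1)] rep.phi_carrier[OF g(2)] that Y(1)
        by (intro assoc_mult_mat_vec) auto
      then show "\<forall>y\<in>Y. map_mat \<iota> (\<phi> (g \<otimes>\<^bsub>rep.H\<^esub> g')) *\<^sub>v y \<in> Y" using g(3,4) by simp
    qed
    then show "X *\<^sub>v y \<in> Y" using y h(2) by blast
  qed
  then have S: "bt_simplex v \<pi> n S" "card S = nat fc.e" unfolding assms(16) by blast+
  have ram: "ramification_index L q p = nat fc.e" if "lies_over L q K p" for q
    using that fc.ramification_index_eq unfolding L K by blast
  moreover obtain q where "lies_over L q K p" using fc.ex_lies_over unfolding L K by blast
  \<comment> \<open>All primes above the place have the same index, and at least one exists, so the
    existential in \<open>ramified\<close> comes down to e > 1.\<close>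
  ultimately have "ramified L K p \<longleftrightarrow> nat fc.e > 1" unfolding ramified_def by metis
  with S ram show ?thesis by simp
qed

end
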